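(* Let $V:f=0$ be a free hypersurface in $\mathbb{P}^n$ with exponents $(d_1,\ldots,d_n)$ and $d=\deg f$. Then the singular subscheme $\Sigma$ of $V$ has dimension $n-2$ and its degree is given by $$\deg\Sigma=(d-1)^2-s_2,\qquad\text{where } s_2=\sum_{1\le i<j\le n}d_id_j.$$ Moreover, let $V':f'=0$ in $\mathbb{P}^n$ be a hypersurface of degree $d'$ which is tame with respect to the subset $\hat\rho'=(\rho_1',\ldots,\rho_{n-1}')$ of a minimal set of homogeneous generators $\rho'_1,\ldots,\rho'_m$ of $D_0(f')$, with exponents $(d_1',\ldots,d_m')$, $d'_j=\deg\rho'_j$ (not assumed ordered), for some $m\ge n$. If the singular subscheme $\Sigma'$ of $V'$ has dimension $n-2$, then $$\deg\Sigma'\le (d'-1)^2-\sum_{1\le i<j\le n}d_i'd_j',$$ where in the last sum $d_n'$ is replaced by $$d_n''=d'-1-\sum_{j=1}^{n-1}d_j'.$$ The equality holds here if and only if $V'$ is free, and hence in particular $m=n$.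
   Context: Let $n\ge 2$, $S=\mathbb{C}[x_0,\ldots,x_n]$ with the standard grading. All hypersurfaces $V:f=0$ in $\mathbb{P}^n$ considered are reduced ($f\in S$ homogeneous of degree $d$ and square-free), of degree $d\ge 3$, and not cones over a hypersurface in $\mathbb{P}^{n-1}$. Write $f_j=\partial f/\partial x_j$, $J_f=(f_0,\ldots,f_n)$, $M(f)=S/J_f$, and $$D_0(f)=\{\rho=(a_0,\ldots,a_n)\in S^{n+1}: \sum_{j=0}^n a_jf_j=0\},$$ a graded $S$-module of rank $n$, where a syzygy $\rho$ is homogeneous of degree $e$ if all its components are homogeneous of degree $e$. The exponents of $V$ are the degrees $d_1,\ldots,d_m$ of a minimal set of homogeneous generators $\rho_1,\ldots,\rho_m$ of $D_0(f)$; one has $m\ge n$, and $V$ is free if $m=n$ (equivalently, $D_0(f)$ is a free $S$-module). The singular subscheme $\Sigma$ of $V$ is the subscheme of $\mathbb{P}^n$ defined by $J_f$; with $s=\dim\Sigma\le n-2$, its degree $\deg\Sigma$ is defined by the Hilbert polynomial of $M(f)$ having the form $\frac{\deg(\Sigma)}{s!}t^s+(\text{lower degree terms})$. For $\hat\rho=(\rho_1,\ldots,\rho_{n-1})$ a subset of a minimal set of homogeneous generators of $D_0(f)$ (no ordering of the degrees assumed), consider the sequence $$0\to S(-d_1)\oplus\cdots\oplus S(-d_{n-1})\xrightarrow{u} D_0(f)\xrightarrow{v} B(f,\hat\rho)(d_1+\ldots+d_{n-1}-d+1)\to 0,\qquad( * )$$ where $u(a_1,\ldots,a_{n-1})=\sum_{j=1}^{n-1}a_j\rho_j$,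 and, for $\rho\in D_0(f)$, $v(\rho)=\det M(\hat\rho,\rho)/f$, where $M(\hat\rho,\rho)$ is the $(n+1)\times(n+1)$-matrix whose first row is $(x_0,\ldots,x_n)$, whose $j$-th row for $2\le j\le n$ consists of the components of $\rho_{j-1}$, and whose last row consists of the components of $\rho$ (this determinant is divisible by $f$). Here $B(f,\hat\rho)\subset S$ is the homogeneous ideal $\{v(\rho):\rho\in D_0(f)\}$ (the image of $v$, with degrees shifted so that it is a graded ideal of $S$). $V$ is tame with respect to $\hat\rho$ if the sequence $( * )$ is exact. *)

theory Defs
  imports
    "HOL-Analysis.Analysis"
    "HOL-Library.Poly_Mapping"
    "HOL-Computational_Algebra.Polynomial"
    "HOL-Computational_Algebra.Squarefree"
begin

section \<open>The polynomial ring\<close>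

text \<open>The variables \<open>x\<^sub>0, \<dots>, x\<^sub>n\<close> are indexed by a finite linearly ordered type \<open>'n\<close> with
  \<open>n + 1\<close> elements, so that \<open>S\<close> is the whole type \<open>'n cpoly\<close> and \<open>S^(n+1)\<close> is \<open>'n cpoly_vec\<close>.
  A monomial is its exponent vector \<open>'n \<Rightarrow>\<^sub>0 nat\<close>.\<close>

type_synonym 'n cpoly = "('n \<Rightarrow>\<^sub>0 nat) \<Rightarrow>\<^sub>0 complex"

type_synonym 'n cpoly_vec = "('n cpoly, 'n) vec"

abbreviation coef :: "'n cpoly \<Rightarrow> ('n \<Rightarrow>\<^sub>0 nat) \<Rightarrow> complex" where
  "coef \<equiv> Poly_Mapping.lookup"

definition Const :: "complex \<Rightarrow> 'n cpoly" where
  "Const c = Poly_Mapping.single 0 c"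

definition Var :: "'n \<Rightarrow> 'n cpoly" where
  "Var i = Poly_Mapping.single (Poly_Mapping.single i 1) 1"

definition mon_degree :: "('n::finite \<Rightarrow>\<^sub>0 nat) \<Rightarrow> nat" where
  "mon_degree m = (\<Sum>i\<in>UNIV. Poly_Mapping.lookup m i)"

definition homogeneous :: "nat \<Rightarrow> ('n::finite) cpoly \<Rightarrow> bool" where
  "homogeneous e p \<longleftrightarrow> (\<forall>m\<in>Poly_Mapping.keys p. mon_degree m = e)"

text \<open>The truncated subtraction \<open>m - single j 1\<close> does no harm: if \<open>x\<^sub>j\<close> does not divide the
  monomial, the coefficient is \<open>0\<close>.\<close>

definition partial_deriv :: "'n \<Rightarrow> 'n cpoly \<Rightarrow> 'n cpoly" where
  "partial_deriv j p = (\<Sum>m\<in>Poly_Mapping.keys p.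
     Poly_Mapping.single (m - Poly_Mapping.single j 1)
       (of_nat (Poly_Mapping.lookup m j) * coef p m))"

definition linear_subst :: "complex ^ 'n ^ 'n \<Rightarrow> ('n::finite) cpoly \<Rightarrow> 'n cpoly" where
  "linear_subst A p = (\<Sum>m\<in>Poly_Mapping.keys p. Const (coef p m) *
     (\<Prod>i\<in>UNIV. (\<Sum>k\<in>UNIV. Const (A $ i $ k) * Var k) ^ Poly_Mapping.lookup m i))"

global_interpretation S_ideal: module "(*) :: 'n cpoly \<Rightarrow> 'n cpoly \<Rightarrow> 'n cpoly"
  by unfold_locales (simp_all add: algebra_simps)

global_interpretation S_vec:
  module "(*s) :: 'n cpoly \<Rightarrow> 'n cpoly ^ ('n::finite) \<Rightarrow> 'n cpoly ^ 'n"
  by unfold_locales (simp_all add: vec_eq_iff algebra_simps)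


section \<open>Hypersurfaces\<close>

text \<open>A cone over a hypersurface in \<open>P^(n-1)\<close>: after a linear change of coordinates, some
  variable does not occur in the equation.\<close>

definition is_cone :: "('n::finite) cpoly \<Rightarrow> bool" where
  "is_cone f \<longleftrightarrow> (\<exists>A. invertible A \<and>
     (\<exists>j. \<forall>m\<in>Poly_Mapping.keys (linear_subst A f). Poly_Mapping.lookup m j = 0))"

text \<open>\<open>hypersurface d f\<close> collects the standing assumptions on \<open>V : f = 0\<close>; square-freeness
  excludes \<open>f = 0\<close>.\<close>

definition hypersurface :: "nat \<Rightarrow> ('n::finite) cpoly \<Rightarrow> bool" where
  "hypersurface d f \<longleftrightarrow> homogeneous d f \<and> squarefree f \<and> 3 \<le> d \<and> \<not> is_cone f"

definition jacobian_ideal :: "('n::finite) cpoly \<Rightarrow> 'n cpoly set" where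
  "jacobian_ideal f = S_ideal.span (range (\<lambda>j. partial_deriv j f))"


section \<open>Dimension and degree of the projective scheme of a homogeneous ideal\<close>

definition homogeneous_ideal :: "('n::finite) cpoly set \<Rightarrow> bool" where
  "homogeneous_ideal I \<longleftrightarrow> S_ideal.subspace I \<and> I = S_ideal.span {p \<in> I. \<exists>e. homogeneous e p}"

definition prime_ideal :: "'n cpoly set \<Rightarrow> bool" where
  "prime_ideal P \<longleftrightarrow> S_ideal.subspace P \<and> P \<noteq> UNIV \<and> (\<forall>a b. a * b \<in> P \<longrightarrow> a \<in> P \<or> b \<in> P)"

text \<open>The points of \<open>Proj (S/I)\<close>, as homogeneous prime ideals of \<open>S\<close>.\<close>

definition proj_points :: "('n::finite) cpoly set \<Rightarrow> 'n cpoly set set" where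
  "proj_points I = {P. homogeneous_ideal P \<and> prime_ideal P \<and> I \<subseteq> P \<and> \<not> range Var \<subseteq> P}"

text \<open>The Krull dimension of \<open>Proj (S/I)\<close>; the empty scheme has dimension \<open>-1\<close>. Chains
  have length at most \<open>n\<close>, so the supremum is that of a bounded set.\<close>

definition proj_dimension :: "('n::finite) cpoly set \<Rightarrow> int" where
  "proj_dimension I = Sup (insert (- 1) {int s | s. \<exists>P :: nat \<Rightarrow> 'n cpoly set.
     (\<forall>i\<le>s. P i \<in> proj_points I) \<and> (\<forall>i<s. P i \<subset> P (Suc i))})"

text \<open>\<open>B\<close> is a finite subset of the complex vector space \<open>V\<close> whose classes form a basis
  of \<open>V / (V \<inter> W)\<close>; by uniqueness of the coefficients these classes are pairwise distinct.\<close>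

definition quotient_basis :: "'n cpoly set \<Rightarrow> 'n cpoly set \<Rightarrow> 'n cpoly set \<Rightarrow> bool" where
  "quotient_basis V W B \<longleftrightarrow> finite B \<and> B \<subseteq> V \<and>
     (\<forall>p\<in>V. \<exists>!c :: 'n cpoly \<Rightarrow> complex.
        (\<forall>b. b \<notin> B \<longrightarrow> c b = 0) \<and> p - (\<Sum>b\<in>B. Const (c b) * b) \<in> W)"

definition quotient_dim :: "'n cpoly set \<Rightarrow> 'n cpoly set \<Rightarrow> nat" where
  "quotient_dim V W = (THE k. \<exists>B. quotient_basis V W B \<and> card B = k)"

text \<open>The Hilbert function and the Hilbert polynomial of the graded module \<open>S/I\<close>.\<close>

definition hilbert_function :: "('n::finite) cpoly set \<Rightarrow> nat \<Rightarrow> nat" where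
  "hilbert_function I t = quotient_dim {p. homogeneous t p} I"

definition hilbert_polynomial :: "('n::finite) cpoly set \<Rightarrow> real poly" where
  "hilbert_polynomial I =
     (THE h. \<forall>\<^sub>F t in sequentially. poly h (real t) = real (hilbert_function I t))"

text \<open>The Hilbert polynomial has the form \<open>deg / s! * t^s + lower terms\<close>, \<open>s\<close> the dimension.\<close>

definition proj_degree :: "('n::finite) cpoly set \<Rightarrow> real" where
  "proj_degree I = (let s = nat (proj_dimension I) in fact s * coeff (hilbert_polynomial I) s)"

abbreviation sing_dimension :: "('n::finite) cpoly \<Rightarrow> int" where
  "sing_dimension f \<equiv> proj_dimension (jacobian_ideal f)"

abbreviation sing_degree :: "('n::finite) cpoly \<Rightarrow> real" where
  "sing_degree f \<equiv> proj_degree (jacobian_ideal f)"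


section \<open>Syzygies, exponents and freeness\<close>

definition D0 :: "('n::finite) cpoly \<Rightarrow> 'n cpoly_vec set" where
  "D0 f = {\<rho>. (\<Sum>j\<in>UNIV. \<rho> $ j * partial_deriv j f) = 0}"

definition homogeneous_vec :: "nat \<Rightarrow> ('n::finite) cpoly_vec \<Rightarrow> bool" where
  "homogeneous_vec e \<rho> \<longleftrightarrow> (\<forall>j. homogeneous e (\<rho> $ j))"

text \<open>\<open>rs = [\<rho>\<^sub>1, \<dots>, \<rho>\<^sub>m]\<close> enumerates a minimal set of homogeneous generators of \<open>D\<^sub>0(f)\<close>, with
  degrees \<open>ds = [d\<^sub>1, \<dots>, d\<^sub>m]\<close> in no particular order. By minimality all \<open>\<rho>\<^sub>i\<close> are nonzero, so
  \<open>ds\<close> is determined by \<open>rs\<close>.\<close>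

definition minimal_generators ::
    "('n::finite) cpoly \<Rightarrow> 'n cpoly_vec list \<Rightarrow> nat list \<Rightarrow> bool" where
  "minimal_generators f rs ds \<longleftrightarrow>
     distinct rs \<and> list_all2 homogeneous_vec ds rs \<and>
     S_vec.span (set rs) = D0 f \<and>
     (\<forall>R. R \<subset> set rs \<longrightarrow> S_vec.span R \<noteq> D0 f)"

definition exponents :: "('n::finite) cpoly \<Rightarrow> nat list \<Rightarrow> bool" where
  "exponents f ds \<longleftrightarrow> (\<exists>rs. minimal_generators f rs ds)"

text \<open>Freeness means \<open>m = n\<close>, where \<open>n + 1\<close> is the number of variables.\<close>

definition free_hypersurface :: "('n::finite) cpoly \<Rightarrow> bool" where
  "free_hypersurface f \<longleftrightarrow> (\<exists>ds. exponents f ds \<and> length ds = CARD('n) - 1)"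


section \<open>Tame hypersurfaces\<close>

text \<open>Here \<open>rs = [\<rho>\<^sub>1, \<dots>, \<rho>\<^sub>n\<^sub>-\<^sub>1]\<close>. The rows of the determinant are listed in order and
  row \<open>i :: 'n\<close> is the one at the position of \<open>i\<close> in the linear order of \<open>'n\<close>.\<close>

definition syzygy_matrix ::
    "('n::{finite,linorder}) cpoly_vec list \<Rightarrow> 'n cpoly_vec \<Rightarrow> ('n cpoly_vec, 'n) vec" where
  "syzygy_matrix rs \<rho> = (\<chi> i. ((\<chi> j. Var j) # rs @ [\<rho>]) ! card {..<i})"

definition v_map ::
    "('n::{finite,linorder}) cpoly \<Rightarrow> 'n cpoly_vec list \<Rightarrow> 'n cpoly_vec \<Rightarrow> 'n cpoly" where
  "v_map f rs \<rho> = (THE q. q * f = det (syzygy_matrix rs \<rho>))"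

definition B_ideal ::
    "('n::{finite,linorder}) cpoly \<Rightarrow> 'n cpoly_vec list \<Rightarrow> 'n cpoly set" where
  "B_ideal f rs = {v_map f rs \<rho> | \<rho>. \<rho> \<in> D0 f}"

text \<open>Elements \<open>(a\<^sub>1, \<dots>, a\<^sub>k)\<close> of the source of \<open>u\<close> are functions on \<open>nat\<close> vanishing outside
  \<open>{..<k}\<close> (indices shifted by one).\<close>

definition coef_tuples :: "nat \<Rightarrow> (nat \<Rightarrow> 'n cpoly) set" where
  "coef_tuples k = {a. \<forall>i\<ge>k. a i = 0}"

definition u_map ::
    "('n::finite) cpoly_vec list \<Rightarrow> (nat \<Rightarrow> 'n cpoly) \<Rightarrow> 'n cpoly_vec" where
  "u_map rs a = (\<Sum>i<length rs. a i *s rs ! i)"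

text \<open>Exactness of \<open>0 \<rightarrow> S(-d\<^sub>1) \<oplus> \<dots> \<oplus> S(-d\<^sub>n\<^sub>-\<^sub>1) \<rightarrow> D\<^sub>0(f) \<rightarrow> B(f, rs) \<rightarrow> 0\<close>, up to a twist
  of the last term. The degree shifts only make the maps homogeneous of degree \<open>0\<close> and do
  not affect exactness; exactness at the last term holds by the definition of the ideal.\<close>

definition tame ::
    "('n::{finite,linorder}) cpoly \<Rightarrow> 'n cpoly_vec list \<Rightarrow> bool" where
  "tame f rs \<longleftrightarrow>
     inj_on (u_map rs) (coef_tuples (length rs)) \<and>
     u_map rs ` coef_tuples (length rs) = {\<rho> \<in> D0 f. v_map f rs \<rho> = 0} \<and>
     v_map f rs ` D0 f = B_ideal f rs"

text \<open>The sum of \<open>e\<^sub>i * e\<^sub>j\<close> over \<open>1 \<le> i < j \<le> n\<close>, with the indices shifted to start from \<open>0\<close>.\<close>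

definition pair_sum :: "nat \<Rightarrow> (nat \<Rightarrow> real) \<Rightarrow> real" where
  "pair_sum n e = (\<Sum>(i, j) | i < j \<and> j < n. e i * e j)"

end

theory Submission
  imports Defs
begin

text \<open>Since \<open>D\<^sub>0(f)\<close> is the kernel of \<open>S^(n+1) \<rightarrow> J\<^sub>f(d-1)\<close>, the Hilbert function of \<open>S/J\<^sub>f\<close> is determined
  by that of \<open>D\<^sub>0(f)\<close>. In the free case this gives the Hilbert polynomial of \<open>S/J\<^sub>f\<close>; its
  coefficients in degrees \<open>n\<close> and \<open>n - 1\<close> vanish because \<open>J\<^sub>f\<close> has codimension at least \<open>2\<close> (\<open>f\<close> is
  square-free), which forces \<open>\<Sum>d\<^sub>i = d - 1\<close>, and the coefficient in degree \<open>n - 2\<close> is the claimed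
  degree, nonzero since \<open>(d-1)\<^sup>2 > s\<^sub>2\<close>.

  In the tame case the exact sequence replaces one free summand \<open>S(-d\<^sub>n'')\<close> of \<open>D\<^sub>0(f')\<close> by
  \<open>B(-d\<^sub>n'')\<close>, so the bound minus \<open>deg \<Sigma>'\<close> is \<open>(n-2)!\<close> times the coefficient in degree \<open>n - 2\<close> of the
  Hilbert polynomial of \<open>S/B\<close>, a nonnegative number. If it is \<open>0\<close>, then \<open>B\<close> has codimension at least
  \<open>3\<close>, so \<open>Ext\<^sup>1(B, S) = 0\<close> and the sequence splits, which is possible only if \<open>1 \<in> B\<close>. The vanishing
  of \<open>Ext\<close> is made explicit: \<open>B\<close> contains coprime \<open>p, r\<close> such that \<open>(p, r) : B = (p, r)\<close>.\<close>

text \<open>Dimension is defined by chains of homogeneous primes, degree by a Hilbert polynomial.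
  The bridge is the growth \<open>growth_le\<close> of Hilbert functions: an ideal of large growth
  lies in a prime of equally large growth, cutting a prime with a variable costs at most one power
  of t, and passing to a strictly larger prime costs at least one. Codimension thus becomes an
  inequality between Hilbert functions.

  Freeness is defined by counting minimal generators. So the independence of n generators has to be
  extracted from a rank count, and their number has to be shown independent of the choice.

  The delicate case is equality. Codimension 3 of \<open>B\<close> enters through one consequence:
  \<open>B\<close> meets the polynomial ring in any n - 1 of the n + 1 variables, since otherwise
  the Hilbert function of that ring, a polynomial of degree n - 2, would fit below that of S/B. This
  property passes to the ideal of coefficients with respect to one variable, so that an induction on
  the number of variables replaces the theory of depth and unmixedness; with two variables left it
  provides a nonzero constant.\<close>

declare S_ideal.scale_scale [simp del] \<comment> \<open>reassociates products and makes \<open>algebra_simps\<close> loop\<close>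

section \<open>Monomials, homogeneous components and coefficients in one variable\<close>

lemma sum_single_coef: "(\<Sum>m\<in>Poly_Mapping.keys p. Poly_Mapping.single m (coef p m)) = p"
proof (rule poly_mapping_eqI)
  fix k
  show "coef (\<Sum>m\<in>Poly_Mapping.keys p. Poly_Mapping.single m (coef p m)) k = coef p k"
    by (simp add: lookup_sum lookup_single when_def sum.delta' in_keys_iff)
qed

lemma cpoly_induct [case_names single add]:
  assumes "\<And>m c. P (Poly_Mapping.single m c)" and "\<And>p q. P p \<Longrightarrow> P q \<Longrightarrow> P (p + q)"
  shows "P (p :: 'n cpoly)"
proof -
  have "P (\<Sum>m\<in>A. Poly_Mapping.single m (coef p m))" if "finite A" for A
    using that
  proof induction
    case empty
    show ?case using assms(1)[of 0 0] by simp
  qed (simp add: assms)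
  from this[OF finite_keys[of p]] show ?thesis by (simp add: sum_single_coef)
qed

lemma coef_single_mult:
  "coef (Poly_Mapping.single a c * (p :: 'n cpoly)) (a + m) = c * coef p m"
  by (induction p rule: cpoly_induct)
     (auto simp: mult_single lookup_single when_def lookup_add distrib_left)

lemma coef_Const_mult [simp]: "coef (Const c * p) m = c * coef p m"
  using coef_single_mult[of 0 c p m] by (simp add: Const_def)

lemma Const_0 [simp]: "Const 0 = 0" and Const_1 [simp]: "Const 1 = 1"
  and Const_add: "Const (a + b) = Const a + Const b"
  and Const_diff: "Const (a - b) = Const a - Const b"
  and Const_minus: "Const (- a) = - Const a"
  and Const_mult: "Const (a * b) = Const a * Const b"
  by (simp_all add: Const_def single_add single_diff single_uminus mult_single)

lemma coef_Const: "coef (Const c) m = (if m = 0 then c else 0)"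
  by (simp add: Const_def lookup_single when_def)

lemma Const_eq_0_iff [simp]: "Const c = 0 \<longleftrightarrow> c = 0"
  by (metis Const_0 coef_Const)

lemma coef_0_mult: "coef (p * q :: ('n::finite) cpoly) 0 = coef p 0 * coef q 0"
proof (induction p rule: cpoly_induct)
  case (single m c)
  show ?case
  proof (induction q rule: cpoly_induct)
    case (single m' c')
    show ?case
      by (auto simp: mult_single lookup_single when_def poly_mapping_eq_iff lookup_add fun_eq_iff)
  qed (simp add: distrib_left lookup_add)
qed (simp add: distrib_right lookup_add)

lemma mon_degree_add: "mon_degree (a + b) = mon_degree a + mon_degree b"
  by (simp add: mon_degree_def lookup_add sum.distrib)

lemma mon_degree_0 [simp]: "mon_degree 0 = 0"
  by (simp add: mon_degree_def)

lemma mon_degree_single [simp]: "mon_degree (Poly_Mapping.single i k) = k"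
  by (simp add: mon_degree_def lookup_single when_def)

lemma mon_degree_eq_0_iff: "mon_degree m = 0 \<longleftrightarrow> m = 0"
  by (auto simp: mon_degree_def poly_mapping_eq_iff fun_eq_iff)

section \<open>Homogeneous polynomials and homogeneous components\<close>

lemma homogeneous_iff: "homogeneous e p \<longleftrightarrow> (\<forall>m. coef p m \<noteq> 0 \<longrightarrow> mon_degree m = e)"
  by (auto simp: homogeneous_def in_keys_iff)

lemma homogeneous_0 [simp]: "homogeneous e 0"
  by (simp add: homogeneous_iff)

lemma homogeneous_add: "homogeneous e p \<Longrightarrow> homogeneous e q \<Longrightarrow> homogeneous e (p + q)"
  by (auto simp: homogeneous_iff lookup_add) (metis add_0)

lemma homogeneous_uminus: "homogeneous e p \<Longrightarrow> homogeneous e (- p)"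
  by (auto simp: homogeneous_iff)

lemma homogeneous_diff: "homogeneous e p \<Longrightarrow> homogeneous e q \<Longrightarrow> homogeneous e (p - q)"
  using homogeneous_add[of e p "- q"] by (simp add: homogeneous_uminus)

lemma homogeneous_sum: "(\<And>x. x \<in> A \<Longrightarrow> homogeneous e (f x)) \<Longrightarrow> homogeneous e (sum f A)"
  by (induction A rule: infinite_finite_induct) (auto intro: homogeneous_add)

lemma homogeneous_single [simp]: "homogeneous (mon_degree m) (Poly_Mapping.single m c)"
  by (simp add: homogeneous_iff lookup_single when_def)

lemma homogeneous_Var [simp]: "homogeneous 1 (Var i)"
  by (simp add: Var_def homogeneous_iff lookup_single when_def)

lemma homogeneous_Const [simp]: "homogeneous 0 (Const c)"
  by (simp add: homogeneous_iff coef_Const)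

lemma homogeneous_mult:
  assumes "homogeneous d p" "homogeneous e q"
  shows "homogeneous (d + e) (p * q)"
  unfolding homogeneous_def
proof
  fix m assume "m \<in> Poly_Mapping.keys (p * q)"
  then obtain a b where "m = a + b" "a \<in> Poly_Mapping.keys p" "b \<in> Poly_Mapping.keys q"
    using keys_mult[of p q] by blast
  with assms show "mon_degree m = d + e" by (simp add: homogeneous_def mon_degree_add)
qed

lemma homogeneous_Const_mult: "homogeneous e p \<Longrightarrow> homogeneous e (Const c * p)"
  using homogeneous_mult[OF homogeneous_Const] by fastforce

lemma homogeneous_0_imp_Const: "homogeneous 0 p \<Longrightarrow> p = Const (coef p 0)"
  by (rule poly_mapping_eqI) (auto simp: homogeneous_iff coef_Const mon_degree_eq_0_iff)

definition hcomp :: "nat \<Rightarrow> ('n::finite) cpoly \<Rightarrow> 'n cpoly" where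
  "hcomp t p = Poly_Mapping.mapp (\<lambda>m c. c when mon_degree m = t) p"

lemma coef_hcomp: "coef (hcomp t p) m = (if mon_degree m = t then coef p m else 0)"
  by (simp add: hcomp_def lookup_mapp when_def in_keys_iff)

lemma homogeneous_hcomp [simp]: "homogeneous t (hcomp t p)"
  by (simp add: homogeneous_iff coef_hcomp)

lemma hcomp_0 [simp]: "hcomp t 0 = 0"
  and hcomp_add: "hcomp t (p + q) = hcomp t p + hcomp t q"
  and hcomp_diff: "hcomp t (p - q) = hcomp t p - hcomp t q"
  and hcomp_Const_mult: "hcomp t (Const c * p) = Const c * hcomp t p"
  by (rule poly_mapping_eqI, simp add: coef_hcomp lookup_add lookup_minus)+

lemma hcomp_sum: "hcomp t (sum f A) = (\<Sum>x\<in>A. hcomp t (f x))"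
  by (induction A rule: infinite_finite_induct) (auto simp: hcomp_add)

lemma hcomp_homogeneous: "homogeneous e p \<Longrightarrow> hcomp t p = (if t = e then p else 0)"
  by (rule poly_mapping_eqI) (auto simp: coef_hcomp homogeneous_iff)

lemma sum_hcomp: "p = (\<Sum>t\<in>mon_degree ` Poly_Mapping.keys p. hcomp t p)"
proof (rule poly_mapping_eqI)
  fix m
  show "coef p m = coef (\<Sum>t\<in>mon_degree ` Poly_Mapping.keys p. hcomp t p) m"
    by (auto simp: lookup_sum coef_hcomp sum.delta' in_keys_iff image_iff)
qed

lemma hcomp_mult:
  assumes "homogeneous e p"
  shows "hcomp t (a * p) = (if e \<le> t then hcomp (t - e) a * p else 0)"
proof (induction a rule: cpoly_induct)
  case (single m c)
  have "homogeneous (mon_degree m + e) (Poly_Mapping.single m c * p)"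
    by (intro homogeneous_mult assms homogeneous_single)
  then show ?case
    by (auto simp: hcomp_homogeneous[OF homogeneous_single] hcomp_homogeneous)
qed (simp add: distrib_right hcomp_add)

text \<open>As \<open>f\<close> is homogeneous, \<open>hcomp t q * f\<close> is the component of
  \<open>q * f\<close> in degree \<open>t + d\<close>, so it vanishes unless
  \<open>t + d = e\<close>: only one component of \<open>q\<close> survives.\<close>

lemma homogeneous_div:
  fixes q f :: "('n::{finite,linorder}) cpoly"
  assumes "homogeneous e (q * f)" "homogeneous d f" "f \<noteq> 0" "q \<noteq> 0"
  shows "d \<le> e" "homogeneous (e - d) q"
proof -
  obtain t where t: "hcomp t q \<noteq> 0"
    using sum_hcomp[of q] assms(4) by (metis sum.neutral)
  have *: "hcomp t q = 0 \<or> t + d = e" for t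
  proof (cases "t + d = e")
    case False
    then have "hcomp (t + d) (q * f) = 0" using hcomp_homogeneous[OF assms(1)] by simp
    then have "hcomp t q * f = 0" using hcomp_mult[OF assms(2), of "t + d" q] by simp
    then show ?thesis using assms(3) by simp
  qed simp
  from *[of t] t show "d \<le> e" by simp
  show "homogeneous (e - d) q"
    unfolding homogeneous_iff
  proof (intro allI impI)
    fix m assume "coef q m \<noteq> 0"
    then have "hcomp (mon_degree m) q \<noteq> 0" by (metis coef_hcomp lookup_zero)
    with * show "mon_degree m = e - d" by force
  qed
qed

text \<open>The coefficient of \<open>Var i ^ k\<close> when \<open>p\<close> is read as a
  polynomial in \<open>Var i\<close> over the other variables, kept in the same type. After the
  shift by \<open>single i k\<close>, the filter discards the monomials in which
  \<open>Var i\<close> had an exponent larger than \<open>k\<close>.\<close>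

definition xcoef :: "'n \<Rightarrow> nat \<Rightarrow> 'n cpoly \<Rightarrow> 'n cpoly" where
  "xcoef i k p = Poly_Mapping.mapp (\<lambda>m c. c when Poly_Mapping.lookup m i = 0)
     (Poly_Mapping.map_key (\<lambda>m. m + Poly_Mapping.single i k) p)"

lemma coef_xcoef: "coef (xcoef i k p) m =
    (if Poly_Mapping.lookup m i = 0 then coef p (m + Poly_Mapping.single i k) else 0)"
proof -
  have "inj (\<lambda>m. m + Poly_Mapping.single i k)" by (simp add: inj_on_def)
  then show ?thesis
    by (auto simp: xcoef_def lookup_mapp when_def in_keys_iff map_key.rep_eq)
qed

lemma xcoef_add: "xcoef i k (p + q) = xcoef i k p + xcoef i k q"
  by (rule poly_mapping_eqI) (simp add: coef_xcoef lookup_add)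

lemma xcoef_single: "xcoef i k (Poly_Mapping.single m c) =
    (if Poly_Mapping.lookup m i = k then Poly_Mapping.single (m - Poly_Mapping.single i k) c else 0)"
proof (rule poly_mapping_eqI)
  fix m'
  have "m = m' + Poly_Mapping.single i k \<longleftrightarrow> Poly_Mapping.lookup m i = k \<and> m - Poly_Mapping.single i k = m'"
    if "Poly_Mapping.lookup m' i = 0"
    using that by (auto simp: poly_mapping_eq_iff fun_eq_iff lookup_add lookup_minus lookup_single when_def
        split: if_splits)
  moreover have "Poly_Mapping.lookup (m - Poly_Mapping.single i (Poly_Mapping.lookup m i)) i = 0"
    by (simp add: lookup_minus)
  ultimately show "coef (xcoef i k (Poly_Mapping.single m c)) m' = coef (if Poly_Mapping.lookup m i = k
      then Poly_Mapping.single (m - Poly_Mapping.single i k) c else 0) m'"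
    by (auto simp: coef_xcoef lookup_single when_def)
qed

text \<open>An injective ring homomorphism, with evaluation at \<open>Var i\<close> as left inverse.
  The coefficients are again in \<open>'n cpoly\<close>, so one type serves for every choice of the
  variable, and univariate facts on degrees and leading coefficients become available.\<close>

definition xpoly :: "'n \<Rightarrow> 'n cpoly \<Rightarrow> 'n cpoly poly" where
  "xpoly i p = Abs_poly (\<lambda>k. xcoef i k p)"

lemma coeff_xpoly: "coeff (xpoly i p) k = xcoef i k p"
proof -
  have "\<exists>K. \<forall>k>K. xcoef i k p = 0"
  proof (induction p rule: cpoly_induct)
    case (single m c)
    then show ?case by (auto simp: xcoef_single)
  next
    case (add p q)
    then obtain K L where "\<forall>k>K. xcoef i k p = 0" "\<forall>k>L. xcoef i k q = 0" by blast
    then have "\<forall>k>max K L. xcoef i k (p + q) = 0" by (simp add: xcoef_add)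
    then show ?case by blast
  qed
  then obtain K where "\<forall>k>K. xcoef i k p = 0" by blast
  then have "coeff (xpoly i p) = (\<lambda>k. xcoef i k p)"
    unfolding xpoly_def by (intro coeff_Abs_poly) auto
  then show ?thesis by simp
qed

lemma xpoly_add: "xpoly i (p + q) = xpoly i p + xpoly i q"
  by (rule poly_eqI) (simp add: coeff_xpoly xcoef_add)

lemma xpoly_single: "xpoly i (Poly_Mapping.single m c) =
    monom (Poly_Mapping.single (m - Poly_Mapping.single i (Poly_Mapping.lookup m i)) c) (Poly_Mapping.lookup m i)"
  by (rule poly_eqI) (auto simp: coeff_xpoly xcoef_single)

lemma xpoly_mult: "xpoly i (p * q) = xpoly i p * xpoly i q"
proof (induction p rule: cpoly_induct)
  case (single m c)
  show ?case
  proof (induction q rule: cpoly_induct)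
    case (single m' c')
    have "m + m' - Poly_Mapping.single i (Poly_Mapping.lookup (m + m') i) =
      (m - Poly_Mapping.single i (Poly_Mapping.lookup m i)) + (m' - Poly_Mapping.single i (Poly_Mapping.lookup m' i))"
      by (auto simp: poly_mapping_eq_iff fun_eq_iff lookup_add lookup_minus lookup_single when_def)
    then show ?case by (simp add: mult_single xpoly_single mult_monom lookup_add)
  qed (simp add: distrib_left xpoly_add)
qed (simp add: distrib_right xpoly_add)

lemma xpoly_0 [simp]: "xpoly i 0 = 0"
  using xpoly_single[of i 0 0] by simp

lemma xpoly_uminus: "xpoly i (- p) = - xpoly i p"
  using xpoly_add[of i p "- p"] by (simp add: eq_neg_iff_add_eq_0 add.commute)

lemma xpoly_diff: "xpoly i (p - q) = xpoly i p - xpoly i q"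
  using xpoly_add[of i p "- q"] by (simp add: xpoly_uminus)

lemma xpoly_Const [simp]: "xpoly i (Const c) = [:Const c:]"
  by (simp add: Const_def xpoly_single monom_0)

lemma Var_power: "Var i ^ k = Poly_Mapping.single (Poly_Mapping.single i k) 1"
  by (induction k) (simp_all add: Var_def mult_single single_add[symmetric])

lemma xpoly_Var_power: "xpoly i (Var i ^ k) = monom 1 k"
  by (simp add: Var_power xpoly_single)

lemma poly_xpoly [simp]: "poly (xpoly i p) (Var i) = p"
proof (induction p rule: cpoly_induct)
  case (single m c)
  have "m - Poly_Mapping.single i (Poly_Mapping.lookup m i) + Poly_Mapping.single i (Poly_Mapping.lookup m i) = m"
    by (auto simp: poly_mapping_eq_iff fun_eq_iff lookup_add lookup_minus lookup_single when_def)
  then show ?case by (simp add: xpoly_single poly_monom Var_power mult_single)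
qed (simp add: xpoly_add)

lemma xpoly_inject [simp]: "xpoly i p = xpoly i q \<longleftrightarrow> p = q"
  by (metis poly_xpoly)

lemma xpoly_eq_0_iff [simp]: "xpoly i p = 0 \<longleftrightarrow> p = 0"
  by (metis xpoly_0 xpoly_inject)

abbreviation deg_in :: "'n \<Rightarrow> 'n cpoly \<Rightarrow> nat" where
  "deg_in i p \<equiv> degree (xpoly i p)"

lemma deg_in_0_iff: "deg_in i p = 0 \<longleftrightarrow> xpoly i p = [:p:]"
proof
  assume "deg_in i p = 0"
  then obtain a where "xpoly i p = [:a:]" by (meson degree_eq_zeroE)
  then show "xpoly i p = [:p:]" using poly_xpoly[of i p] by simp
qed simp

lemma deg_in_eq_0_iff: "deg_in i p = 0 \<longleftrightarrow> (\<forall>m\<in>Poly_Mapping.keys p. Poly_Mapping.lookup m i = 0)"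
proof
  assume "deg_in i p = 0"
  then have "p = xcoef i 0 p" by (metis coeff_pCons_0 coeff_xpoly deg_in_0_iff)
  then show "\<forall>m\<in>Poly_Mapping.keys p. Poly_Mapping.lookup m i = 0"
    by (metis coef_xcoef in_keys_iff)
next
  assume *: "\<forall>m\<in>Poly_Mapping.keys p. Poly_Mapping.lookup m i = 0"
  have "xcoef i k p = 0" if "k > 0" for k
  proof (rule poly_mapping_eqI)
    fix m
    have "Poly_Mapping.lookup (m + Poly_Mapping.single i k) i \<noteq> 0" using that by (simp add: lookup_add)
    with bspec[OF *, of "m + Poly_Mapping.single i k"]
    have "m + Poly_Mapping.single i k \<notin> Poly_Mapping.keys p" by argo
    then show "coef (xcoef i k p) m = coef 0 m" by (simp add: coef_xcoef in_keys_iff)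
  qed
  then show "deg_in i p = 0" by (metis coeff_xpoly leading_coeff_0_iff not_gr_zero degree_0)
qed

lemma deg_in_xcoef [simp]: "deg_in i (xcoef i k p) = 0"
  by (auto simp: deg_in_eq_0_iff in_keys_iff coef_xcoef split: if_splits)

lemma deg_in_xcoef_le: "deg_in j p = 0 \<Longrightarrow> deg_in j (xcoef i k p) = 0"
proof -
  assume *: "deg_in j p = 0"
  show ?thesis
    unfolding deg_in_eq_0_iff
  proof
    fix m assume "m \<in> Poly_Mapping.keys (xcoef i k p)"
    then have "m + Poly_Mapping.single i k \<in> Poly_Mapping.keys p"
      by (auto simp: in_keys_iff coef_xcoef split: if_splits)
    with * have "Poly_Mapping.lookup (m + Poly_Mapping.single i k) j = 0"
      unfolding deg_in_eq_0_iff by (rule bspec)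
    then show "Poly_Mapping.lookup m j = 0" by (simp add: lookup_add)
  qed
qed

lemma deg_in_mult:
  fixes p q :: "('n::{finite,linorder}) cpoly"
  shows "p \<noteq> 0 \<Longrightarrow> q \<noteq> 0 \<Longrightarrow> deg_in i (p * q) = deg_in i p + deg_in i q"
  by (simp add: xpoly_mult degree_mult_eq)

section \<open>Unique factorization\<close>

text \<open>The subring of polynomials in the variables from \<open>V\<close>, cut out inside one
  type, so that inductions on the set of variables need no change of ring.\<close>

definition Svars :: "'n set \<Rightarrow> 'n cpoly set" where
  "Svars V = {p. \<forall>i. i \<notin> V \<longrightarrow> deg_in i p = 0}"

lemma SvarsD: "p \<in> Svars V \<Longrightarrow> i \<notin> V \<Longrightarrow> deg_in i p = 0"
  by (simp add: Svars_def)

lemma Svars_insertD: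
  assumes "p \<in> Svars (insert i V)" "deg_in i p = 0"
  shows "p \<in> Svars V"
  unfolding Svars_def
proof (intro CollectI allI impI)
  fix j assume "j \<notin> V"
  then show "deg_in j p = 0" using assms by (cases "j = i") (auto simp: Svars_def)
qed

lemma Svars_mono: "V \<subseteq> W \<Longrightarrow> p \<in> Svars V \<Longrightarrow> p \<in> Svars W"
  by (auto simp: Svars_def)

lemma Svars_0 [simp]: "0 \<in> Svars V" and Svars_Const [simp]: "Const c \<in> Svars V"
  by (simp_all add: Svars_def)

lemma Svars_1 [simp]: "1 \<in> Svars V"
  using Svars_Const[of 1 V] by simp

lemma Svars_UNIV [simp]: "p \<in> Svars UNIV"
  by (simp add: Svars_def)

lemma Svars_add: "p \<in> Svars V \<Longrightarrow> q \<in> Svars V \<Longrightarrow> p + q \<in> Svars V"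
  unfolding Svars_def using degree_add_le[of "xpoly _ p" 0 "xpoly _ q"] by (simp add: xpoly_add)

lemma Svars_uminus: "p \<in> Svars V \<Longrightarrow> - p \<in> Svars V"
  by (simp add: Svars_def xpoly_uminus)

lemma Svars_diff: "p \<in> Svars V \<Longrightarrow> q \<in> Svars V \<Longrightarrow> p - q \<in> Svars V"
  using Svars_add[of p V "- q"] by (simp add: Svars_uminus)

lemma Svars_mult: "p \<in> Svars V \<Longrightarrow> q \<in> Svars V \<Longrightarrow> p * q \<in> Svars V"
  unfolding Svars_def
proof (intro CollectI allI impI)
  fix i assume "p \<in> {p. \<forall>i. i \<notin> V \<longrightarrow> deg_in i p = 0}" "q \<in> {p. \<forall>i. i \<notin> V \<longrightarrow> deg_in i p = 0}" "i \<notin> V"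
  then show "deg_in i (p * q) = 0"
    using degree_mult_le[of "xpoly i p" "xpoly i q"] by (simp add: xpoly_mult)
qed

lemma Svars_Var_power: "i \<in> V \<Longrightarrow> Var i ^ k \<in> Svars V"
  by (auto simp: Svars_def deg_in_eq_0_iff Var_power lookup_single when_def)

lemma Svars_xcoef: "p \<in> Svars V \<Longrightarrow> xcoef i k p \<in> Svars (V - {i})"
  by (auto simp: Svars_def deg_in_xcoef_le)

lemma Svars_xcoef_insert: "p \<in> Svars (insert i V) \<Longrightarrow> i \<notin> V \<Longrightarrow> xcoef i k p \<in> Svars V"
  by (metis Diff_insert_absorb Svars_xcoef)

lemma Svars_empty_imp_Const:
  assumes "p \<in> Svars {}"
  shows "p = Const (coef p 0)"
proof (rule poly_mapping_eqI)
  fix m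
  show "coef p m = coef (Const (coef p 0)) m"
  proof (cases "m = 0")
    case False
    then obtain i where "Poly_Mapping.lookup m i \<noteq> 0" by (auto simp: poly_mapping_eq_iff fun_eq_iff)
    with assms have "m \<notin> Poly_Mapping.keys p" by (auto simp: Svars_def deg_in_eq_0_iff)
    with False show ?thesis by (simp add: coef_Const in_keys_iff)
  qed (simp add: coef_Const)
qed

lemma Svars_dvd: "(p :: ('n::{finite,linorder}) cpoly) dvd q \<Longrightarrow> q \<noteq> 0 \<Longrightarrow> q \<in> Svars V \<Longrightarrow> p \<in> Svars V"
  by (auto simp: Svars_def deg_in_mult elim!: dvdE)

lemma unit_iff_Svars_empty: "(p :: ('n::{finite,linorder}) cpoly) dvd 1 \<longleftrightarrow> p \<noteq> 0 \<and> p \<in> Svars {}"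
proof
  assume "p dvd 1"
  then show "p \<noteq> 0 \<and> p \<in> Svars {}" using Svars_dvd[of p 1] by auto
next
  assume *: "p \<noteq> 0 \<and> p \<in> Svars {}"
  then have p: "p = Const (coef p 0)" by (intro Svars_empty_imp_Const) simp
  with * have "coef p 0 \<noteq> 0" by (metis Const_0)
  then have "Const (coef p 0) * Const (1 / coef p 0) = 1" by (simp flip: Const_mult)
  with p have "1 = p * Const (1 / coef p 0)" by metis
  then show "p dvd 1" by (rule dvdI)
qed

lemma unit_iff_Const: "(p :: ('n::{finite,linorder}) cpoly) dvd 1 \<longleftrightarrow> (\<exists>c. c \<noteq> 0 \<and> p = Const c)"
proof
  assume "p dvd 1"
  then show "\<exists>c. c \<noteq> 0 \<and> p = Const c"
    by (metis unit_iff_Svars_empty Const_0 Svars_empty_imp_Const)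
next
  assume "\<exists>c. c \<noteq> 0 \<and> p = Const c"
  then show "p dvd 1" by (auto simp: unit_iff_Svars_empty)
qed

text \<open>The sum of the degrees in the single variables, not the total degree: it is additive on
  products by \<open>deg_in_mult\<close> and vanishes exactly on units, hence can serve as induction
  measure for factorizations.\<close>

definition tdeg :: "('n::{finite,linorder}) cpoly \<Rightarrow> nat" where
  "tdeg p = (\<Sum>i\<in>UNIV. deg_in i p)"

lemma tdeg_mult: "p \<noteq> 0 \<Longrightarrow> q \<noteq> 0 \<Longrightarrow> tdeg (p * q) = tdeg p + tdeg q"
  by (simp add: tdeg_def deg_in_mult sum.distrib)

lemma tdeg_eq_0_iff: "p \<noteq> 0 \<Longrightarrow> tdeg p = 0 \<longleftrightarrow> p dvd 1"
  by (auto simp: tdeg_def unit_iff_Svars_empty Svars_def)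

lemma irreducible_factor_exists:
  assumes "(p :: ('n::{finite,linorder}) cpoly) \<noteq> 0" "\<not> p dvd 1"
  shows "\<exists>g. irreducible g \<and> g dvd p"
  using assms
proof (induction "tdeg p" arbitrary: p rule: less_induct)
  case less
  show ?case
  proof (cases "irreducible p")
    case False
    then obtain a b where ab: "p = a * b" "\<not> a dvd 1" "\<not> b dvd 1"
      using less.prems unfolding irreducible_def by blast
    then have "a \<noteq> 0" "b \<noteq> 0" using less.prems by auto
    then have "tdeg a < tdeg p" using ab tdeg_mult[of a b] tdeg_eq_0_iff[of b] by simp
    from less.hyps[OF this \<open>a \<noteq> 0\<close> ab(2)] show ?thesis using ab(1) by (meson dvd_mult2)
  qed auto
qed

lemma tdeg_irreducible_mult:
  assumes "irreducible (g :: ('n::{finite,linorder}) cpoly)" "c \<noteq> 0"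
  shows "tdeg c < tdeg (g * c)"
  using assms tdeg_mult[of g c] tdeg_eq_0_iff[of g] by (auto simp: irreducible_def)

section \<open>Gauss's lemma by induction on the variables\<close>

lemma xcoef_mult: "xcoef i k (a * b) = (\<Sum>j\<le>k. xcoef i j a * xcoef i (k - j) b)"
  by (simp flip: coeff_xpoly add: xpoly_mult coeff_mult)

lemma xcoef_mult_left: "deg_in i p = 0 \<Longrightarrow> xcoef i k (p * a) = p * xcoef i k a"
  by (simp flip: coeff_xpoly add: xpoly_mult deg_in_0_iff)

lemma xcoef_expansion: "p = (\<Sum>k\<le>deg_in i p. xcoef i k p * Var i ^ k)"
  using poly_altdef[of "xpoly i p" "Var i"] by (simp add: coeff_xpoly)

lemma xcoef_eq_0: "deg_in i p < k \<Longrightarrow> xcoef i k p = 0"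
  using coeff_eq_0[of "xpoly i p" k] by (simp add: coeff_xpoly)

lemma dvd_iff_xcoef:
  assumes "deg_in i (\<pi> :: ('n::{finite,linorder}) cpoly) = 0"
  shows "\<pi> dvd a \<longleftrightarrow> (\<forall>k. \<pi> dvd xcoef i k a)"
proof
  assume "\<pi> dvd a"
  then show "\<forall>k. \<pi> dvd xcoef i k a" by (auto simp: xcoef_mult_left[OF assms])
next
  assume "\<forall>k. \<pi> dvd xcoef i k a"
  then show "\<pi> dvd a" by (subst xcoef_expansion[of a i]) (auto intro!: dvd_sum)
qed

text \<open>Primality relative to the subring \<open>Svars V\<close>, the form that an induction on
  \<open>V\<close> needs. Divisibility is that of the full ring, which makes no difference because
  factors of nonzero elements of \<open>Svars V\<close> stay in \<open>Svars V\<close>.\<close>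

definition prime_in :: "('n::{finite,linorder}) set \<Rightarrow> 'n cpoly \<Rightarrow> bool" where
  "prime_in V g \<longleftrightarrow> (\<forall>a\<in>Svars V. \<forall>b\<in>Svars V. g dvd a * b \<longrightarrow> g dvd a \<or> g dvd b)"

text \<open>Let \<open>k\<close> and \<open>l\<close> be the largest exponents whose coefficients in
  \<open>a\<close> and \<open>b\<close> are not divisible by \<pi>. In the coefficient of
  \<open>Var i ^ (k + l)\<close> in \<open>a * b\<close> every other summand contains a coefficient
  of index beyond \<open>k\<close> or \<open>l\<close>, so \<pi> divides the product of the two
  chosen ones.\<close>

lemma prime_in_insert:
  assumes "prime_in V \<pi>" "\<pi> \<in> Svars V" "i \<notin> V"
  shows "prime_in (insert i V) \<pi>"
  unfolding prime_in_def
proof (intro ballI impI, rule ccontr)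
  fix a b assume a: "a \<in> Svars (insert i V)" and b: "b \<in> Svars (insert i V)"
    and ab: "\<pi> dvd a * b" and "\<not> (\<pi> dvd a \<or> \<pi> dvd b)"
  have \<pi>: "deg_in i \<pi> = 0" using assms by (auto simp: Svars_def)
  have xc: "xcoef i k c \<in> Svars V" if "c \<in> Svars (insert i V)" for k c
    using Svars_xcoef_insert[OF that assms(3)] .
  have max_ex: "\<exists>k. \<not> \<pi> dvd xcoef i k c \<and> (\<forall>j>k. \<pi> dvd xcoef i j c)" if "\<not> \<pi> dvd c" for c
  proof -
    have fin: "finite {k. \<not> \<pi> dvd xcoef i k c}"
      by (rule finite_subset[of _ "{..deg_in i c}"]) (auto simp: xcoef_eq_0 intro: leI)
    have ne: "{k. \<not> \<pi> dvd xcoef i k c} \<noteq> {}" using that dvd_iff_xcoef[OF \<pi>] by blast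
    show ?thesis
      using Max_in[OF fin ne] Max_ge[OF fin] by (intro exI[of _ "Max {k. \<not> \<pi> dvd xcoef i k c}"])
        (auto simp: not_le[symmetric])
  qed
  from max_ex[of a] obtain k where k: "\<not> \<pi> dvd xcoef i k a" "\<And>j. j > k \<Longrightarrow> \<pi> dvd xcoef i j a"
    using \<open>\<not> (\<pi> dvd a \<or> \<pi> dvd b)\<close> by blast
  from max_ex[of b] obtain l where l: "\<not> \<pi> dvd xcoef i l b" "\<And>j. j > l \<Longrightarrow> \<pi> dvd xcoef i j b"
    using \<open>\<not> (\<pi> dvd a \<or> \<pi> dvd b)\<close> by blast
  have "\<pi> dvd xcoef i (k + l) (a * b)" using ab dvd_iff_xcoef[OF \<pi>] by blast
  also have "xcoef i (k + l) (a * b) = xcoef i k a * xcoef i l b +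
      (\<Sum>j\<in>{..k+l} - {k}. xcoef i j a * xcoef i (k + l - j) b)"
    unfolding xcoef_mult by (subst sum.remove[of _ k]) auto
  finally have "\<pi> dvd xcoef i k a * xcoef i l b"
  proof (subst (asm) dvd_add_left_iff)
    show "\<pi> dvd (\<Sum>j\<in>{..k+l} - {k}. xcoef i j a * xcoef i (k + l - j) b)"
    proof (rule dvd_sum)
      fix j assume "j \<in> {..k+l} - {k}"
      then consider "j > k" | "k + l - j > l" by fastforce
      then show "\<pi> dvd xcoef i j a * xcoef i (k + l - j) b"
        by cases (auto simp: k l)
    qed
  qed
  with k(1) l(1) xc[OF a] xc[OF b] assms(1) show False unfolding prime_in_def by blast
qed

lemma const_mult: "[:c:] * p = smult c p"
  by simp

text \<open>Division with remainder in \<open>Var i\<close> over the coefficient ring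
  \<open>Svars V\<close>. In place of dividing by the leading coefficient of \<open>g\<close>, the
  dividend is multiplied by it; \<open>c\<close> collects these factors.\<close>

lemma pseudo_division:
  fixes a g :: "('n::{finite,linorder}) cpoly"
  assumes "g \<in> Svars (insert i V)" "g \<noteq> 0" "a \<in> Svars (insert i V)" "i \<notin> V"
  shows "\<exists>c q r. c \<in> Svars V \<and> c \<noteq> 0 \<and> q \<in> Svars (insert i V) \<and> r \<in> Svars (insert i V) \<and>
    c * a = q * g + r \<and> (r = 0 \<or> deg_in i r < deg_in i g)"
  using assms(3)
proof (induction "deg_in i a" arbitrary: a rule: less_induct)
  case less
  show ?case
  proof (cases "a = 0 \<or> deg_in i a < deg_in i g")
    case True
    then show ?thesis using less.prems
      by (intro exI[of _ 1] exI[of _ 0] exI[of _ a]) auto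
  next
    case False
    define lg where "lg = xcoef i (deg_in i g) g"
    define la where "la = xcoef i (deg_in i a) a"
    define k where "k = deg_in i a - deg_in i g"
    have lgV: "lg \<in> Svars V" "la \<in> Svars V"
      using Svars_xcoef_insert[OF assms(1,4)] Svars_xcoef_insert[OF less.prems assms(4)]
      unfolding lg_def la_def by blast+
    then have lgV': "lg \<in> Svars (insert i V)" "la \<in> Svars (insert i V)" by (auto intro: Svars_mono[rotated])
    have lg0: "lg \<noteq> 0" using assms(2) unfolding lg_def coeff_xpoly[symmetric] by simp
    define a' where "a' = lg * a - la * Var i ^ k * g"
    have a'V: "a' \<in> Svars (insert i V)" unfolding a'_def
      by (intro Svars_diff Svars_mult lgV' less.prems assms(1) Svars_Var_power) simp
    have xl: "xpoly i lg = [:lg:]" "xpoly i la = [:la:]"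
      using SvarsD[OF lgV(1) assms(4)] SvarsD[OF lgV(2) assms(4)] by (simp_all only: deg_in_0_iff)
    have xa': "xpoly i a' = smult lg (xpoly i a) - smult la (monom 1 k * xpoly i g)"
      unfolding a'_def xpoly_diff xpoly_mult xl xpoly_Var_power
      by (simp only: const_mult mult_smult_left)
    have dmk: "degree (monom 1 k * xpoly i g) = deg_in i a"
    proof -
      have "degree (monom 1 k * xpoly i g) = degree (monom (1 :: 'n cpoly) k) + deg_in i g"
        using assms(2) by (intro degree_mult_eq) simp_all
      then show ?thesis using False by (simp only: degree_monom_eq[OF one_neq_zero] k_def) linarith
    qed
    show ?thesis
    \<comment> \<open>The leading terms cancel in \<open>a'\<close>. If \<open>a\<close> and
      \<open>g\<close> both have degree 0 in \<open>Var i\<close>, the degree cannot drop, but then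
      \<open>a'\<close> is 0.\<close>
    proof (cases "a' = 0 \<or> deg_in i a' < deg_in i a")
      case True
      have "\<exists>c q r. c \<in> Svars V \<and> c \<noteq> 0 \<and> q \<in> Svars (insert i V) \<and> r \<in> Svars (insert i V) \<and>
        c * a' = q * g + r \<and> (r = 0 \<or> deg_in i r < deg_in i g)"
        using True
      proof
        assume "a' = 0"
        then show ?thesis
          by (intro exI[of _ 1] exI[of _ 0] exI[of _ 0]) auto
      next
        assume "deg_in i a' < deg_in i a"
        from less.hyps[OF this a'V] show ?thesis .
      qed
      then obtain c q r where *: "c \<in> Svars V" "c \<noteq> 0" "q \<in> Svars (insert i V)" "r \<in> Svars (insert i V)"
        "c * a' = q * g + r" "r = 0 \<or> deg_in i r < deg_in i g" by blast
      have "c * lg * a = (q + c * la * Var i ^ k) * g + r"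
        using *(5) by (simp add: a'_def algebra_simps)
      moreover have "q + c * la * Var i ^ k \<in> Svars (insert i V)"
        using *(1) by (intro Svars_add Svars_mult * lgV' Svars_Var_power) (auto intro: Svars_mono[rotated])
      moreover have "c * lg \<in> Svars V" "c * lg \<noteq> 0" using * lgV lg0 by (auto intro: Svars_mult)
      ultimately show ?thesis using *(4,6) by blast
    next
      case False2: False
      have "degree (xpoly i a') \<le> deg_in i a"
        unfolding xa' by (intro degree_diff_le degree_smult_le[THEN order_trans]) (simp_all add: dmk)
      with False2 have "degree (xpoly i a') = deg_in i a" "a' \<noteq> 0" by auto
      then have "coeff (xpoly i a') (deg_in i a) \<noteq> 0" by (metis leading_coeff_0_iff xpoly_eq_0_iff)
      moreover have "coeff (xpoly i a') (deg_in i a) = 0"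
        using False unfolding xa' coeff_diff coeff_smult coeff_monom_mult
        by (simp add: k_def coeff_xpoly lg_def la_def)
      ultimately show ?thesis by simp
    qed
  qed
qed

lemma dvd_unit_mult: "c dvd 1 \<Longrightarrow> g dvd c * a \<Longrightarrow> g dvd (a :: 'a::comm_semiring_1)"
  by (metis dvd_def dvd_mult mult.assoc mult.commute mult_1)

text \<open>Induction on the variables. If \<open>g\<close> involves the new variable
  \<open>i\<close>, the classical argument over the field of fractions is carried out without
  denominators: nonzero factors from \<open>Svars V\<close> are removed one prime at a time, these
  primes being prime by the induction hypothesis. An element \<open>r\<close> of least degree in the
  ideal of \<open>g\<close> and \<open>a\<close> replaces the greatest common divisor.\<close>

lemma irreducible_imp_prime_in:
  assumes "finite V" "irreducible g" "g \<in> Svars V"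
  shows "prime_in V g"
  using assms
proof (induction V arbitrary: g rule: finite_induct)
  case empty
  then show ?case using unit_iff_Svars_empty[of g] by (auto simp: irreducible_def)
next
  case (insert i V)
  let ?W = "insert i V"
  show ?case
  proof (cases "deg_in i g = 0")
    case True
    have "g \<in> Svars V"
      by (rule Svars_insertD[OF insert.prems(2) True])
    then show ?thesis using insert prime_in_insert by blast
  next
    case False
    have g0: "g \<noteq> 0" using insert.prems by (auto simp: irreducible_def)
    have factor: "\<exists>\<pi> c'. c = \<pi> * c' \<and> irreducible \<pi> \<and> \<pi> \<in> Svars V \<and> c' \<in> Svars V \<and> c' \<noteq> 0 \<and> tdeg c' < tdeg c
        \<and> prime_in ?W \<pi>"
      if c: "c \<in> Svars V" "c \<noteq> 0" "\<not> c dvd 1" for c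
    proof -
      from irreducible_factor_exists[OF c(2,3)] obtain \<pi> c' where *: "irreducible \<pi>" "c = \<pi> * c'" unfolding dvd_def by blast
      then have "c' \<noteq> 0" using c by auto
      moreover have "\<pi> \<in> Svars V" "c' \<in> Svars V" using Svars_dvd[OF _ c(2,1)] * by auto
      moreover have "tdeg c' < tdeg c" using tdeg_irreducible_mult[OF *(1) \<open>c' \<noteq> 0\<close>] *(2) by simp
      moreover have "prime_in ?W \<pi>"
        using prime_in_insert[OF insert.IH[OF *(1)]] \<open>\<pi> \<in> Svars V\<close> insert.hyps(2) by blast
      ultimately show ?thesis using * by blast
    qed
    have not_dvd_g: "\<not> \<pi> dvd g" if "irreducible \<pi>" "\<pi> \<in> Svars V" for \<pi>
    proof
      assume "\<pi> dvd g"
      then obtain h where h: "g = \<pi> * h" by (auto simp: dvd_def)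
      have "\<not> \<pi> dvd 1" using that by (auto simp: irreducible_def)
      with h insert.prems(1) have "h dvd 1" by (auto simp: irreducible_def)
      then have "deg_in i h = 0" by (auto simp: unit_iff_Svars_empty Svars_def)
      moreover have "deg_in i \<pi> = 0" using that insert.hyps by (auto simp: Svars_def)
      ultimately have "deg_in i g = 0" using h g0 deg_in_mult[of \<pi> h i] by auto
      with False show False by simp
    qed
    \<comment> \<open>A prime of the coefficient ring cannot divide \<open>g\<close>, which is
      irreducible and involves \<open>Var i\<close>; so each prime factor of \<open>c\<close>
      divides the cofactor and can be cancelled.\<close>
    have cancel: "g dvd a" if "c \<in> Svars V" "c \<noteq> 0" "a \<in> Svars ?W" "g dvd c * a" for c a
      using that
    proof (induction "tdeg c" arbitrary: c rule: less_induct)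
      case less
      show ?case
      proof (cases "c dvd 1")
        case True
        then show ?thesis using less.prems(4) by (rule dvd_unit_mult)
      next
        case False
        from factor[OF less.prems(1,2) False] obtain \<pi> c' where
          *: "c = \<pi> * c'" "irreducible \<pi>" "\<pi> \<in> Svars V" "c' \<in> Svars V" "c' \<noteq> 0" "tdeg c' < tdeg c" "prime_in ?W \<pi>"
          by blast
        obtain b where b: "c * a = g * b" using less.prems by (auto simp: dvd_def)
        show ?thesis
        proof (cases "a = 0")
          case False
          have "b dvd c * a" "c * a \<noteq> 0" using b less.prems False by auto
          moreover have "c * a \<in> Svars ?W" using less.prems by (intro Svars_mult) (auto intro: Svars_mono[rotated])
          ultimately have bW: "b \<in> Svars ?W" using Svars_dvd by blast
          have "\<pi> dvd g * b" using b * by (metis dvd_mult2 dvd_triv_left)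
          then have "\<pi> dvd b" using *(7) bW insert.prems(2) not_dvd_g[OF *(2,3)] unfolding prime_in_def by blast
          then obtain b' where "b = \<pi> * b'" by (auto simp: dvd_def)
          then have "\<pi> * (c' * a) = \<pi> * (g * b')" using b *(1) \<open>b = \<pi> * b'\<close> by algebra
          then have "c' * a = g * b'" using *(2) by (auto simp: irreducible_def)
          then show ?thesis using less.hyps[OF *(6,4,5) less.prems(3)] by simp
        qed simp
      qed
    qed
    \<comment> \<open>The denominator-free form of the irreducibility of \<open>g\<close> over the
      fraction field of \<open>Svars V\<close>.\<close>
    have split: "g dvd r \<or> deg_in i r = 0"
      if "c \<in> Svars V" "c \<noteq> 0" "q \<in> Svars ?W" "r \<in> Svars ?W" "c * g = q * r" for c q r
      using that
    proof (induction "tdeg c" arbitrary: c q r rule: less_induct)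
      case less
      have nz: "q \<noteq> 0" "r \<noteq> 0" using less.prems g0 by auto
      show ?case
      proof (cases "c dvd 1")
        case True
        then obtain e where e: "1 = c * e" by (auto simp: dvd_def)
        with less.prems(5) have "g = (e * q) * r" by algebra
        with insert.prems(1) have "e * q dvd 1 \<or> r dvd 1" by (auto simp: irreducible_def)
        then have "q dvd 1 \<or> r dvd 1" by (metis dvd_mult_right)
        then show ?thesis
        proof
          assume "q dvd 1"
          moreover have "g dvd q * r" using less.prems(5) by (metis dvd_triv_right)
          ultimately show ?thesis using dvd_unit_mult by blast
        next
          assume "r dvd 1"
          then show ?thesis by (auto simp: unit_iff_Svars_empty Svars_def)
        qed
      next
        case False
        from factor[OF less.prems(1,2) False] obtain \<pi> c' where
          *: "c = \<pi> * c'" "irreducible \<pi>" "\<pi> \<in> Svars V" "c' \<in> Svars V" "c' \<noteq> 0" "tdeg c' < tdeg c" "prime_in ?W \<pi>"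
          by blast
        have pi0: "\<pi> \<noteq> 0" using * by auto
        have "\<pi> dvd q * r" using less.prems(5) * by (metis dvd_mult2 dvd_triv_left)
        then consider "\<pi> dvd q" | "\<pi> dvd r" using *(7) less.prems(3,4) unfolding prime_in_def by blast
        then show ?thesis
        proof cases
          case 1
          then obtain q' where q': "q = \<pi> * q'" by (auto simp: dvd_def)
          then have q'W: "q' \<in> Svars ?W" using Svars_dvd[OF _ nz(1) less.prems(3)] by simp
          have "c' * g = q' * r" using less.prems(5) q' *(1) pi0 mult_left_cancel[OF pi0, of "c' * g" "q' * r"] by algebra
          then show ?thesis by (rule less.hyps[OF *(6,4,5) q'W less.prems(4)])
        next
          case 2
          then obtain r' where r': "r = \<pi> * r'" by (auto simp: dvd_def)
          then have r'W: "r' \<in> Svars ?W" using Svars_dvd[OF _ nz(2) less.prems(4)] by simp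
          have "c' * g = q * r'" using less.prems(5) r' *(1) pi0 mult_left_cancel[OF pi0, of "c' * g" "q * r'"] by algebra
          then have "g dvd r' \<or> deg_in i r' = 0" by (rule less.hyps[OF *(6,4,5) less.prems(3) r'W])
          moreover have "deg_in i \<pi> = 0" using *(3) insert.hyps by (auto simp: Svars_def)
          ultimately show ?thesis using r' nz by (auto simp: deg_in_mult)
        qed
      qed
    qed
    show ?thesis
      unfolding prime_in_def
    proof (intro ballI impI, rule ccontr)
      fix a b assume ab: "a \<in> Svars ?W" "b \<in> Svars ?W" "g dvd a * b" and n: "\<not> (g dvd a \<or> g dvd b)"
      \<comment> \<open>By minimality of its degree, \<open>r\<close> pseudo-divides every element
        of this ideal, in particular \<open>g\<close> and \<open>a\<close>. Then
        \<open>split\<close> leaves two cases: \<open>g dvd r\<close> would give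
        \<open>g dvd a\<close>, and otherwise \<open>r\<close> lies in \<open>Svars V\<close> and
        \<open>r * b\<close> is a multiple of \<open>g\<close>.\<close>
      define I where "I = {s * g + t * a | s t. s \<in> Svars ?W \<and> t \<in> Svars ?W} - {0}"
      have "1 * g + 0 * a \<in> {s * g + t * a | s t. s \<in> Svars ?W \<and> t \<in> Svars ?W}"
        using Svars_0 Svars_1 by blast
      then have "g \<in> I" using g0 by (simp add: I_def)
      then obtain r where r: "r \<in> I" "\<And>x. x \<in> I \<Longrightarrow> deg_in i r \<le> deg_in i x"
        using ex_has_least_nat[of "\<lambda>x. x \<in> I" g "deg_in i"] by blast
      then obtain s t where st: "r = s * g + t * a" "s \<in> Svars ?W" "t \<in> Svars ?W" "r \<noteq> 0" by (auto simp: I_def)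
      have rW: "r \<in> Svars ?W" unfolding st(1) by (intro Svars_add Svars_mult st ab insert.prems)
      have dvd_ex: "\<exists>c q. c \<in> Svars V \<and> c \<noteq> 0 \<and> q \<in> Svars ?W \<and> c * x = q * r"
        if x: "x = s' * g + t' * a" "s' \<in> Svars ?W" "t' \<in> Svars ?W" for x s' t'
      proof -
        have xW: "x \<in> Svars ?W" unfolding x(1) by (intro Svars_add Svars_mult x ab insert.prems)
        from pseudo_division[OF rW st(4) xW insert.hyps(2)] obtain c q e where
          *: "c \<in> Svars V" "c \<noteq> 0" "q \<in> Svars ?W" "c * x = q * r + e" "e = 0 \<or> deg_in i e < deg_in i r" by blast
        have cW: "c \<in> Svars ?W" using * by (auto intro: Svars_mono[rotated])
        have "e = (c * s' - q * s) * g + (c * t' - q * t) * a"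
          using *(4) by (simp add: x(1) st(1) algebra_simps)
        moreover have "c * s' - q * s \<in> Svars ?W" "c * t' - q * t \<in> Svars ?W"
          by (intro Svars_diff Svars_mult x st * cW)+
        ultimately have "e \<in> {s * g + t * a | s t. s \<in> Svars ?W \<and> t \<in> Svars ?W}" by blast
        then have "e = 0 \<or> e \<in> I" by (simp add: I_def)
        then have "e = 0" using r(2)[of e] *(5) by linarith
        then have "c * x = q * r" using *(4) by simp
        then show ?thesis using *(1-3) by blast
      qed
      have "g = 1 * g + 0 * a" "a = 0 * g + 1 * a" by simp_all
      note gen = this
      from dvd_ex[OF gen(1) Svars_1 Svars_0] obtain c q where
        cq: "c \<in> Svars V" "c \<noteq> 0" "q \<in> Svars ?W" "c * g = q * r" by blast
      from dvd_ex[OF gen(2) Svars_0 Svars_1] obtain c' q' where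
        cq': "c' \<in> Svars V" "c' \<noteq> 0" "q' \<in> Svars ?W" "c' * a = q' * r" by blast
      have "\<not> g dvd r"
      proof
        assume "g dvd r"
        then have "g dvd c' * a" using cq'(4) by simp
        then show False using cancel[OF cq'(1,2) ab(1)] n by blast
      qed
      with split[OF cq(1-3) rW cq(4)] have dr: "deg_in i r = 0" by simp
      have rV: "r \<in> Svars V"
        by (rule Svars_insertD[OF rW dr])
      have "r * b = (s * b) * g + t * (a * b)" by (simp add: st(1) algebra_simps)
      then have "g dvd r * b" using ab(3) by simp
      from cancel[OF rV st(4) ab(2) this] n show False by blast
    qed
  qed
qed

lemma irreducible_imp_prime_elem: "irreducible (g :: ('n::{finite,linorder}) cpoly) \<Longrightarrow> prime_elem g"
  using irreducible_imp_prime_in[of UNIV g]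
  by (auto simp: prime_elem_def prime_in_def irreducible_def)

lemma prime_factor_exists: "(p :: ('n::{finite,linorder}) cpoly) \<noteq> 0 \<Longrightarrow> \<not> p dvd 1 \<Longrightarrow> \<exists>g. prime_elem g \<and> g dvd p"
  using irreducible_factor_exists irreducible_imp_prime_elem by blast

lemma tdeg_prime_mult: "prime_elem (g :: ('n::{finite,linorder}) cpoly) \<Longrightarrow> c \<noteq> 0 \<Longrightarrow> tdeg c < tdeg (g * c)"
  using tdeg_mult[of g c] tdeg_eq_0_iff[of g] by (auto simp: prime_elem_def)

text \<open>A prime factor of \<open>p\<close> divides \<open>b * r\<close> but not
  \<open>r\<close>, so it divides \<open>b\<close>; cancel it and repeat.\<close>

lemma dvd_of_no_common_prime:
  assumes "(p :: ('n::{finite,linorder}) cpoly) \<noteq> 0" "\<And>g. prime_elem g \<Longrightarrow> g dvd p \<Longrightarrow> \<not> g dvd r" "p dvd b * r"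
  shows "p dvd b"
  using assms
proof (induction "tdeg p" arbitrary: p b rule: less_induct)
  case less
  show ?case
  proof (cases "p dvd 1")
    case False
    from prime_factor_exists[OF less.prems(1) False] obtain g p' where g: "prime_elem g" "p = g * p'"
      by (auto simp: dvd_def)
    then have p': "p' \<noteq> 0" using less.prems by auto
    have "g dvd b * r" using less.prems(3) g by (metis dvd_mult_left)
    then have "g dvd b" using g less.prems(2)[OF g(1)] by (auto simp: prime_elem_dvd_mult_iff)
    then obtain b' where b': "b = g * b'" by (auto simp: dvd_def)
    have "p' dvd b' * r" using less.prems(3) p' unfolding g(2) b'
      using g(1) by (simp add: mult.assoc prime_elem_def)
    with less.hyps[of p' b'] less.prems(2) p' tdeg_prime_mult[OF g(1) p'] have "p' dvd b'" by (auto simp: g)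
    then show ?thesis by (simp add: g b')
  qed (metis dvd_trans one_dvd)
qed

text \<open>Split off a prime \<open>g\<close> of \<open>f\<close> and of \<open>h\<close>. No prime
  of the cofactor \<open>f'\<close> divides \<open>g\<close>, since its square would divide
  \<open>f\<close>, so all of them still divide \<open>h'\<close>.\<close>

lemma squarefree_dvd_of_primes:
  assumes "squarefree (f :: ('n::{finite,linorder}) cpoly)" "\<And>g. prime_elem g \<Longrightarrow> g dvd f \<Longrightarrow> g dvd h"
  shows "f dvd h"
  using assms
proof (induction "tdeg f" arbitrary: f h rule: less_induct)
  case less
  have f0: "f \<noteq> 0" using less.prems(1) by auto
  show ?case
  proof (cases "f dvd 1")
    case False
    from prime_factor_exists[OF f0 False] obtain g f' where g: "prime_elem g" "f = g * f'"
      by (auto simp: dvd_def)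
    then have f': "f' \<noteq> 0" using f0 by auto
    obtain h' where h': "h = g * h'" using less.prems(2)[OF g(1)] g(2) by (auto simp: dvd_def)
    have sq: "squarefree f'" using less.prems(1) g(2) squarefree_mono[of f' f] by simp
    have "k dvd h'" if k: "prime_elem k" "k dvd f'" for k
    proof -
      have "\<not> k dvd g"
      proof
        assume "k dvd g"
        then have "k ^ 2 dvd f" using k(2) g(2) by (simp add: power2_eq_square mult_dvd_mono)
        then show False using less.prems(1) k(1) by (auto simp: squarefree_def prime_elem_def)
      qed
      moreover have "k dvd g * h'" using less.prems(2)[OF k(1)] k(2) g(2) h' by simp
      ultimately show ?thesis using k(1) by (simp add: prime_elem_dvd_mult_iff)
    qed
    then have "f' dvd h'" using less.hyps[of f' h'] sq tdeg_prime_mult[OF g(1) f'] by (simp add: g)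
    then show ?thesis by (simp add: g h')
  qed (metis dvd_trans one_dvd)
qed

section \<open>Dimensions of subspaces that lie in the span of a finite set\<close>

locale linear_space = vector_space

context linear_space
begin

text \<open>\<open>dim\<close> is the cardinality of a basis and hence 0 for infinite bases, so
  dimension counts need this side condition. It is inherited by subsets, and no ambient
  finite-dimensional space is assumed.\<close>

definition findim :: "'b set \<Rightarrow> bool" where
  "findim V \<longleftrightarrow> (\<exists>A. finite A \<and> V \<subseteq> span A)"

lemma findim_subset: "findim V \<Longrightarrow> U \<subseteq> V \<Longrightarrow> findim U"
  unfolding findim_def by blast

lemma findim_independent:
  assumes "findim V" "independent B" "B \<subseteq> V"
  shows "finite B"
proof -
  obtain A where A: "finite A" "V \<subseteq> span A" using assms(1) by (auto simp: findim_def)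
  show ?thesis using independent_span_bound[OF A(1) assms(2)] A(2) assms(3) by blast
qed

lemma findim_basis:
  assumes "findim V"
  obtains B where "finite B" "B \<subseteq> V" "independent B" "V \<subseteq> span B" "card B = dim V"
  using basis_exists[of V] findim_independent[OF assms] by metis

lemma dim_mono_findim:
  assumes "U \<subseteq> V" "findim V"
  shows "dim U \<le> dim V"
proof -
  obtain B where "finite B" "V \<subseteq> span B" "card B = dim V" using findim_basis[OF assms(2)] by metis
  with assms(1) show ?thesis using dim_le_card[of U B] by auto
qed

lemma span_Int_span_complement:
  assumes "independent B" "C \<subseteq> B" "x \<in> span C" "x \<in> span (B - C)"
  shows "x = 0"
proof -
  have "representation B x b = 0" for b
  proof -
    have "representation B x = representation C x"
      by (rule representation_extend[OF assms(1,3,2)])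
    moreover have "representation B x = representation (B - C) x"
      by (rule representation_extend[OF assms(1,4)]) blast
    ultimately show ?thesis using representation_ne_zero[of C x b] representation_ne_zero[of "B - C" x b]
      by (cases "b \<in> C") auto
  qed
  moreover have "x \<in> span B" using assms(2,3) span_mono by blast
  ultimately show ?thesis
    using sum_nonzero_representation_eq[OF assms(1), of x] by simp
qed

text \<open>A substitute for the quotient map by \<open>U\<close>: extend a basis of
  \<open>U\<close> to the whole space, send its members to 0 and fix the others.\<close>

lemma projection_exists:
  assumes "subspace U"
  shows "\<exists>\<pi>. Vector_Spaces.linear scale scale \<pi> \<and> (\<forall>x. \<pi> x = 0 \<longleftrightarrow> x \<in> U)"
proof -
  interpret p: vector_space_pair scale scale by unfold_locales
  obtain C where C: "C \<subseteq> U" "independent C" "U \<subseteq> span C" using basis_exists by metis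
  obtain B where B: "C \<subseteq> B" "independent B" "UNIV \<subseteq> span B"
    using maximal_independent_subset_extend[of C UNIV] C(2) by auto
  obtain \<pi> where \<pi>: "Vector_Spaces.linear scale scale \<pi>" "\<And>x. x \<in> B \<Longrightarrow> \<pi> x = (if x \<in> C then 0 else x)"
    using p.linear_independent_extend[OF B(2), of "\<lambda>x. if x \<in> C then 0 else x"] by metis
  interpret \<pi>: Vector_Spaces.linear scale scale \<pi> by (rule \<pi>(1))
  \<comment> \<open>This yields the harder inclusion: if \<pi> vanishes at \<open>x\<close>, then
    \<open>x = x - \<pi> x\<close> is in \<open>U\<close>.\<close>
  have sub: "x - \<pi> x \<in> U" for x
  proof -
    have "x \<in> span B" using B(3) by blast
    then show ?thesis
    proof (induction rule: span_induct_alt)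
      case base
      then show ?case using assms subspace_0 by (simp add: \<pi>.zero)
    next
      case (step c x y)
      have "scale c (x - \<pi> x) \<in> U"
        using step(1) C(1) subspace_scale[OF assms] subspace_0[OF assms] by (auto simp: \<pi>(2))
      then have "scale c (x - \<pi> x) + (y - \<pi> y) \<in> U" using step(2) subspace_add[OF assms] by blast
      then show ?case by (simp add: \<pi>.add \<pi>.scale scale_right_diff_distrib algebra_simps)
    qed
  qed
  have "\<pi> x = 0" if "x \<in> U" for x
  proof -
    have "x \<in> span C" using C that by blast
    then show ?thesis
      by (induction rule: span_induct_alt) (use B(1) in \<open>auto simp: \<pi>.zero \<pi>.add \<pi>.scale \<pi>(2)\<close>)
  qed
  then show ?thesis using \<pi>(1) sub by (metis diff_zero)
qed

end

locale linear_space_pair = vector_space_pair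

sublocale linear_space_pair \<subseteq> vs1: linear_space s1 by unfold_locales
sublocale linear_space_pair \<subseteq> vs2: linear_space s2 by unfold_locales

lemma (in linear_space_pair) rank_nullity:
  assumes f: "Vector_Spaces.linear s1 s2 f" and V: "vs1.subspace V" "vs1.findim V"
  shows "vs2.findim (f ` V)" "vs2.dim (f ` V) + vs1.dim {x \<in> V. f x = 0} = vs1.dim V"
proof -
  interpret f: Vector_Spaces.linear s1 s2 f by (rule f)
  let ?K = "{x \<in> V. f x = 0}"
  obtain C where C: "C \<subseteq> ?K" "vs1.independent C" "?K \<subseteq> vs1.span C" "card C = vs1.dim ?K"
    using vs1.basis_exists[of ?K] by blast
  have "C \<subseteq> V" using C(1) by blast
  from vs1.maximal_independent_subset_extend[OF this C(2)] obtain B where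
    B: "C \<subseteq> B" "B \<subseteq> V" "vs1.independent B" "V \<subseteq> vs1.span B" by metis
  have finB: "finite B" by (rule vs1.findim_independent[OF V(2) B(3,2)])
  have spB: "vs1.span B = V" using B(2,4) V(1) by (metis subset_antisym vs1.span_minimal)
  have inj: "inj_on f (vs1.span (B - C))"
  proof (rule inj_onI)
    fix x y assume xy: "x \<in> vs1.span (B - C)" "y \<in> vs1.span (B - C)" "f x = f y"
    have d: "x - y \<in> vs1.span (B - C)" by (rule vs1.span_diff[OF xy(1,2)])
    then have "x - y \<in> vs1.span B" using vs1.span_mono[of "B - C" B] by blast
    then have "x - y \<in> ?K" using xy(3) spB by (simp add: f.diff)
    then have "x - y = 0" using vs1.span_Int_span_complement[OF B(3,1)] C(3) d by blast
    then show "x = y" by simp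
  qed
  have ind: "vs2.independent (f ` (B - C))"
    by (rule f.independent_injective_image[OF vs1.independent_mono[OF B(3)] inj]) blast
  have "f ` B \<subseteq> insert 0 (f ` (B - C))" using C(1) by blast
  then have "vs2.span (f ` B) \<subseteq> vs2.span (f ` (B - C))" by (metis vs2.span_insert_0 vs2.span_mono)
  moreover have "vs2.span (f ` B) = f ` V" by (simp add: f.span_image spB)
  moreover have "f ` (B - C) \<subseteq> f ` V" using B(2) by blast
  ultimately have *: "f ` (B - C) \<subseteq> f ` V" "f ` V \<subseteq> vs2.span (f ` (B - C))" by blast+
  then show "vs2.findim (f ` V)" unfolding vs2.findim_def using finB finite_imageI[of "B - C" f] by (meson finite_Diff)
  have "vs2.dim (f ` V) = card (f ` (B - C))"
    by (rule vs2.basis_card_eq_dim[OF * ind, symmetric])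
  also have "\<dots> = card (B - C)"
    by (rule card_image[OF inj_on_subset[OF inj]]) (use vs1.span_superset in blast)
  also have "\<dots> + card C = card B" using finB B(1) by (simp add: card_Diff_subset finite_subset card_mono)
  finally show "vs2.dim (f ` V) + vs1.dim ?K = vs1.dim V"
    using C(4) vs1.basis_card_eq_dim[OF B(2,4,3)] by simp
qed

lemma (in linear_space_pair) dim_image_inj:
  assumes "Vector_Spaces.linear s1 s2 f" "vs1.subspace V" "vs1.findim V" "\<And>x. x \<in> V \<Longrightarrow> f x = 0 \<Longrightarrow> x = 0"
  shows "vs2.dim (f ` V) = vs1.dim V"
proof -
  interpret f: Vector_Spaces.linear s1 s2 f by (rule assms)
  have "{x \<in> V. f x = 0} = {0}" using assms(2,4) vs1.subspace_0 by (auto simp: f.zero)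
  moreover have "vs1.dim {0} = 0" using vs1.dim_le_card[of "{0}" "{}"] by simp
  ultimately show ?thesis using rank_nullity(2)[OF assms(1-3)] by simp
qed

context linear_space
begin

text \<open>A projection with kernel \<open>U\<close> has the same image on the sum as on
  \<open>W\<close>; its kernels there are \<open>U\<close> and \<open>U \<inter> W\<close>.\<close>

lemma dim_sum_Int:
  assumes "subspace U" "subspace W" "findim U" "findim W"
  shows "dim {u + w | u w. u \<in> U \<and> w \<in> W} + dim (U \<inter> W) = dim U + dim W"
    and "findim {u + w | u w. u \<in> U \<and> w \<in> W}"
proof -
  interpret p: linear_space_pair scale scale by unfold_locales
  let ?S = "{u + w | u w. u \<in> U \<and> w \<in> W}"
  obtain A B where AB: "finite A" "U \<subseteq> span A" "finite B" "W \<subseteq> span B"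
    using assms(3,4) by (auto simp: findim_def)
  have "?S \<subseteq> span (A \<union> B)"
  proof
    fix x assume "x \<in> ?S"
    then obtain u w where "x = u + w" "u \<in> span A" "w \<in> span B" using AB by blast
    then show "x \<in> span (A \<union> B)"
      using span_mono[of A "A \<union> B"] span_mono[of B "A \<union> B"] span_add by blast
  qed
  then show fin: "findim ?S" using AB by (auto simp: findim_def)
  obtain \<pi> where \<pi>: "Vector_Spaces.linear scale scale \<pi>" "\<And>x. \<pi> x = 0 \<longleftrightarrow> x \<in> U"
    using projection_exists[OF assms(1)] by blast
  interpret \<pi>: Vector_Spaces.linear scale scale \<pi> by (rule \<pi>(1))
  have im: "\<pi> ` ?S = \<pi> ` W"
  proof (intro subset_antisym subsetI)
    fix y assume "y \<in> \<pi> ` ?S"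
    then obtain u w where "y = \<pi> (u + w)" "u \<in> U" "w \<in> W" by blast
    then have "y = \<pi> w" using \<pi>(2)[of u] by (simp add: \<pi>.add)
    then show "y \<in> \<pi> ` W" using \<open>w \<in> W\<close> by blast
  next
    fix y assume "y \<in> \<pi> ` W"
    then obtain w where w: "y = \<pi> (0 + w)" "w \<in> W" by auto
    then show "y \<in> \<pi> ` ?S" using subspace_0[OF assms(1)] by blast
  qed
  have "U \<subseteq> ?S"
  proof
    fix u assume "u \<in> U"
    then have "u + 0 \<in> ?S" using subspace_0[OF assms(2)] by blast
    then show "u \<in> ?S" by simp
  qed
  then have ker: "{x \<in> ?S. \<pi> x = 0} = U" using \<pi>(2) by blast
  have "dim (\<pi> ` W) + dim U = dim ?S"
    using p.rank_nullity(2)[OF \<pi>(1) subspace_sums[OF assms(1,2)] fin] im ker by simp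
  moreover have "{x \<in> W. \<pi> x = 0} = U \<inter> W" using \<pi>(2) by blast
  then have "dim (\<pi> ` W) + dim (U \<inter> W) = dim W"
    using p.rank_nullity(2)[OF \<pi>(1) assms(2,4)] by simp
  ultimately show "dim ?S + dim (U \<inter> W) = dim U + dim W" by simp
qed

text \<open>Extend a basis \<open>C\<close> of \<open>V \<inter> W\<close> to a basis
  \<open>B\<close> of \<open>V\<close>; the added vectors \<open>B - C\<close> represent a basis of
  the quotient.\<close>

lemma dim_quotient_basis_exists:
  assumes "subspace V" "subspace W" "findim V"
  obtains B where "finite B" "B \<subseteq> V" "card B + dim (V \<inter> W) = dim V"
    "\<And>p. p \<in> V \<Longrightarrow> \<exists>!c. (\<forall>b. b \<notin> B \<longrightarrow> c b = 0) \<and> p - (\<Sum>b\<in>B. scale (c b) b) \<in> W"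
proof -
  obtain C where C: "C \<subseteq> V \<inter> W" "independent C" "V \<inter> W \<subseteq> span C" "card C = dim (V \<inter> W)"
    using basis_exists by metis
  have "C \<subseteq> V" using C(1) by blast
  from maximal_independent_subset_extend[OF this C(2)] obtain B where
    B: "C \<subseteq> B" "B \<subseteq> V" "independent B" "V \<subseteq> span B" by metis
  have finB: "finite B" by (rule findim_independent[OF assms(3) B(3,2)])
  have dimB: "card B = dim V" by (rule basis_card_eq_dim[OF B(2,4,3)])
  show ?thesis
  proof (rule that[of "B - C"])
    show "finite (B - C)" "B - C \<subseteq> V" using finB B by auto
    show "card (B - C) + dim (V \<inter> W) = dim V"
      using card_Diff_subset[OF finite_subset[OF B(1) finB] B(1)] card_mono[OF finB B(1)] C(4) dimB by simp
    fix p assume p: "p \<in> V"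
    obtain u where u: "p = (\<Sum>b\<in>B. scale (u b) b)"
      using p B(4) span_finite[OF finB] by auto
    have "p - (\<Sum>b\<in>B - C. scale (u b) b) = (\<Sum>b\<in>C. scale (u b) b)"
      unfolding u using sum.subset_diff[OF B(1) finB, of "\<lambda>b. scale (u b) b"] by simp
    also have "\<dots> \<in> W"
      by (rule subspace_sum[OF assms(2)]) (use C(1) subspace_scale[OF assms(2)] in blast)
    finally have u_in: "p - (\<Sum>b\<in>B - C. scale (u b) b) \<in> W" .
    show "\<exists>!c. (\<forall>b. b \<notin> B - C \<longrightarrow> c b = 0) \<and> p - (\<Sum>b\<in>B - C. scale (c b) b) \<in> W"
    proof (rule ex_ex1I)
      have "(\<Sum>b\<in>B - C. scale (u b) b) = (\<Sum>b\<in>B - C. scale (if b \<in> B - C then u b else 0) b)"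
        by (rule sum.cong) auto
      then show "\<exists>c. (\<forall>b. b \<notin> B - C \<longrightarrow> c b = 0) \<and> p - (\<Sum>b\<in>B - C. scale (c b) b) \<in> W"
        using u_in by (intro exI[of _ "\<lambda>b. if b \<in> B - C then u b else 0"]) auto
    next
      fix c d
      assume c: "(\<forall>b. b \<notin> B - C \<longrightarrow> c b = 0) \<and> p - (\<Sum>b\<in>B - C. scale (c b) b) \<in> W"
        and d: "(\<forall>b. b \<notin> B - C \<longrightarrow> d b = 0) \<and> p - (\<Sum>b\<in>B - C. scale (d b) b) \<in> W"
      let ?x = "\<Sum>b\<in>B - C. scale (d b - c b) b"
      have "?x = (p - (\<Sum>b\<in>B - C. scale (c b) b)) - (p - (\<Sum>b\<in>B - C. scale (d b) b))"
        by (simp add: scale_left_diff_distrib sum_subtractf)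
      then have "?x \<in> W"
        using subspace_diff[OF assms(2) conjunct2[OF c] conjunct2[OF d]] by simp
      moreover have spx: "?x \<in> span (B - C)" by (intro span_sum span_scale span_base)
      then have "?x \<in> V" using B(2) assms(1) span_minimal[of "B - C" V] by blast
      ultimately have "?x = 0" using span_Int_span_complement[OF B(3,1)] C(3) spx by blast
      then have "d b - c b = 0" if "b \<in> B - C" for b
        using independentD[OF B(3), of "B - C" "\<lambda>b. d b - c b" b] finB that by auto
      then show "c = d" using c d by (metis eq_iff_diff_eq_0 ext)
    qed
  qed
qed

text \<open>Makes the \<open>THE\<close> in \<open>quotient_dim\<close> well defined. A projection
  with kernel \<open>W\<close> is injective on the span of \<open>B\<close> and maps it onto the
  image of \<open>V\<close>.\<close>

lemma dim_quotient_basis_unique: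
  assumes "subspace V" "subspace W" "findim V" "finite B" "B \<subseteq> V"
    "\<And>p. p \<in> V \<Longrightarrow> \<exists>!c. (\<forall>b. b \<notin> B \<longrightarrow> c b = 0) \<and> p - (\<Sum>b\<in>B. scale (c b) b) \<in> W"
  shows "card B + dim (V \<inter> W) = dim V"
proof -
  interpret p: linear_space_pair scale scale by unfold_locales
  obtain \<pi> where \<pi>: "Vector_Spaces.linear scale scale \<pi>" "\<And>x. \<pi> x = 0 \<longleftrightarrow> x \<in> W"
    using projection_exists[OF assms(2)] by blast
  interpret \<pi>: Vector_Spaces.linear scale scale \<pi> by (rule \<pi>(1))
  \<comment> \<open>Uniqueness of the coefficients, applied to the vector 0, is independence of
    \<open>B\<close> modulo \<open>W\<close>.\<close>
  have zero: "c b = 0" if "(\<Sum>b\<in>B. scale (c b) b) \<in> W" "b \<in> B" for c b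
  proof -
    let ?c = "\<lambda>b. if b \<in> B then c b else 0"
    have *: "(\<Sum>b\<in>B. scale (c b) b) = (\<Sum>b\<in>B. scale (?c b) b)" by (rule sum.cong) auto
    have "0 \<in> V" using assms(1) by (rule subspace_0)
    from assms(6)[OF this]
    have uniq: "\<And>c d. (\<forall>b. b \<notin> B \<longrightarrow> c b = 0) \<and> 0 - (\<Sum>b\<in>B. scale (c b) b) \<in> W \<Longrightarrow>
       (\<forall>b. b \<notin> B \<longrightarrow> d b = 0) \<and> 0 - (\<Sum>b\<in>B. scale (d b) b) \<in> W \<Longrightarrow> c = d" by blast
    have "?c = (\<lambda>_. 0)"
    proof (rule uniq)
      show "(\<forall>b. b \<notin> B \<longrightarrow> ?c b = 0) \<and> 0 - (\<Sum>b\<in>B. scale (?c b) b) \<in> W"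
        using subspace_neg[OF assms(2) that(1)] unfolding * by simp
      show "(\<forall>b. b \<notin> B \<longrightarrow> (0::'a) = 0) \<and> 0 - (\<Sum>b\<in>B. scale 0 b) \<in> W"
        using subspace_0[OF assms(2)] by simp
    qed
    then have "?c b = 0" by metis
    then show ?thesis using that(2) by simp
  qed
  have ind: "independent B"
    using assms(4) by (rule independent_if_scalars_zero) (use zero subspace_0[OF assms(2)] in metis)
  have inj: "inj_on \<pi> (span B)"
  proof (rule inj_onI)
    fix x y assume xy: "x \<in> span B" "y \<in> span B" "\<pi> x = \<pi> y"
    have "x - y \<in> span B" using xy by (intro span_diff)
    then obtain u where u: "x - y = (\<Sum>b\<in>B. scale (u b) b)" using span_finite[OF assms(4)] by auto
    have "x - y \<in> W" using xy(3) \<pi>(2)[of "x - y"] by (simp add: \<pi>.diff)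
    with u have "u b = 0" if "b \<in> B" for b using zero that by simp
    then have "x - y = 0" unfolding u by (intro sum.neutral) auto
    then show "x = y" by simp
  qed
  have "\<pi> ` V \<subseteq> span (\<pi> ` B)"
  proof
    fix y assume "y \<in> \<pi> ` V"
    then obtain p where p: "p \<in> V" "y = \<pi> p" by blast
    from assms(6)[OF p(1)] obtain c where "p - (\<Sum>b\<in>B. scale (c b) b) \<in> W" by blast
    then have "\<pi> p = \<pi> (\<Sum>b\<in>B. scale (c b) b)" using \<pi>(2)[of "p - (\<Sum>b\<in>B. scale (c b) b)"] by (simp add: \<pi>.diff)
    also have "\<dots> \<in> \<pi> ` span B" by (intro imageI span_sum span_scale span_base)
    finally show "y \<in> span (\<pi> ` B)" using p by (simp add: \<pi>.span_image)
  qed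
  then have "dim (\<pi> ` V) = card (\<pi> ` B)"
    using \<pi>.independent_injective_image[OF ind inj] assms(5) by (intro basis_card_eq_dim[symmetric]) auto
  also have "\<dots> = card B" by (rule card_image[OF inj_on_subset[OF inj span_superset]])
  finally have "dim (\<pi> ` V) = card B" .
  moreover have "{x \<in> V. \<pi> x = 0} = V \<inter> W" using \<pi>(2) by blast
  ultimately show ?thesis using p.rank_nullity(2)[OF \<pi>(1) assms(1,3)] by simp
qed

end

section \<open>Hilbert functions of homogeneous ideals\<close>

global_interpretation CP: linear_space "\<lambda>c (p :: 'n cpoly). Const c * p"
  by unfold_locales (simp_all add: algebra_simps Const_add Const_mult)

global_interpretation CPP: linear_space_pair "\<lambda>c (p :: 'n cpoly). Const c * p" "\<lambda>c (p :: 'n cpoly). Const c * p"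
  by unfold_locales

section \<open>Monomial bases of the graded pieces\<close>

lemma finite_mon_degree: "finite {m :: ('n::finite) \<Rightarrow>\<^sub>0 nat. mon_degree m = t}"
proof -
  have "Poly_Mapping.lookup m i \<le> mon_degree m" for m :: "'n \<Rightarrow>\<^sub>0 nat" and i
    unfolding mon_degree_def by (rule member_le_sum) auto
  then have "{m :: 'n \<Rightarrow>\<^sub>0 nat. mon_degree m = t} \<subseteq> Poly_Mapping.lookup -` (UNIV \<rightarrow>\<^sub>E {..t})"
    by (auto simp: PiE_def extensional_def)
  moreover have "finite (UNIV \<rightarrow>\<^sub>E {..t} :: ('n \<Rightarrow> nat) set)" by (rule finite_PiE) simp_all
  then have "finite (Poly_Mapping.lookup -` (UNIV \<rightarrow>\<^sub>E {..t}) :: ('n \<Rightarrow>\<^sub>0 nat) set)"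
    by (rule finite_vimageI) (meson injI poly_mapping_eq_iff)
  ultimately show ?thesis by (rule finite_subset)
qed

abbreviation monomial :: "('n \<Rightarrow>\<^sub>0 nat) \<Rightarrow> 'n cpoly" where
  "monomial m \<equiv> Poly_Mapping.single m 1"

lemma single_eq_Const_mult: "Poly_Mapping.single m c = Const c * monomial m"
  by (simp add: Const_def mult_single)

lemma inj_monomial: "inj_on (monomial :: _ \<Rightarrow> 'n cpoly) A"
proof (rule inj_onI)
  fix x y :: "'n \<Rightarrow>\<^sub>0 nat"
  assume "(monomial x :: 'n cpoly) = monomial y"
  then have "coef (monomial x :: 'n cpoly) x = coef (monomial y) x" by simp
  then show "x = y" by (simp add: lookup_single when_def split: if_splits)
qed

lemma independent_monomials:
  "CP.independent (monomial ` (A :: ('n \<Rightarrow>\<^sub>0 nat) set))"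
proof (unfold CP.independent_explicit_finite_subsets, intro allI impI ballI)
  fix B u v assume B: "B \<subseteq> monomial ` A" "finite B" "(\<Sum>v\<in>B. Const (u v) * v) = 0" "v \<in> B"
  then obtain M where M: "B = monomial ` M" by (metis subset_imageE)
  with B(4) obtain m where m: "v = monomial m" "m \<in> M" by blast
  note inj = inj_monomial[of M]
  then have finM: "finite M" using B(2) M finite_imageD by blast
  have "0 = coef (\<Sum>v\<in>B. Const (u v) * v) m" using B(3) by simp
  also have "\<dots> = (\<Sum>k\<in>M. u (monomial k) * coef (monomial k) m)"
    unfolding M by (subst sum.reindex[OF inj]) (simp add: lookup_sum)
  also have "\<dots> = (\<Sum>k\<in>M. if k = m then u (monomial k) else 0)"
    by (rule sum.cong) (simp_all add: lookup_single when_def)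
  also have "\<dots> = u v" using finM m by (simp add: sum.delta)
  finally show "u v = 0" by simp
qed

lemma span_monomials: "CP.span (monomial ` A) = {p. Poly_Mapping.keys p \<subseteq> A}" (is "_ = ?S")
proof (rule CP.span_unique)
  show "monomial ` A \<subseteq> ?S" by auto
  show "CP.subspace ?S"
  proof (rule CP.subspaceI)
    fix p q assume "p \<in> ?S" "q \<in> ?S"
    then show "p + q \<in> ?S" using keys_add[of p q] by blast
  qed (auto simp: in_keys_iff)
  fix T assume T: "monomial ` A \<subseteq> T" "CP.subspace T"
  show "?S \<subseteq> T"
  proof
    fix p assume "p \<in> ?S"
    then have "Poly_Mapping.single m (coef p m) \<in> T" if "m \<in> Poly_Mapping.keys p" for m
    proof -
      have "monomial m \<in> T" using that T(1) \<open>p \<in> ?S\<close> by blast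
      then show ?thesis unfolding single_eq_Const_mult[of m "coef p m"] by (rule CP.subspace_scale[OF T(2)])
    qed
    then show "p \<in> T" using CP.subspace_sum[OF T(2)] sum_single_coef[of p] by metis
  qed
qed

lemma dim_monomials:
  assumes "finite A"
  shows "CP.dim {p. Poly_Mapping.keys p \<subseteq> A} = card A" "CP.findim {p. Poly_Mapping.keys p \<subseteq> A}"
  unfolding span_monomials[symmetric]
  using CP.dim_span_eq_card_independent[OF independent_monomials, of A] card_image[OF inj_monomial, of A] assms
  by (auto simp: CP.findim_def)

abbreviation Hom :: "nat \<Rightarrow> ('n::finite) cpoly set" where
  "Hom t \<equiv> {p. homogeneous t p}"

lemma Hom_keys: "Hom t = {p. Poly_Mapping.keys p \<subseteq> {m. mon_degree m = t}}"
  by (auto simp: homogeneous_def)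

lemma subspace_Hom [simp]: "CP.subspace (Hom t)"
  by (rule CP.subspaceI) (auto intro: homogeneous_add homogeneous_Const_mult)

lemma findim_Hom [simp]: "CP.findim (Hom t)"
  unfolding Hom_keys by (rule dim_monomials(2)[OF finite_mon_degree])

lemma dim_Hom: "CP.dim (Hom t :: ('n::finite) cpoly set) = card {m :: 'n \<Rightarrow>\<^sub>0 nat. mon_degree m = t}"
  unfolding Hom_keys by (rule dim_monomials(1)[OF finite_mon_degree])

lemma ideal_imp_subspace: "S_ideal.subspace I \<Longrightarrow> CP.subspace I"
  by (auto simp: S_ideal.subspace_def intro!: CP.subspaceI)

text \<open>Turns the Hilbert function, defined through \<open>THE\<close>, into dimensions of
  subspaces; the additive form avoids truncated subtraction.\<close>

lemma hilbert_function_eq: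
  fixes I :: "('n::finite) cpoly set"
  assumes "S_ideal.subspace I"
  shows "hilbert_function I t + CP.dim (Hom t \<inter> I) = CP.dim (Hom t :: 'n cpoly set)"
proof -
  note I = ideal_imp_subspace[OF assms]
  have iff: "quotient_basis (Hom t) I B \<longleftrightarrow> finite B \<and> B \<subseteq> Hom t \<and>
     (\<forall>p\<in>Hom t. \<exists>!c. (\<forall>b. b \<notin> B \<longrightarrow> c b = 0) \<and> p - (\<Sum>b\<in>B. Const (c b) * b) \<in> I)" for B
    by (simp add: quotient_basis_def)
  have "\<exists>B. quotient_basis (Hom t) I B \<and> card B = CP.dim (Hom t :: 'n cpoly set) - CP.dim (Hom t \<inter> I)"
  proof -
    obtain B where
      "finite B" "B \<subseteq> Hom t" "card B + CP.dim (Hom t \<inter> I) = CP.dim (Hom t :: 'n cpoly set)"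
      "\<And>p. p \<in> Hom t \<Longrightarrow> \<exists>!c. (\<forall>b. b \<notin> B \<longrightarrow> c b = 0) \<and> p - (\<Sum>b\<in>B. Const (c b) * b) \<in> I"
      using CP.dim_quotient_basis_exists[OF subspace_Hom[of t] I findim_Hom] by blast
    then show ?thesis unfolding iff by (intro exI[of _ B]) auto
  qed
  moreover have "card B + CP.dim (Hom t \<inter> I) = CP.dim (Hom t :: 'n cpoly set)" if "quotient_basis (Hom t) I B" for B
    by (rule CP.dim_quotient_basis_unique[OF subspace_Hom I findim_Hom]) (use that in \<open>auto simp: iff\<close>)
  ultimately have "hilbert_function I t = CP.dim (Hom t :: 'n cpoly set) - CP.dim (Hom t \<inter> I)"
    unfolding hilbert_function_def quotient_dim_def by (intro the_equality) force+
  moreover have "CP.dim (Hom t \<inter> I) \<le> CP.dim (Hom t :: 'n cpoly set)" by (rule CP.dim_mono_findim) auto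
  ultimately show ?thesis by simp
qed

lemma findim_Hom_Int [simp]: "CP.findim (Hom t \<inter> I)"
  by (rule CP.findim_subset[OF findim_Hom]) blast

lemma hilbert_function_mono:
  assumes "S_ideal.subspace I" "S_ideal.subspace J" "Hom t \<inter> I \<subseteq> J"
  shows "hilbert_function J t \<le> hilbert_function I t"
proof -
  have "CP.dim (Hom t \<inter> I) \<le> CP.dim (Hom t \<inter> J)" by (rule CP.dim_mono_findim) (use assms(3) in auto)
  then show ?thesis using hilbert_function_eq[OF assms(1), of t] hilbert_function_eq[OF assms(2), of t] by linarith
qed

lemma hilbert_function_eq_0:
  assumes "S_ideal.subspace I" "Hom t \<subseteq> I"
  shows "hilbert_function I t = 0"
  using hilbert_function_eq[OF assms(1), of t] assms(2) by (simp add: Int_absorb2)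

lemma hilbert_function_pos:
  fixes I :: "('n::finite) cpoly set"
  assumes "S_ideal.subspace I" "homogeneous t p" "p \<notin> I"
  shows "0 < hilbert_function I t"
proof -
  note I = ideal_imp_subspace[OF assms(1)]
  obtain B where B: "finite B" "card B + CP.dim (Hom t \<inter> I) = CP.dim (Hom t :: 'n cpoly set)"
      "\<forall>p\<in>Hom t. \<exists>!c. (\<forall>b. b \<notin> B \<longrightarrow> c b = 0) \<and> p - (\<Sum>b\<in>B. Const (c b) * b) \<in> I"
    by (rule CP.dim_quotient_basis_exists[OF subspace_Hom[of t] I findim_Hom]) simp
  have "B \<noteq> {}" using bspec[OF B(3), of p] assms by auto
  then have "card B > 0" using B(1) by (simp add: card_gt_0_iff)
  then show ?thesis using B(2) hilbert_function_eq[OF assms(1), of t] by linarith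
qed

text \<open>Equivalent to \<open>homogeneous_ideal\<close>, but stated by closure under components,
  which passes easily to \<open>add_ideal\<close> and \<open>colon\<close>.\<close>

definition hideal :: "('n::finite) cpoly set \<Rightarrow> bool" where
  "hideal I \<longleftrightarrow> S_ideal.subspace I \<and> (\<forall>p\<in>I. \<forall>t. hcomp t p \<in> I)"

lemma hidealD: "hideal I \<Longrightarrow> S_ideal.subspace I" "hideal I \<Longrightarrow> p \<in> I \<Longrightarrow> hcomp t p \<in> I"
  by (auto simp: hideal_def)

lemma hideal_hcompI:
  assumes "S_ideal.subspace I" "\<And>t. hcomp t p \<in> I"
  shows "p \<in> I"
  by (subst sum_hcomp, rule S_ideal.subspace_sum[OF assms(1)]) (rule assms(2))

lemma hideal_span:
  assumes "\<And>p. p \<in> G \<Longrightarrow> \<exists>e. homogeneous e p"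
  shows "hideal (S_ideal.span G)"
  unfolding hideal_def
proof (intro conjI ballI allI)
  fix p t assume "p \<in> S_ideal.span G"
  then show "hcomp t p \<in> S_ideal.span G"
  proof (induction rule: S_ideal.span_induct_alt)
    case base
    then show ?case by (simp add: S_ideal.span_zero)
  next
    case (step c x y)
    obtain e where "homogeneous e x" using assms step(1) by blast
    then have "hcomp t (c * x) \<in> S_ideal.span G"
      using step(1) by (auto simp: hcomp_mult intro: S_ideal.span_scale S_ideal.span_base S_ideal.span_zero)
    then show ?case using step(2) by (simp add: hcomp_add S_ideal.span_add)
  qed
qed auto

lemma homogeneous_ideal_iff: "homogeneous_ideal I \<longleftrightarrow> hideal I"
proof
  assume I: "homogeneous_ideal I"
  then have "I = S_ideal.span {p \<in> I. \<exists>e. homogeneous e p}" unfolding homogeneous_ideal_def by blast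
  moreover have "hideal (S_ideal.span {p \<in> I. \<exists>e. homogeneous e p})" by (rule hideal_span) blast
  ultimately show "hideal I" by simp
next
  assume I: "hideal I"
  then have sub: "S_ideal.subspace I" by (rule hidealD)
  have "I \<subseteq> S_ideal.span {p \<in> I. \<exists>e. homogeneous e p}"
  proof
    fix p assume "p \<in> I"
    have "hcomp t p \<in> S_ideal.span {p \<in> I. \<exists>e. homogeneous e p}" for t
      by (rule S_ideal.span_base) (use hidealD(2)[OF I \<open>p \<in> I\<close>] homogeneous_hcomp in blast)
    then show "p \<in> S_ideal.span {p \<in> I. \<exists>e. homogeneous e p}"
      by (rule hideal_hcompI[OF S_ideal.subspace_span])
  qed
  moreover have "S_ideal.span {p \<in> I. \<exists>e. homogeneous e p} \<subseteq> I"
    by (rule S_ideal.span_minimal[OF _ sub]) blast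
  ultimately show "homogeneous_ideal I" using sub unfolding homogeneous_ideal_def by blast
qed

definition add_ideal :: "'n cpoly set \<Rightarrow> 'n cpoly \<Rightarrow> 'n cpoly set" where
  "add_ideal I a = {p + q * a | p q. p \<in> I}"

definition colon :: "'n cpoly set \<Rightarrow> 'n cpoly \<Rightarrow> 'n cpoly set" where
  "colon I a = {q. q * a \<in> I}"

lemma ideal_mult: "S_ideal.subspace I \<Longrightarrow> p \<in> I \<Longrightarrow> q * p \<in> I"
  using S_ideal.subspace_scale by blast

lemma hideal_add_ideal:
  assumes "hideal I" "homogeneous e a"
  shows "hideal (add_ideal I a)"
  unfolding hideal_def
proof (intro conjI ballI allI)
  note I = hidealD(1)[OF assms(1)]
  show "S_ideal.subspace (add_ideal I a)"
  proof (rule S_ideal.subspaceI)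
    show "0 \<in> add_ideal I a" unfolding add_ideal_def using S_ideal.subspace_0[OF I]
      by (intro CollectI exI[of _ 0]) simp
    fix x y assume "x \<in> add_ideal I a"
    then obtain p q where x: "x = p + q * a" "p \<in> I" by (auto simp: add_ideal_def)
    fix c
    have "c * x = c * p + (c * q) * a" by (simp add: x algebra_simps)
    then show "c * x \<in> add_ideal I a" unfolding add_ideal_def using ideal_mult[OF I x(2)] by blast
    assume "y \<in> add_ideal I a"
    then obtain p' q' where y: "y = p' + q' * a" "p' \<in> I" by (auto simp: add_ideal_def)
    have "x + y = (p + p') + (q + q') * a" by (simp add: x y algebra_simps)
    then show "x + y \<in> add_ideal I a" unfolding add_ideal_def using S_ideal.subspace_add[OF I x(2) y(2)] by blast
  qed
  fix x t assume "x \<in> add_ideal I a"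
  then obtain p q where x: "x = p + q * a" "p \<in> I" by (auto simp: add_ideal_def)
  have "hcomp t x = hcomp t p + (if e \<le> t then hcomp (t - e) q else 0) * a"
    by (simp add: x hcomp_add hcomp_mult[OF assms(2)])
  then show "hcomp t x \<in> add_ideal I a" unfolding add_ideal_def using hidealD(2)[OF assms(1) x(2)] by blast
qed

lemma subset_add_ideal: "I \<subseteq> add_ideal I a"
proof
  fix p assume "p \<in> I"
  moreover have "p = p + 0 * a" by simp
  ultimately show "p \<in> add_ideal I a" unfolding add_ideal_def by blast
qed

lemma mem_add_ideal: "S_ideal.subspace I \<Longrightarrow> a \<in> add_ideal I a"
proof -
  assume "S_ideal.subspace I"
  then have "0 \<in> I" by (rule S_ideal.subspace_0)
  moreover have "a = 0 + 1 * a" by simp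
  ultimately show ?thesis unfolding add_ideal_def by blast
qed

lemma hideal_colon:
  assumes "hideal I" "homogeneous e a"
  shows "hideal (colon I a)"
  unfolding hideal_def
proof (intro conjI ballI allI)
  note I = hidealD(1)[OF assms(1)]
  show "S_ideal.subspace (colon I a)"
    by (rule S_ideal.subspaceI)
       (auto simp: colon_def distrib_right mult.assoc S_ideal.subspace_0[OF I]
          intro: S_ideal.subspace_add[OF I] ideal_mult[OF I])
  fix x t assume "x \<in> colon I a"
  then have "hcomp (t + e) (x * a) \<in> I" using hidealD(2)[OF assms(1)] by (simp add: colon_def)
  then show "hcomp t x \<in> colon I a" by (simp add: colon_def hcomp_mult[OF assms(2)])
qed

lemma subset_colon: "S_ideal.subspace I \<Longrightarrow> I \<subseteq> colon I a"
  unfolding colon_def using ideal_mult[of I _ a] by (auto simp: mult.commute)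

text \<open>Multiplication by \<open>a\<close> gives the exact sequence 0 \<rightarrow> S/(I:a)(-e)
  \<rightarrow> S/I \<rightarrow> S/(I+(a)) \<rightarrow> 0. In degree \<open>t + e\<close> it is
  read off from the sum and the intersection of the pieces of \<open>I\<close> and of
  \<open>(a)\<close>. Nearly all inductions on ideals below rest on this identity.\<close>

lemma hilbert_function_exact:
  fixes I :: "('n::{finite,linorder}) cpoly set"
  assumes I: "hideal I" and a: "homogeneous e a" "a \<noteq> 0"
  shows "hilbert_function I (t + e) = hilbert_function (add_ideal I a) (t + e) + hilbert_function (colon I a) t"
proof -
  have lin: "Vector_Spaces.linear (\<lambda>c (p :: 'n cpoly). Const c * p) (\<lambda>c p. Const c * p) (\<lambda>q. q * a)"
    by unfold_locales (simp_all add: algebra_simps)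
  note sub = hidealD(1)[OF I] hidealD(1)[OF hideal_add_ideal[OF I a(1)]] hidealD(1)[OF hideal_colon[OF I a(1)]]
  let ?U = "Hom (t + e) \<inter> I" and ?W = "(\<lambda>q. q * a) ` Hom t"
  have "CP.dim ?W = CP.dim (Hom t :: 'n cpoly set)"
    by (rule CPP.dim_image_inj[OF lin]) (use a in auto)
  moreover have "CP.dim ((\<lambda>q. q * a) ` (Hom t \<inter> colon I a)) = CP.dim (Hom t \<inter> colon I a)"
    by (rule CPP.dim_image_inj[OF lin]) (use a in \<open>auto intro: CP.subspace_inter ideal_imp_subspace[OF sub(3)]\<close>)
  moreover have "(\<lambda>q. q * a) ` (Hom t \<inter> colon I a) = ?U \<inter> ?W"
    using homogeneous_mult[OF _ a(1), of t] by (auto simp: colon_def)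
  moreover have "{u + w | u w. u \<in> ?U \<and> w \<in> ?W} = Hom (t + e) \<inter> add_ideal I a"
  proof (intro subset_antisym subsetI)
    fix x assume "x \<in> {u + w | u w. u \<in> ?U \<and> w \<in> ?W}"
    then obtain u q where x: "x = u + q * a" "u \<in> ?U" "q \<in> Hom t" by blast
    then have "homogeneous (t + e) x" using homogeneous_mult[OF _ a(1), of t q] by (auto intro: homogeneous_add)
    then show "x \<in> Hom (t + e) \<inter> add_ideal I a" using x unfolding add_ideal_def by blast
  next
    fix x assume x: "x \<in> Hom (t + e) \<inter> add_ideal I a"
    then obtain p q where pq: "x = p + q * a" "p \<in> I" by (auto simp: add_ideal_def)
    have "x = hcomp (t + e) x" using x hcomp_homogeneous[of "t + e" x "t + e"] by simp
    also have "\<dots> = hcomp (t + e) p + hcomp t q * a" by (simp add: pq hcomp_add hcomp_mult[OF a(1)])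
    finally show "x \<in> {u + w | u w. u \<in> ?U \<and> w \<in> ?W}"
      using hidealD(2)[OF I pq(2)] homogeneous_hcomp by blast
  qed
  moreover have "CP.subspace ?U" by (intro CP.subspace_inter ideal_imp_subspace[OF sub(1)] subspace_Hom)
  moreover have "CP.subspace ?W" by (intro CPP.linear_subspace_image[OF lin] subspace_Hom)
  moreover have "CP.findim ?W" by (rule CPP.rank_nullity(1)[OF lin]) simp_all
  ultimately have "CP.dim (Hom (t + e) \<inter> add_ideal I a) + CP.dim (Hom t \<inter> colon I a) =
      CP.dim ?U + CP.dim (Hom t :: 'n cpoly set)"
    using CP.dim_sum_Int(1)[of ?U ?W] by simp
  then show ?thesis
    using hilbert_function_eq[OF sub(1), of "t + e"] hilbert_function_eq[OF sub(2), of "t + e"]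
      hilbert_function_eq[OF sub(3), of t] by linarith
qed

section \<open>The ascending chain condition and Hilbert polynomials\<close>

lemma nat_seq_mono_subseq: "\<exists>r. strict_mono (r :: nat \<Rightarrow> nat) \<and> mono (\<lambda>i. (f :: nat \<Rightarrow> nat) (r i))"
proof -
  obtain r where r: "strict_mono (r :: nat \<Rightarrow> nat)" "monoseq (\<lambda>n. f (r n))"
    using seq_monosub[of f] by blast
  show ?thesis
  proof (cases "incseq (\<lambda>n. f (r n))")
    case True
    then show ?thesis using r(1) by blast
  next
    case False
    with r(2) have dec: "decseq (\<lambda>n. f (r n))" by (auto simp: monoseq_iff)
    obtain N where N: "\<And>n. f (r N) \<le> f (r n)"
      using ex_has_least_nat[of "\<lambda>_. True" 0 "\<lambda>n. f (r n)"] by blast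
    have "f (r (n + N)) = f (r N)" for n using N[of "n + N"] decseqD[OF dec, of N "n + N"] by simp
    then have "mono (\<lambda>n. f (r (n + N)))" by (simp add: mono_def)
    moreover have "strict_mono (\<lambda>n. r (n + N))" using r(1) by (simp add: strict_mono_def)
    ultimately show ?thesis by (intro exI[of _ "\<lambda>n. r (n + N)"]) simp
  qed
qed

lemma dickson_subseq:
  assumes "finite A"
  shows "\<exists>r. strict_mono (r :: nat \<Rightarrow> nat) \<and> (\<forall>k\<in>A. mono (\<lambda>i. (f :: nat \<Rightarrow> 'a \<Rightarrow> nat) (r i) k))"
  using assms
proof induction
  case empty
  show ?case by (intro exI[of _ id]) (simp add: strict_mono_def)
next
  case (insert a A)
  then obtain r where r: "strict_mono (r :: nat \<Rightarrow> nat)" "\<forall>k\<in>A. mono (\<lambda>i. f (r i) k)" by blast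
  obtain s where s: "strict_mono (s :: nat \<Rightarrow> nat)" "mono (\<lambda>i. f (r (s i)) a)"
    using nat_seq_mono_subseq[of "\<lambda>i. f (r i) a"] by blast
  have "mono (\<lambda>i. f (r (s i)) k)" if "k \<in> A" for k
  proof -
    have "mono (\<lambda>i. f (r i) k)" using r(2) that by blast
    then show ?thesis using strict_mono_mono[OF s(1)] by (auto simp: mono_def)
  qed
  then show ?case using s strict_mono_compose[OF r(1) s(1)]
    by (intro exI[of _ "\<lambda>i. r (s i)"]) (auto simp: strict_mono_def r(1)[unfolded strict_mono_def])
qed

text \<open>The linear order of the type of exponent vectors serves as monomial order: addition is
  monotone for it, and minima are taken only among the finitely many monomials of one
  degree.\<close>

definition lead_mon :: "('n::{finite,linorder}) cpoly \<Rightarrow> ('n \<Rightarrow>\<^sub>0 nat)" where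
  "lead_mon p = Max (Poly_Mapping.keys p)"

lemma lead_mon_in_keys: "p \<noteq> 0 \<Longrightarrow> lead_mon p \<in> Poly_Mapping.keys p"
  unfolding lead_mon_def by (rule Max_in) auto

lemma keys_monomial_mult: "Poly_Mapping.keys (monomial a * (p :: 'n cpoly)) = (+) a ` Poly_Mapping.keys p"
proof
  show "Poly_Mapping.keys (monomial a * p) \<subseteq> (+) a ` Poly_Mapping.keys p"
    using keys_mult[of "monomial a" p] by auto
  show "(+) a ` Poly_Mapping.keys p \<subseteq> Poly_Mapping.keys (monomial a * p)"
    by (auto simp: in_keys_iff coef_single_mult)
qed

lemma lead_mon_monomial_mult:
  assumes "(p :: ('n::{finite,linorder}) cpoly) \<noteq> 0"
  shows "lead_mon (monomial a * p) = a + lead_mon p"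
  unfolding lead_mon_def keys_monomial_mult
  by (rule mono_Max_commute[symmetric]) (use assms in \<open>auto simp: mono_def add_left_mono\<close>)

text \<open>Among the homogeneous elements of \<open>J - I\<close> of one fixed degree take
  \<open>h\<close> with least leading monomial. A homogeneous \<open>g\<close> in \<open>I\<close>
  with the same leading monomial could be subtracted from \<open>h\<close> to make it
  smaller.\<close>

lemma hideal_step_lead_mon:
  fixes I J :: "('n::{finite,linorder}) cpoly set"
  assumes "hideal I" "hideal J" "I \<subset> J"
  shows "\<exists>h\<in>J. h \<noteq> 0 \<and> (\<forall>g\<in>I. g \<noteq> 0 \<longrightarrow> (\<exists>e. homogeneous e g) \<longrightarrow> lead_mon g \<noteq> lead_mon h) \<and> (\<exists>e. homogeneous e h)"
proof -
  note sub = hidealD(1)[OF assms(1)] hidealD(1)[OF assms(2)]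
  obtain p where p: "p \<in> J" "p \<notin> I" using assms(3) by blast
  then obtain e where "hcomp e p \<notin> I" using hideal_hcompI[OF sub(1)] by blast
  define X where "X = {h \<in> J - I. homogeneous e h}"
  have Xne: "hcomp e p \<in> X" using p \<open>hcomp e p \<notin> I\<close> hidealD(2)[OF assms(2)] by (simp add: X_def)
  have nz: "h \<noteq> 0" if "h \<in> X" for h using that S_ideal.subspace_0[OF sub(1)] by (auto simp: X_def)
  have "lead_mon ` X \<subseteq> {m. mon_degree m = e}"
    using nz lead_mon_in_keys by (fastforce simp: X_def homogeneous_def)
  then have "finite (lead_mon ` X)" using finite_mon_degree finite_subset by blast
  then have "Min (lead_mon ` X) \<in> lead_mon ` X" using Xne by (intro Min_in) auto
  then obtain h where h: "h \<in> X" "lead_mon h = Min (lead_mon ` X)" by force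
  have h0: "h \<noteq> 0" using nz h by blast
  have "lead_mon g \<noteq> lead_mon h" if g: "g \<in> I" "g \<noteq> 0" "homogeneous e' g" for g e'
  proof
    assume eq: "lead_mon g = lead_mon h"
    have "mon_degree (lead_mon g) = e'" "mon_degree (lead_mon h) = e"
      using lead_mon_in_keys[OF g(2)] g(3) lead_mon_in_keys[OF h0] h(1) by (auto simp: homogeneous_def X_def)
    with eq g(3) have ge: "homogeneous e g" by simp
    define c where "c = coef h (lead_mon h) / coef g (lead_mon h)"
    define k where "k = h - Const c * g"
    have gI: "Const c * g \<in> I" using g(1) ideal_mult[OF sub(1)] by blast
    have "k \<in> J" unfolding k_def using h(1) gI assms(3) by (intro S_ideal.subspace_diff[OF sub(2)]) (auto simp: X_def)
    moreover have "k \<notin> I"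
    proof
      assume "k \<in> I"
      then have "k + Const c * g \<in> I" using gI S_ideal.subspace_add[OF sub(1)] by blast
      then show False using h(1) by (simp add: k_def X_def)
    qed
    moreover have "homogeneous e k" unfolding k_def using h(1) ge
      by (intro homogeneous_diff homogeneous_Const_mult) (auto simp: X_def)
    ultimately have kX: "k \<in> X" by (simp add: X_def)
    have "coef g (lead_mon h) \<noteq> 0" using lead_mon_in_keys[OF g(2)] eq by (simp add: in_keys_iff)
    then have c0: "coef k (lead_mon h) = 0" by (simp add: k_def lookup_minus c_def)
    have "Poly_Mapping.keys k \<subseteq> Poly_Mapping.keys h \<union> Poly_Mapping.keys g"
      by (auto simp: k_def in_keys_iff lookup_minus)
    then have "\<forall>m\<in>Poly_Mapping.keys k. m \<le> lead_mon h"
      using eq Max_ge[OF finite_keys, of _ h] Max_ge[OF finite_keys, of _ g] unfolding lead_mon_def by fastforce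
    then have "lead_mon k \<le> lead_mon h" using lead_mon_in_keys[OF nz[OF kX]] by blast
    moreover have "lead_mon k \<noteq> lead_mon h" using lead_mon_in_keys[OF nz[OF kX]] c0 by (auto simp: in_keys_iff)
    moreover have "lead_mon h \<le> lead_mon k" unfolding h(2) using kX \<open>finite (lead_mon ` X)\<close> by simp
    ultimately show False by simp
  qed
  then show ?thesis using h h0 by (intro bexI[of _ h]) (auto simp: X_def)
qed

text \<open>Each step of the chain contributes an \<open>h i\<close> whose leading monomial does not
  occur in \<open>I i\<close>. By Dickson's lemma the leading monomial of some \<open>h i\<close>
  divides that of a later \<open>h j\<close>; then a monomial multiple of \<open>h i\<close> lies in
  \<open>I j\<close> and has the leading monomial of \<open>h j\<close>.\<close>

lemma hideal_acc:
  fixes I :: "nat \<Rightarrow> ('n::{finite,linorder}) cpoly set"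
  assumes "\<And>i. hideal (I i)" "\<And>i. I i \<subset> I (Suc i)"
  shows False
proof -
  have "I i \<subseteq> I (Suc i)" for i by (rule psubset_imp_subset[OF assms(2)])
  then have mono: "I i \<subseteq> I j" if "i \<le> j" for i j
    using that by (rule lift_Suc_mono_le)
  have "\<forall>i. \<exists>h. h \<in> I (Suc i) \<and> h \<noteq> 0 \<and> (\<exists>e. homogeneous e h) \<and>
      (\<forall>g\<in>I i. g \<noteq> 0 \<longrightarrow> (\<exists>e. homogeneous e g) \<longrightarrow> lead_mon g \<noteq> lead_mon h)"
    using hideal_step_lead_mon[OF assms(1) assms(1) assms(2)] by blast
  then obtain h where h: "\<And>i. h i \<in> I (Suc i)" "\<And>i. h i \<noteq> 0" "\<And>i. \<exists>e. homogeneous e (h i)"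
      "\<And>i g. g \<in> I i \<Longrightarrow> g \<noteq> 0 \<Longrightarrow> \<exists>e. homogeneous e g \<Longrightarrow> lead_mon g \<noteq> lead_mon (h i)"
    by metis
  obtain r where r: "strict_mono (r :: nat \<Rightarrow> nat)"
      "\<And>k. mono (\<lambda>i. Poly_Mapping.lookup (lead_mon (h (r i))) k)"
    using dickson_subseq[of UNIV "\<lambda>i. Poly_Mapping.lookup (lead_mon (h i))"] by auto
  define i j where "i = r 0" and "j = r 1"
  have ij: "Suc i \<le> j" using strict_monoD[OF r(1), of 0 1] by (simp add: i_def j_def)
  define d where "d = lead_mon (h j) - lead_mon (h i)"
  have d: "d + lead_mon (h i) = lead_mon (h j)"
    using r(2)[THEN monoD, of 0 1]
    by (auto simp: d_def poly_mapping_eq_iff fun_eq_iff lookup_add lookup_minus i_def j_def)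
  have "monomial d * h i \<in> I j"
    using mono[OF ij] h(1)[of i] ideal_mult[OF hidealD(1)[OF assms(1)]] by blast
  moreover have "monomial d * h i \<noteq> 0" using h(2)[of i] keys_monomial_mult[of d "h i"] by auto
  moreover have "\<exists>e. homogeneous e (monomial d * h i)" using h(3)[of i] homogeneous_mult homogeneous_single by blast
  ultimately have "lead_mon (monomial d * h i) \<noteq> lead_mon (h j)" by (rule h(4))
  then show False using d by (simp add: lead_mon_monomial_mult h(2))
qed

lemma hideal_induct [consumes 1, case_names step]:
  fixes I :: "('n::{finite,linorder}) cpoly set"
  assumes "hideal I" and step: "\<And>I. hideal I \<Longrightarrow> (\<And>J. hideal J \<Longrightarrow> I \<subset> J \<Longrightarrow> P J) \<Longrightarrow> P I"
  shows "P I"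
proof -
  have "wf {(J, I :: 'n cpoly set). hideal I \<and> hideal J \<and> I \<subset> J}"
    unfolding wf_iff_no_infinite_down_chain
  proof (rule notI, elim exE)
    fix f :: "nat \<Rightarrow> 'n cpoly set"
    assume f: "\<forall>i. (f (Suc i), f i) \<in> {(J, I). hideal I \<and> hideal J \<and> I \<subset> J}"
    show False by (rule hideal_acc[of f]) (use f in simp_all)
  qed
  then have "hideal I \<longrightarrow> P I"
  proof (induction I rule: wf_induct_rule)
    case (less I)
    show ?case
    proof
      assume I: "hideal I"
      show "P I" by (rule step[OF I]) (use less I in auto)
    qed
  qed
  then show ?thesis using assms(1) by simp
qed

lemma all_Var_imp_Hom_subset:
  assumes "S_ideal.subspace I" "range Var \<subseteq> I" "0 < t"
  shows "Hom t \<subseteq> I"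
proof
  fix p :: "'a cpoly" assume p: "p \<in> Hom t"
  have "Poly_Mapping.single m (coef p m) \<in> I" if "m \<in> Poly_Mapping.keys p" for m
  proof -
    have "mon_degree m = t" using p that by (simp add: homogeneous_def)
    then obtain i where i: "Poly_Mapping.lookup m i \<noteq> 0" using assms(3) by (metis mon_degree_def sum.neutral less_not_refl)
    have "m = (m - Poly_Mapping.single i 1) + Poly_Mapping.single i 1"
      using i by (auto simp: poly_mapping_eq_iff fun_eq_iff lookup_add lookup_minus lookup_single when_def)
    then have "Poly_Mapping.single m (coef p m) =
        Poly_Mapping.single (m - Poly_Mapping.single i 1) (coef p m) * Var i"
      by (simp add: Var_def mult_single)
    then show ?thesis using ideal_mult[OF assms(1) subsetD[OF assms(2) rangeI[of Var i]]] by simp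
  qed
  then show "p \<in> I" using S_ideal.subspace_sum[OF assms(1)] sum_single_coef[of p] by metis
qed

section \<open>Discrete integration and eventual polynomiality\<close>

lemma coeff_shift_power:
  "coeff ([:c, 1:] ^ n) j = of_nat (n choose j) * (c :: 'a::comm_semiring_1) ^ (n - j)"
proof (cases "j \<le> n")
  case False
  have "degree ([:c, 1:] ^ n) \<le> n" using degree_power_le[of "[:c, 1:]" n] by simp
  then show ?thesis using False by (simp add: coeff_eq_0 binomial_eq_0)
qed (simp add: coeff_linear_poly_power)

lemma pcompose_shift_coeff:
  fixes P :: "'a::comm_semiring_1 poly"
  shows "coeff (pcompose P [:c, 1:]) j = (\<Sum>i\<le>degree P. coeff P i * (of_nat (i choose j) * c ^ (i - j)))"
proof -
  have "pcompose P [:c, 1:] = (\<Sum>i\<le>degree P. smult (coeff P i) ([:c, 1:] ^ i))"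
    by (simp add: pcompose_altdef poly_altdef coeff_map_poly degree_map_poly)
  then show ?thesis by (simp add: coeff_sum coeff_shift_power)
qed

lemma difference_poly_exists: "\<exists>Q :: real poly. \<forall>x. poly Q (x + 1) - poly Q x = poly q x"
proof (induction "degree q" arbitrary: q rule: less_induct)
  case less
  show ?case
  proof (cases "degree q = 0")
    case True
    then obtain a where "q = [:a:]" by (meson degree_eq_zeroE)
    then show ?thesis by (intro exI[of _ "[:0, a:]"]) (simp add: algebra_simps)
  next
    case False
    define k where "k = degree q"
    \<comment> \<open>With this factor the leading term of \<open>Q0(x + 1) - Q0(x)\<close>, which
      is (k + 1) a x^k, equals that of \<open>q\<close>, so the remainder \<open>q'\<close> has
      smaller degree.\<close>
    define a where "a = coeff q k / (real k + 1)"
    define Q0 where "Q0 = monom a (Suc k)"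
    define q' where "q' = q - (pcompose Q0 [:1, 1:] - Q0)"
    have cQ: "coeff (pcompose Q0 [:1, 1:]) j = a * real (Suc k choose j)" for j
    proof (cases "a = 0")
      case False
      then have "degree Q0 = Suc k" by (simp add: Q0_def degree_monom_eq)
      then show ?thesis unfolding pcompose_shift_coeff by (simp add: Q0_def sum.delta if_distrib if_distribR cong: if_cong)
    qed (simp add: Q0_def)
    have "coeff q' j = 0" if "j \<ge> k" for j
    proof -
      have "coeff q' j = coeff q j - (a * real (Suc k choose j) - (if j = Suc k then a else 0))"
        by (simp add: q'_def cQ) (simp add: Q0_def)
      moreover have "a * (real k + 1) = coeff q k" by (simp add: a_def)
      moreover have "j = k \<or> j = Suc k \<or> j > Suc k" using that by linarith
      ultimately show ?thesis
        by (auto simp: coeff_eq_0 binomial_eq_0 k_def algebra_simps)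
    qed
    then have "degree q' < k" using False by (metis k_def degree_0 leading_coeff_0_iff not_gr0 not_le)
    then obtain Q where Q: "\<And>x. poly Q (x + 1) - poly Q x = poly q' x" using less.hyps k_def by blast
    have "poly (Q + Q0) (x + 1) - poly (Q + Q0) x = poly q x" for x
      using Q[of x] by (simp add: q'_def poly_pcompose algebra_simps)
    then show ?thesis by blast
  qed
qed

text \<open>Noetherian induction along the exact sequence for a variable outside \<open>I\<close>.
  If the colon ideal is strictly larger, both outer terms are covered by the induction hypothesis.
  If it equals \<open>I\<close>, the sequence gives the first difference of the Hilbert function as
  an eventual polynomial, which is summed by \<open>difference_poly_exists\<close>.\<close>

lemma hilbert_function_eventually_poly:
  fixes I :: "('n::{finite,linorder}) cpoly set"
  assumes "hideal I"
  shows "\<exists>h T. \<forall>t\<ge>T. poly h (real t) = real (hilbert_function I t)"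
  using assms
proof (induction I rule: hideal_induct)
  case (step I)
  note sub = hidealD(1)[OF step(1)]
  show ?case
  proof (cases "range Var \<subseteq> I")
    case True
    then show ?thesis using hilbert_function_eq_0[OF sub all_Var_imp_Hom_subset[OF sub True]]
      by (intro exI[of _ 0] exI[of _ 1]) auto
  next
    case False
    then obtain i where i: "Var i \<notin> I" by blast
    then have i0: "(Var i :: 'n cpoly) \<noteq> 0" using S_ideal.subspace_0[OF sub] by metis
    define J where "J = add_ideal I (Var i)"
    have "hideal J" unfolding J_def by (rule hideal_add_ideal[OF step(1) homogeneous_Var])
    moreover have "I \<subset> J" using subset_add_ideal[of I "Var i"] mem_add_ideal[OF sub, of "Var i"] i unfolding J_def by blast
    ultimately obtain h T where h: "\<And>t. t \<ge> T \<Longrightarrow> poly h (real t) = real (hilbert_function J t)" using step(2) by blast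
    have exact: "hilbert_function I (t + 1) = hilbert_function J (t + 1) + hilbert_function (colon I (Var i)) t" for t
      unfolding J_def by (rule hilbert_function_exact[OF step(1) homogeneous_Var i0])
    show ?thesis
    proof (cases "colon I (Var i) = I")
      case True
      obtain Q where Q: "\<And>x. poly Q (x + 1) - poly Q x = poly (pcompose h [:1, 1:]) x"
        using difference_poly_exists by blast
      define c where "c = real (hilbert_function I T) - poly Q (real T)"
      have "poly (Q + [:c:]) (real t) = real (hilbert_function I t)" if "t \<ge> T" for t
        using that
      proof (induction t rule: dec_induct)
        case base
        show ?case by (simp add: c_def)
      next
        case (step t)
        have "real (hilbert_function I (Suc t)) = poly h (real (Suc t)) + real (hilbert_function I t)"
          using exact[of t] True h[of "Suc t"] step by simp
        also have "poly h (real (Suc t)) = poly Q (real t + 1) - poly Q (real t)"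
          using Q[of "real t"] by (simp add: poly_pcompose add.commute)
        finally show ?case using step by (simp add: add.commute)
      qed
      then show ?thesis by blast
    next
      case False
      have "hideal (colon I (Var i))" by (rule hideal_colon[OF step(1) homogeneous_Var])
      moreover have "I \<subset> colon I (Var i)" using subset_colon[OF sub, of "Var i"] False by blast
      ultimately obtain h' T' where h': "\<And>t. t \<ge> T' \<Longrightarrow> poly h' (real t) = real (hilbert_function (colon I (Var i)) t)"
        using step(2) by blast
      have "poly (h + pcompose h' [:-1, 1:]) (real t) = real (hilbert_function I t)" if "t \<ge> max T T' + 1" for t
        using exact[of "t - 1"] h[of t] h'[of "t - 1"] that by (simp add: poly_pcompose of_nat_diff algebra_simps)
      then show ?thesis by blast
    qed
  qed
qed

lemma poly_eqI_eventually:
  fixes p q :: "real poly"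
  assumes "\<And>t. t \<ge> T \<Longrightarrow> poly p (real t) = poly q (real t)"
  shows "p = q"
proof (rule ccontr)
  assume "p \<noteq> q"
  then have "finite {x. poly (p - q) x = 0}" by (intro poly_roots_finite) simp
  moreover have "real ` {T..} \<subseteq> {x. poly (p - q) x = 0}" using assms by auto
  ultimately have "finite (real ` {T..})" by (rule finite_subset[rotated])
  then have "finite {T..}" by (rule finite_imageD) (simp add: inj_on_def)
  then show False using infinite_Ici by blast
qed

lemma hilbert_polynomial_eqI:
  assumes "\<And>t. t \<ge> T \<Longrightarrow> poly h (real t) = real (hilbert_function I t)"
  shows "hilbert_polynomial I = h"
  unfolding hilbert_polynomial_def
proof (rule the_equality)
  show "\<forall>\<^sub>F t in sequentially. poly h (real t) = real (hilbert_function I t)"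
    unfolding eventually_sequentially using assms by blast
  fix h' assume "\<forall>\<^sub>F t in sequentially. poly h' (real t) = real (hilbert_function I t)"
  then obtain T' where "\<And>t. t \<ge> T' \<Longrightarrow> poly h' (real t) = real (hilbert_function I t)"
    unfolding eventually_sequentially by blast
  then show "h' = h" using assms by (intro poly_eqI_eventually[of "max T T'"]) simp
qed

section \<open>Growth of Hilbert functions and chains of homogeneous primes\<close>

text \<open>\<open>growth_le k I\<close> says that the Hilbert function of \<open>S/I\<close> is \<open>O(t^(k-1))\<close>, where
  \<open>O(t^(-1))\<close> means eventually zero; so \<open>k\<close> bounds the Krull dimension of \<open>S/I\<close>.\<close>

fun growth_le :: "nat \<Rightarrow> ('n::finite) cpoly set \<Rightarrow> bool" where
  "growth_le 0 I \<longleftrightarrow> (\<exists>T. \<forall>t\<ge>T. hilbert_function I t = 0)"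
| "growth_le (Suc k) I \<longleftrightarrow> (\<exists>C. \<forall>t. hilbert_function I t \<le> C * (t + 1) ^ k)"

lemma growth_le_mono:
  assumes "growth_le k I" "\<And>t. hilbert_function J t \<le> hilbert_function I t"
  shows "growth_le k J"
  using assms by (cases k) (auto, metis le_zero_eq, meson order_trans)

lemma growth_le_subset:
  assumes "growth_le k I" "S_ideal.subspace I" "S_ideal.subspace J" "I \<subseteq> J"
  shows "growth_le k J"
  by (rule growth_le_mono[OF assms(1)], rule hilbert_function_mono) (use assms in auto)

lemma growth_le_Var:
  assumes "S_ideal.subspace I" "range Var \<subseteq> I"
  shows "growth_le k I"
proof -
  have z: "hilbert_function I t = 0" if "t > 0" for t
    using hilbert_function_eq_0[OF assms(1) all_Var_imp_Hom_subset[OF assms that]] .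
  show ?thesis
  proof (cases k)
    case 0
    then show ?thesis using z by (auto intro!: exI[of _ 1])
  next
    case (Suc j)
    have "hilbert_function I t \<le> hilbert_function I 0 * (t + 1) ^ j" for t
      using z[of t] by (cases t) auto
    then show ?thesis using Suc by auto
  qed
qed

lemma growth_le_exact:
  fixes I :: "('n::{finite,linorder}) cpoly set"
  assumes I: "hideal I" "homogeneous e a" "a \<noteq> 0"
    and J: "growth_le k (add_ideal I a)" and K: "growth_le k (colon I a)"
  shows "growth_le k I"
proof (cases k)
  case 0
  with J K obtain T T' where T: "\<And>t. t \<ge> T \<Longrightarrow> hilbert_function (add_ideal I a) t = 0"
    "\<And>t. t \<ge> T' \<Longrightarrow> hilbert_function (colon I a) t = 0" by auto
  have "hilbert_function I t = 0" if "t \<ge> T + T' + e" for t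
    using hilbert_function_exact[OF I, of "t - e"] T(1)[of t] T(2)[of "t - e"] that by simp
  with 0 show ?thesis by auto
next
  case (Suc j)
  with J K obtain C C' where C: "\<And>t. hilbert_function (add_ideal I a) t \<le> C * (t + 1) ^ j"
    "\<And>t. hilbert_function (colon I a) t \<le> C' * (t + 1) ^ j" by auto
  \<comment> \<open>Bounds the degrees below \<open>e\<close>, which the exact sequence does not
    reach.\<close>
  define D where "D = (\<Sum>t<e. hilbert_function I t)"
  have "hilbert_function I t \<le> (C + C' + D) * (t + 1) ^ j" for t
  proof (cases "t < e")
    case True
    then have "hilbert_function I t \<le> D" unfolding D_def by (intro member_le_sum) auto
    also have "D \<le> D * (t + 1) ^ j" by simp
    also have "\<dots> \<le> (C + C' + D) * (t + 1) ^ j" by (intro mult_right_mono) auto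
    finally show ?thesis .
  next
    case False
    then have "hilbert_function I t = hilbert_function (add_ideal I a) t + hilbert_function (colon I a) (t - e)"
      using hilbert_function_exact[OF I, of "t - e"] by simp
    also have "\<dots> \<le> C * (t + 1) ^ j + C' * (t - e + 1) ^ j" using C by (intro add_mono)
    also have "C' * (t - e + 1) ^ j \<le> C' * (t + 1) ^ j" by (intro mult_left_mono power_mono) auto
    finally show ?thesis by (simp add: algebra_simps)
  qed
  with Suc show ?thesis by auto
qed

section \<open>Homogeneous primes of prescribed growth\<close>

lemma hcomp_mult_sum:
  "hcomp n (a * b) = (\<Sum>t\<in>mon_degree ` Poly_Mapping.keys b. if t \<le> n then hcomp (n - t) a * hcomp t b else 0)"
proof -
  have "hcomp n (a * b) = hcomp n (\<Sum>t\<in>mon_degree ` Poly_Mapping.keys b. a * hcomp t b)"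
    by (subst sum_hcomp[of b]) (simp add: sum_distrib_left)
  then show ?thesis by (simp add: hcomp_sum hcomp_mult[OF homogeneous_hcomp])
qed

text \<open>If \<open>a\<close> and \<open>b\<close> are outside \<open>I\<close>, take their
  highest components outside \<open>I\<close>, in degrees \<open>s\<close> and \<open>t\<close>.
  Modulo \<open>I\<close> the component of \<open>a * b\<close> in degree \<open>s + t\<close> is
  the product of these two.\<close>

lemma hideal_primeI:
  fixes I :: "('n::{finite,linorder}) cpoly set"
  assumes I: "hideal I" "I \<noteq> UNIV"
    and hom: "\<And>a b d e. homogeneous d a \<Longrightarrow> homogeneous e b \<Longrightarrow> a * b \<in> I \<Longrightarrow> a \<in> I \<or> b \<in> I"
  shows "prime_ideal I"
proof -
  note sub = hidealD(1)[OF I(1)]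
  have "False" if ab: "a * b \<in> I" and n: "a \<notin> I" "b \<notin> I" for a b
  proof -
    have top: "\<exists>s. hcomp s p \<notin> I \<and> (\<forall>t>s. hcomp t p \<in> I)" if "p \<notin> I" for p
    proof -
      let ?X = "{s. hcomp s p \<notin> I}"
      have "?X \<subseteq> mon_degree ` Poly_Mapping.keys p"
      proof
        fix s assume "s \<in> ?X"
        then have "hcomp s p \<noteq> 0" using S_ideal.subspace_0[OF sub] by auto
        then obtain m where "coef (hcomp s p) m \<noteq> 0" by (metis poly_mapping_eqI lookup_zero)
        then show "s \<in> mon_degree ` Poly_Mapping.keys p"
          by (auto simp: coef_hcomp in_keys_iff split: if_splits)
      qed
      then have fin: "finite ?X" by (rule finite_subset) simp
      have ne: "?X \<noteq> {}" using hideal_hcompI[OF sub] that by blast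
      show ?thesis using Max_in[OF fin ne] Max_ge[OF fin] by (intro exI[of _ "Max ?X"]) (auto simp: not_le[symmetric])
    qed
    from top[OF n(1)] obtain s where s: "hcomp s a \<notin> I" "\<And>t. t > s \<Longrightarrow> hcomp t a \<in> I" by blast
    from top[OF n(2)] obtain t where t: "hcomp t b \<notin> I" "\<And>u. u > t \<Longrightarrow> hcomp u b \<in> I" by blast
    let ?T = "mon_degree ` Poly_Mapping.keys b"
    let ?F = "\<lambda>u. if u \<le> s + t then hcomp (s + t - u) a * hcomp u b else 0"
    have rest: "?F u \<in> I" if "u \<noteq> t" for u
    proof (cases "u > t")
      case True
      then show ?thesis using t(2)[OF True] ideal_mult[OF sub] S_ideal.subspace_0[OF sub] by auto
    next
      case False
      then have "hcomp (s + t - u) a \<in> I" using that by (intro s(2)) auto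
      then show ?thesis using ideal_mult[OF sub, of "hcomp (s + t - u) a" "hcomp u b"] S_ideal.subspace_0[OF sub]
        by (simp add: mult.commute)
    qed
    have "t \<in> ?T"
    proof (rule ccontr)
      assume "t \<notin> ?T"
      then have "hcomp t b = 0" by (intro poly_mapping_eqI) (auto simp: coef_hcomp in_keys_iff image_iff)
      then show False using t(1) S_ideal.subspace_0[OF sub] by simp
    qed
    then have eq: "hcomp (s + t) (a * b) = hcomp s a * hcomp t b + sum ?F (?T - {t})"
      unfolding hcomp_mult_sum by (subst sum.remove[of _ t]) auto
    have "sum ?F (?T - {t}) \<in> I" by (rule S_ideal.subspace_sum[OF sub]) (use rest in blast)
    from S_ideal.subspace_diff[OF sub hidealD(2)[OF I(1) ab, of "s + t"] this]
    have "hcomp s a * hcomp t b \<in> I" unfolding eq by (simp only: add_diff_cancel_right')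
    then show False using hom[OF homogeneous_hcomp homogeneous_hcomp] s(1) t(1) by blast
  qed
  then show ?thesis using sub I(2) unfolding prime_ideal_def by blast
qed

lemma prime_idealD:
  assumes "prime_ideal P"
  shows "S_ideal.subspace P" "P \<noteq> UNIV" "a * b \<in> P \<Longrightarrow> a \<in> P \<or> b \<in> P" "1 \<notin> P"
proof -
  show sub: "S_ideal.subspace P" and ne: "P \<noteq> UNIV" and "a * b \<in> P \<Longrightarrow> a \<in> P \<or> b \<in> P"
    using assms unfolding prime_ideal_def by blast+
  show "1 \<notin> P"
  proof
    assume "1 \<in> P"
    then have "x * 1 \<in> P" for x using ideal_mult[OF sub] by blast
    then show False using ne by auto
  qed
qed

lemma growth_le_UNIV: "growth_le k UNIV"
  by (rule growth_le_Var) (auto simp: S_ideal.subspace_def)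

text \<open>If \<open>I\<close> is not prime, there are homogeneous \<open>a\<close>,
  \<open>b\<close> outside \<open>I\<close> with product in \<open>I\<close>. Then
  \<open>add_ideal I a\<close> and \<open>colon I a\<close> are both strictly larger, the latter
  because it contains \<open>b\<close>, and by the exact sequence one of them keeps the
  growth.\<close>

lemma prime_of_growth_exists:
  fixes I :: "('n::{finite,linorder}) cpoly set"
  assumes "hideal I" "\<not> growth_le k I"
  shows "\<exists>P. hideal P \<and> prime_ideal P \<and> I \<subseteq> P \<and> \<not> growth_le k P"
  using assms
proof (induction I rule: hideal_induct)
  case (step I)
  note sub = hidealD(1)[OF step(1)]
  show ?case
  proof (cases "prime_ideal I")
    case False
    have "I \<noteq> UNIV" using step(3) growth_le_UNIV by auto
    with False hideal_primeI[OF step(1)] obtain a b d e where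
      ab: "homogeneous d a" "homogeneous e b" "a * b \<in> I" "a \<notin> I" "b \<notin> I" by metis
    have "a \<noteq> 0" using ab(4) S_ideal.subspace_0[OF sub] by metis
    then have "\<not> growth_le k (add_ideal I a) \<or> \<not> growth_le k (colon I a)"
      using growth_le_exact[OF step(1) ab(1)] step(3) by blast
    moreover have "I \<subset> add_ideal I a" using subset_add_ideal[of I a] mem_add_ideal[OF sub] ab(4) by blast
    moreover have "b \<in> colon I a" using ab(3) by (simp add: colon_def mult.commute)
    then have "I \<subset> colon I a" using subset_colon[OF sub] ab(5) by blast
    moreover note hideal_add_ideal[OF step(1) ab(1)] hideal_colon[OF step(1) ab(1)]
    ultimately show ?thesis using step(2) by (meson psubset_imp_subset subset_trans)
  qed (use step in blast)
qed

lemma colon_prime: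
  assumes "prime_ideal P" "a \<notin> P"
  shows "colon P a = P"
  using prime_idealD(3)[OF assms(1)] assms(2) subset_colon[OF prime_idealD(1)[OF assms(1)], of a]
  by (auto simp: colon_def)

text \<open>Since the colon of a prime by a variable outside it is the prime itself, the Hilbert
  function of \<open>add_ideal P (Var i)\<close> is the first difference of that of
  \<open>P\<close>; summation raises the exponent by one.\<close>

lemma growth_le_add_Var:
  fixes P :: "('n::{finite,linorder}) cpoly set"
  assumes "hideal P" "prime_ideal P" "Var i \<notin> P" "growth_le k (add_ideal P (Var i))"
  shows "growth_le (Suc k) P"
proof -
  have "(Var i :: 'n cpoly) \<noteq> 0" using assms(3) S_ideal.subspace_0[OF hidealD(1)[OF assms(1)]] by metis
  from hilbert_function_exact[OF assms(1) homogeneous_Var this] colon_prime[OF assms(2,3)]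
  have rec: "hilbert_function P (t + 1) = hilbert_function (add_ideal P (Var i)) (t + 1) + hilbert_function P t" for t
    by simp
  show ?thesis
  proof (cases k)
    case 0
    with assms(4) obtain T where T: "\<And>t. t \<ge> T \<Longrightarrow> hilbert_function (add_ideal P (Var i)) t = 0" by auto
    define C where "C = (\<Sum>s\<le>T. hilbert_function P s)"
    have "hilbert_function P t \<le> C" for t
    proof (induction t)
      case 0
      show ?case unfolding C_def by (rule member_le_sum) auto
    next
      case (Suc t)
      show ?case
      proof (cases "Suc t \<le> T")
        case True
        then show ?thesis unfolding C_def by (intro member_le_sum) auto
      next
        case False
        then show ?thesis using rec[of t] T[of "Suc t"] Suc by simp
      qed
    qed
    then show ?thesis using 0 by auto
  next
    case (Suc j)
    with assms(4) obtain C where C: "\<And>t. hilbert_function (add_ideal P (Var i)) t \<le> C * (t + 1) ^ j" by auto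
    define D where "D = C + hilbert_function P 0"
    have "hilbert_function P t \<le> D * (t + 1) ^ Suc j" for t
    proof (induction t)
      case 0
      show ?case by (simp add: D_def)
    next
      case (Suc t)
      have "hilbert_function P (Suc t) \<le> C * (Suc t + 1) ^ j + D * (t + 1) ^ Suc j"
        using rec[of t] C[of "Suc t"] Suc by simp
      also have "\<dots> \<le> D * (Suc t + 1) ^ j + D * ((t + 1) * (Suc t + 1) ^ j)"
      proof (intro add_mono)
        show "C * (Suc t + 1) ^ j \<le> D * (Suc t + 1) ^ j" by (intro mult_right_mono) (auto simp: D_def)
        have "(t + 1) * (t + 1) ^ j \<le> (t + 1) * (Suc t + 1) ^ j" by (intro mult_left_mono power_mono) auto
        then show "D * (t + 1) ^ Suc j \<le> D * ((t + 1) * (Suc t + 1) ^ j)" by (simp only: power_Suc) (rule mult_left_mono, simp_all)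
      qed
      also have "\<dots> = D * (Suc t + 1) ^ Suc j" by (simp add: algebra_simps)
      finally show ?case .
    qed
    with Suc show ?thesis by auto
  qed
qed

lemma proj_pointsI:
  "hideal P \<Longrightarrow> prime_ideal P \<Longrightarrow> I \<subseteq> P \<Longrightarrow> \<not> range Var \<subseteq> P \<Longrightarrow> P \<in> proj_points I"
  by (simp add: proj_points_def homogeneous_ideal_iff)

lemma proj_pointsD:
  assumes "P \<in> proj_points I"
  shows "hideal P" "prime_ideal P" "I \<subseteq> P" "\<not> range Var \<subseteq> P" "S_ideal.subspace P"
  using assms by (auto simp: proj_points_def homogeneous_ideal_iff hideal_def)

text \<open>The lower bound for the dimension: cutting with a variable outside \<open>P\<close>
  loses at most one step of growth, and a prime above the cut retains what is left.\<close>

lemma chain_of_growth_exists: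
  fixes P :: "('n::{finite,linorder}) cpoly set"
  assumes "hideal P" "prime_ideal P" "I \<subseteq> P" "\<not> growth_le k P"
  shows "\<exists>Q :: nat \<Rightarrow> 'n cpoly set. Q 0 = P \<and> (\<forall>i\<le>k. Q i \<in> proj_points I) \<and> (\<forall>i<k. Q i \<subset> Q (Suc i))"
  using assms
proof (induction k arbitrary: P)
  case 0
  then have "\<not> range Var \<subseteq> P" using growth_le_Var[OF hidealD(1)] by blast
  then show ?case using 0 by (intro exI[of _ "\<lambda>_. P"]) (simp add: proj_pointsI)
next
  case (Suc k)
  have nV: "\<not> range Var \<subseteq> P" using Suc.prems(1,4) growth_le_Var[OF hidealD(1)] by blast
  then obtain i where i: "Var i \<notin> P" by blast
  let ?J = "add_ideal P (Var i)"
  have "\<not> growth_le k ?J" using growth_le_add_Var[OF Suc.prems(1,2) i] Suc.prems(4) by blast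
  moreover have "hideal ?J" by (rule hideal_add_ideal[OF Suc.prems(1) homogeneous_Var])
  ultimately obtain Q where Q: "hideal Q" "prime_ideal Q" "?J \<subseteq> Q" "\<not> growth_le k Q"
    using prime_of_growth_exists by blast
  have PQ: "P \<subset> Q" using Q(3) subset_add_ideal[of P "Var i"] mem_add_ideal[OF hidealD(1)[OF Suc.prems(1)], of "Var i"] i by blast
  then have "I \<subseteq> Q" using Suc.prems(3) by blast
  from Suc.IH[OF Q(1,2) this Q(4)] obtain R where
    R: "R 0 = Q" "\<And>i. i \<le> k \<Longrightarrow> R i \<in> proj_points I" "\<And>i. i < k \<Longrightarrow> R i \<subset> R (Suc i)" by blast
  define R' where "R' = case_nat P R"
  have "R' i \<in> proj_points I" if "i \<le> Suc k" for i
    using that R(2) proj_pointsI[OF Suc.prems(1,2,3) nV] by (cases i) (auto simp: R'_def)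
  moreover have "R' i \<subset> R' (Suc i)" if "i < Suc k" for i
    using that R(1,3) PQ by (cases i) (auto simp: R'_def)
  ultimately show ?case by (intro exI[of _ R']) (simp add: R'_def)
qed

section \<open>Loss of growth along strict inclusions of primes\<close>

lemma hilbert_function_prime_mono:
  fixes P :: "('n::{finite,linorder}) cpoly set"
  assumes "hideal P" "prime_ideal P" "\<not> range Var \<subseteq> P" "s \<le> t"
  shows "hilbert_function P s \<le> hilbert_function P t"
proof -
  obtain i where i: "Var i \<notin> P" using assms(3) by blast
  then have "(Var i :: 'n cpoly) \<noteq> 0" using S_ideal.subspace_0[OF hidealD(1)[OF assms(1)]] by metis
  from hilbert_function_exact[OF assms(1) homogeneous_Var this] colon_prime[OF assms(2) i]
  have "hilbert_function P t \<le> hilbert_function P (Suc t)" for t by simp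
  then show ?thesis using assms(4) by (rule lift_Suc_mono_le)
qed

lemma hilbert_function_prime_pos:
  fixes P :: "('n::{finite,linorder}) cpoly set"
  assumes "hideal P" "prime_ideal P"
  shows "0 < hilbert_function P 0"
proof -
  have "homogeneous 0 (1 :: 'n cpoly)" using homogeneous_Const[of 1] by simp
  then show ?thesis using hilbert_function_pos[OF prime_idealD(1)[OF assms(2)]] prime_idealD(4)[OF assms(2)] by blast
qed

text \<open>For homogeneous \<open>a\<close> of degree \<open>e\<close> in \<open>Q - P\<close> the
  exact sequence gives H_P(t + e) \<ge> H_P(t) + H_Q(t + e), writing H for the Hilbert functions.
  Iterate \<open>j\<close> times; H_Q is nondecreasing.\<close>

lemma hilbert_function_prime_subset:
  fixes P Q :: "('n::{finite,linorder}) cpoly set"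
  assumes P: "hideal P" "prime_ideal P" and Q: "hideal Q" "prime_ideal Q" "\<not> range Var \<subseteq> Q" and PQ: "P \<subset> Q"
  shows "\<exists>e. \<forall>t j. (j + 1) * hilbert_function Q t \<le> hilbert_function P (t + j * e)"
proof -
  note sub = hidealD(1)[OF P(1)] hidealD(1)[OF Q(1)]
  obtain p where "p \<in> Q" "p \<notin> P" using PQ by blast
  then obtain e where e: "hcomp e p \<notin> P" using hideal_hcompI[OF sub(1)] by blast
  define a where "a = hcomp e p"
  have a: "a \<in> Q" "a \<notin> P" "homogeneous e a" "a \<noteq> 0"
    using hidealD(2)[OF Q(1) \<open>p \<in> Q\<close>] e S_ideal.subspace_0[OF sub(1)] by (auto simp: a_def)
  have "add_ideal P a \<subseteq> Q"
    using PQ a(1) S_ideal.subspace_add[OF sub(2)] ideal_mult[OF sub(2)] by (auto simp: add_ideal_def)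
  then have "hilbert_function Q t \<le> hilbert_function (add_ideal P a) t" for t
    by (intro hilbert_function_mono hidealD(1) hideal_add_ideal[OF P(1) a(3)] Q) blast
  then have rec: "hilbert_function Q (t + e) + hilbert_function P t \<le> hilbert_function P (t + e)" for t
    using hilbert_function_exact[OF P(1) a(3,4), of t] colon_prime[OF P(2) a(2)] by simp
  have "(j + 1) * hilbert_function Q t \<le> hilbert_function P (t + j * e)" for t j
  proof (induction j)
    case 0
    show ?case using hilbert_function_mono[OF sub] PQ by auto
  next
    case (Suc j)
    have "hilbert_function Q t \<le> hilbert_function Q (t + j * e + e)"
      by (rule hilbert_function_prime_mono[OF Q]) simp
    then show ?case using Suc rec[of "t + j * e"] by (simp add: algebra_simps)
  qed
  then show ?thesis by blast
qed

text \<open>With \<open>j = t\<close> the preceding bound reads (t + 1) H_Q(t) \<le> H_P(t + t e),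
  so \<open>Q\<close> loses a full power of t. This is the upper bound for lengths of
  chains.\<close>

lemma growth_le_prime_subset:
  fixes P Q :: "('n::{finite,linorder}) cpoly set"
  assumes "hideal P" "prime_ideal P" "hideal Q" "prime_ideal Q" "\<not> range Var \<subseteq> Q" "P \<subset> Q"
    and "growth_le (Suc k) P"
  shows "0 < k \<and> growth_le k Q"
proof -
  obtain e where e: "\<And>t j. (j + 1) * hilbert_function Q t \<le> hilbert_function P (t + j * e)"
    using hilbert_function_prime_subset[OF assms(1-6)] by blast
  obtain C where C: "\<And>t. hilbert_function P t \<le> C * (t + 1) ^ k" using assms(7) by auto
  have bound: "(t + 1) * hilbert_function Q t \<le> C * (e + 1) ^ k * (t + 1) ^ k" for t
  proof -
    have "(t + 1) * hilbert_function Q t \<le> C * (t + t * e + 1) ^ k" using e[of t t] C[of "t + t * e"] by linarith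
    also have "\<dots> \<le> C * ((e + 1) * (t + 1)) ^ k" by (intro mult_left_mono power_mono) auto
    finally show ?thesis by (simp only: power_mult_distrib mult.assoc)
  qed
  show ?thesis
  proof (cases k)
    case 0
    \<comment> \<open>For \<open>k = 0\<close> the bound says (t + 1) H_Q(t) \<le> C for all t,
      which fails at t = C because H_Q is positive.\<close>
    have "0 < hilbert_function Q 0" by (rule hilbert_function_prime_pos[OF assms(3,4)])
    also have "hilbert_function Q 0 \<le> hilbert_function Q C" by (rule hilbert_function_prime_mono[OF assms(3-5)]) simp
    finally have "(C + 1) * 1 \<le> (C + 1) * hilbert_function Q C" by (intro mult_left_mono) simp_all
    then show ?thesis using bound[of C] 0 by simp
  next
    case (Suc j)
    have "hilbert_function Q t \<le> C * (e + 1) ^ k * (t + 1) ^ j" for t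
    proof -
      have "(t + 1) * hilbert_function Q t \<le> (t + 1) * (C * (e + 1) ^ k * (t + 1) ^ j)"
        using bound[of t] Suc by (simp only: power_Suc ac_simps)
      then show ?thesis by (simp only: mult_le_cancel1)
    qed
    then show ?thesis unfolding Suc by auto
  qed
qed

lemma chain_length_le_growth:
  fixes P :: "nat \<Rightarrow> ('n::{finite,linorder}) cpoly set"
  assumes "\<And>i. i \<le> s \<Longrightarrow> P i \<in> proj_points I" "\<And>i. i < s \<Longrightarrow> P i \<subset> P (Suc i)" "growth_le (Suc k) (P 0)"
  shows "s \<le> k"
  using assms
proof (induction s arbitrary: P k)
  case (Suc s)
  have 0: "P 0 \<in> proj_points I" and 1: "P 1 \<in> proj_points I" using Suc.prems(1)[of 0] Suc.prems(1)[of 1] by auto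
  have "P 0 \<subset> P 1" using Suc.prems(2)[of 0] by simp
  then have g: "0 < k" "growth_le k (P 1)"
    using growth_le_prime_subset[OF proj_pointsD(1,2)[OF 0] proj_pointsD(1,2,4)[OF 1] _ Suc.prems(3)] by auto
  then obtain j where j: "k = Suc j" by (cases k) auto
  have "s \<le> j"
    by (rule Suc.IH[of "\<lambda>i. P (Suc i)"]) (use Suc.prems(1,2) g j in auto)
  then show ?case using j by simp
qed simp

lemma proj_dimension_eqI:
  fixes I :: "('n::{finite,linorder}) cpoly set"
  assumes "hideal I" "growth_le (Suc k) I" "\<not> growth_le k I"
  shows "proj_dimension I = int k"
  unfolding proj_dimension_def
proof (rule cSup_eq_maximum)
  obtain P where "hideal P" "prime_ideal P" "I \<subseteq> P" "\<not> growth_le k P"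
    using prime_of_growth_exists[OF assms(1,3)] by blast
  from chain_of_growth_exists[OF this] show "int k \<in> insert (- 1) {int s |s. \<exists>P. (\<forall>i\<le>s. P i \<in> proj_points I) \<and> (\<forall>i<s. P i \<subset> P (Suc i))}"
    by blast
next
  fix x assume "x \<in> insert (- 1) {int s |s. \<exists>P. (\<forall>i\<le>s. P i \<in> proj_points I) \<and> (\<forall>i<s. P i \<subset> P (Suc i))}"
  then consider "x = -1" | s P where "x = int s" "\<forall>i\<le>s. P i \<in> proj_points I" "\<forall>i<s. P i \<subset> P (Suc i)" by blast
  then show "x \<le> int k"
  proof cases
    case 2
    then have P0: "P 0 \<in> proj_points I" by blast
    have "growth_le (Suc k) (P 0)"
      by (rule growth_le_subset[OF assms(2) hidealD(1)[OF assms(1)] proj_pointsD(5,3)[OF P0]])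
    with 2 show ?thesis using chain_length_le_growth[of s P I k] by simp
  qed simp
qed

section \<open>Partial derivatives and the codimension of the singular locus\<close>

lemma coef_partial_deriv:
  "coef (partial_deriv j p) m = of_nat (Poly_Mapping.lookup m j + 1) * coef p (m + Poly_Mapping.single j 1)"
proof -
  have iff: "m' - Poly_Mapping.single j 1 = m \<longleftrightarrow> m' = m + Poly_Mapping.single j 1"
    if "Poly_Mapping.lookup m' j \<noteq> 0" for m'
    using that by (auto simp: poly_mapping_eq_iff fun_eq_iff lookup_add lookup_minus lookup_single when_def
        split: if_splits)
  have "coef (partial_deriv j p) m = (\<Sum>m'\<in>Poly_Mapping.keys p.
      if m' = m + Poly_Mapping.single j 1 then of_nat (Poly_Mapping.lookup m' j) * coef p m' else 0)"
    unfolding partial_deriv_def lookup_sum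
    by (rule sum.cong) (use iff in \<open>auto simp: lookup_single when_def lookup_add\<close>)
  also have "\<dots> = of_nat (Poly_Mapping.lookup m j + 1) * coef p (m + Poly_Mapping.single j 1)"
    by (simp add: sum.delta in_keys_iff lookup_add)
  finally show ?thesis .
qed

lemma partial_deriv_add: "partial_deriv j (p + q) = partial_deriv j p + partial_deriv j q"
  by (rule poly_mapping_eqI) (simp add: coef_partial_deriv lookup_add distrib_left)

lemma partial_deriv_single: "partial_deriv j (Poly_Mapping.single m c) =
    Poly_Mapping.single (m - Poly_Mapping.single j 1) (of_nat (Poly_Mapping.lookup m j) * c)"
  by (simp add: partial_deriv_def)

lemma partial_deriv_mult:
  "partial_deriv j (p * q) = partial_deriv j p * q + p * partial_deriv j q"
proof (induction p rule: cpoly_induct)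
  case (single m c)
  show ?case
  proof (induction q rule: cpoly_induct)
    case (single m' c')
    have 1: "m - Poly_Mapping.single j 1 + m' = m + m' - Poly_Mapping.single j 1" if "Poly_Mapping.lookup m j \<noteq> 0"
      using that by (auto simp: poly_mapping_eq_iff fun_eq_iff lookup_add lookup_minus lookup_single when_def)
    have 2: "m + (m' - Poly_Mapping.single j 1) = m + m' - Poly_Mapping.single j 1" if "Poly_Mapping.lookup m' j \<noteq> 0"
      using that by (auto simp: poly_mapping_eq_iff fun_eq_iff lookup_add lookup_minus lookup_single when_def)
    show ?case
      using 1 2 by (cases "Poly_Mapping.lookup m j = 0"; cases "Poly_Mapping.lookup m' j = 0")
        (simp_all add: mult_single partial_deriv_single lookup_add algebra_simps flip: single_add)
  qed (simp add: distrib_left partial_deriv_add)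
qed (simp add: distrib_right partial_deriv_add)

lemma homogeneous_partial_deriv: "homogeneous e p \<Longrightarrow> homogeneous (e - 1) (partial_deriv j p)"
  unfolding homogeneous_iff coef_partial_deriv by (metis diff_add_inverse2 mon_degree_add mon_degree_single mult_zero_right)

lemma euler_formula:
  assumes "homogeneous e (p :: ('n::finite) cpoly)"
  shows "(\<Sum>j\<in>UNIV. Var j * partial_deriv j p) = of_nat e * p"
proof -
  have single: "(\<Sum>j\<in>UNIV. Var j * partial_deriv j (Poly_Mapping.single m c)) =
      of_nat (mon_degree m) * Poly_Mapping.single m c" for m :: "'n \<Rightarrow>\<^sub>0 nat" and c
  proof -
    have "Var j * partial_deriv j (Poly_Mapping.single m c) =
        Poly_Mapping.single m (of_nat (Poly_Mapping.lookup m j) * c)" for j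
    proof (cases "Poly_Mapping.lookup m j = 0")
      case False
      then have "Poly_Mapping.single j 1 + (m - Poly_Mapping.single j 1) = m"
        by (auto simp: poly_mapping_eq_iff fun_eq_iff lookup_add lookup_minus lookup_single when_def)
      then show ?thesis by (simp add: partial_deriv_single Var_def mult_single)
    qed (simp add: partial_deriv_single)
    then have "(\<Sum>j\<in>UNIV. Var j * partial_deriv j (Poly_Mapping.single m c)) =
        (\<Sum>j\<in>UNIV. Poly_Mapping.single m (of_nat (Poly_Mapping.lookup m j) * c))" by simp
    also have "\<dots> = Poly_Mapping.single m (of_nat (mon_degree m) * c)"
      by (intro poly_mapping_eqI) (simp add: lookup_sum lookup_single when_def mon_degree_def sum_distrib_right)
    also have "\<dots> = of_nat (mon_degree m) * Poly_Mapping.single m c"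
      by (simp add: mult_single flip: single_of_nat)
    finally show ?thesis .
  qed
  have add: "(\<Sum>j\<in>UNIV. Var j * partial_deriv j (\<Sum>m\<in>A. Poly_Mapping.single m (coef p m))) =
      of_nat e * (\<Sum>m\<in>A. Poly_Mapping.single m (coef p m))" if "A \<subseteq> Poly_Mapping.keys p" for A
  proof -
    have "finite A" by (rule finite_subset[OF that finite_keys])
    then show ?thesis using that
    proof induction
      case empty
      show ?case by (simp add: partial_deriv_def)
    next
      case (insert m A)
      then have "mon_degree m = e" using assms by (simp add: homogeneous_def)
      with insert show ?case by (simp add: partial_deriv_add distrib_left sum.distrib single)
    qed
  qed
  show ?thesis using add[of "Poly_Mapping.keys p"] by (simp add: sum_single_coef)
qed

lemma xcoef_partial_deriv: "xcoef j k (partial_deriv j p) = of_nat (k + 1) * xcoef j (k + 1) p"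
proof (rule poly_mapping_eqI)
  fix m
  have "m + Poly_Mapping.single j k + Poly_Mapping.single j 1 = m + Poly_Mapping.single j (k + 1)"
    by (simp add: add.assoc flip: single_add)
  then have "coef (xcoef j k (partial_deriv j p)) m = of_nat (k + 1) * coef (xcoef j (k + 1) p) m"
    by (simp add: coef_xcoef coef_partial_deriv lookup_add)
  also have "\<dots> = coef (of_nat (k + 1) * xcoef j (k + 1) p) m"
    using coef_single_mult[of 0 "of_nat (k + 1)" "xcoef j (k + 1) p" m] by (simp del: of_nat_add of_nat_Suc)
  finally show "coef (xcoef j k (partial_deriv j p)) m = coef (of_nat (k + 1) * xcoef j (k + 1) p) m" .
qed

text \<open>In characteristic 0 a positive degree in \<open>Var j\<close> drops by exactly one under
  the derivative, which is then a nonzero polynomial of degree too small to be a multiple of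
  \<open>g\<close>.\<close>

lemma dvd_partial_deriv_imp_const:
  fixes g :: "('n::{finite,linorder}) cpoly"
  assumes "g dvd partial_deriv j g" "g \<noteq> 0"
  shows "deg_in j g = 0"
proof (rule ccontr)
  assume "deg_in j g \<noteq> 0"
  then obtain k where k: "deg_in j g = k + 1" by (metis Suc_eq_plus1 not0_implies_Suc)
  have "xcoef j (k + 1) g \<noteq> 0"
    using assms(2) unfolding coeff_xpoly[symmetric] k[symmetric] by simp
  then have "of_nat (k + 1) * xcoef j (k + 1) g \<noteq> 0" by (simp del: of_nat_add of_nat_Suc)
  then have "xcoef j k (partial_deriv j g) \<noteq> 0" by (simp only: xcoef_partial_deriv) simp
  then have nz: "partial_deriv j g \<noteq> 0" using coeff_xpoly[of j 0 k] by auto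
  have "xcoef j (deg_in j (partial_deriv j g)) (partial_deriv j g) \<noteq> 0"
    using nz unfolding coeff_xpoly[symmetric] by simp
  then have "xcoef j (deg_in j (partial_deriv j g) + 1) g \<noteq> 0" unfolding xcoef_partial_deriv by auto
  then have "deg_in j (partial_deriv j g) + 1 \<le> deg_in j g" using xcoef_eq_0 by (metis not_le)
  moreover obtain q where q: "partial_deriv j g = g * q" using assms(1) by (auto simp: dvd_def)
  then have "deg_in j g \<le> deg_in j (partial_deriv j g)" using nz by (simp add: deg_in_mult)
  ultimately show False by simp
qed

text \<open>Write \<open>f = g * k\<close> with \<open>k\<close> not divisible by \<open>g\<close>.
  By the product rule \<open>g\<close> would divide all its own partial derivatives and hence be
  constant.\<close>

lemma prime_not_dvd_all_partials:
  fixes f :: "('n::{finite,linorder}) cpoly"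
  assumes "squarefree f" "prime_elem g" "g dvd f"
  shows "\<exists>j. \<not> g dvd partial_deriv j f"
proof (rule ccontr)
  assume "\<nexists>j. \<not> g dvd partial_deriv j f"
  then have all: "\<And>j. g dvd partial_deriv j f" by blast
  obtain k where k: "f = g * k" using assms(3) by (auto simp: dvd_def)
  have ngk: "\<not> g dvd k"
  proof
    assume "g dvd k"
    then have "g ^ 2 dvd f" unfolding k by (simp add: power2_eq_square mult_dvd_mono)
    then show False using assms(1,2) by (auto simp: squarefree_def prime_elem_def)
  qed
  have "g dvd partial_deriv j g" for j
  proof -
    have "g dvd partial_deriv j g * k + g * partial_deriv j k" using all[of j] by (simp add: k partial_deriv_mult)
    then have "g dvd partial_deriv j g * k" by (metis dvd_add_left_iff dvd_triv_left)
    then show ?thesis using assms(2) ngk by (simp add: prime_elem_dvd_mult_iff)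
  qed
  moreover have "g \<noteq> 0" using assms(2) by auto
  ultimately have "g \<in> Svars {}" using dvd_partial_deriv_imp_const by (auto simp: Svars_def)
  then have "g dvd 1" using \<open>g \<noteq> 0\<close> unit_iff_Svars_empty by blast
  then show False using assms(2) by (simp add: prime_elem_def)
qed

text \<open>Each prime factor of \<open>f\<close> misses some partial derivative, so it divides
  \<open>h\<close>. This will yield the divisibility by \<open>f\<close> of the determinant that
  defines \<open>v\<close>.\<close>

lemma dvd_of_dvd_mult_partials:
  fixes f :: "('n::{finite,linorder}) cpoly"
  assumes "squarefree f" "\<And>j. f dvd h * partial_deriv j f"
  shows "f dvd h"
proof (rule squarefree_dvd_of_primes[OF assms(1)])
  fix g assume g: "prime_elem g" "g dvd f"
  obtain j where j: "\<not> g dvd partial_deriv j f" using prime_not_dvd_all_partials[OF assms(1) g] by blast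
  have "g dvd h * partial_deriv j f" using g(2) assms(2)[of j] dvd_trans by blast
  then show "g dvd h" using g(1) j by (simp add: prime_elem_dvd_mult_iff)
qed

lemma ideal_span_range:
  "S_ideal.span (range (g :: 'm::finite \<Rightarrow> 'n cpoly)) = range (\<lambda>a. \<Sum>j\<in>UNIV. a j * g j)"
    (is "_ = range ?F")
proof (rule S_ideal.span_unique)
  have F_in: "x \<in> range ?F" if "x = ?F a" for x a using that by blast
  show "range g \<subseteq> range ?F"
  proof
    fix x assume "x \<in> range g"
    then obtain k where "x = g k" by blast
    also have "\<dots> = (\<Sum>j\<in>UNIV. if j = k then g j else 0)" by (simp add: sum.delta)
    also have "\<dots> = ?F (\<lambda>j. if j = k then 1 else 0)" by (rule sum.cong) auto
    finally show "x \<in> range ?F" by (rule F_in)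
  qed
  show "S_ideal.subspace (range ?F)"
  proof (rule S_ideal.subspaceI)
    have "0 = ?F (\<lambda>_. 0)" by simp
    then show "0 \<in> range ?F" by (rule F_in)
    fix x y c assume "x \<in> range ?F"
    then obtain a where x: "x = ?F a" by blast
    then have "c * x = ?F (\<lambda>j. c * a j)" by (simp add: sum_distrib_left mult.assoc)
    then show "c * x \<in> range ?F" by (rule F_in)
    assume "y \<in> range ?F"
    then obtain b where "y = ?F b" by blast
    then have "x + y = ?F (\<lambda>j. a j + b j)" by (simp add: x sum.distrib distrib_right)
    then show "x + y \<in> range ?F" by (rule F_in)
  qed
  fix T assume T: "range g \<subseteq> T" "S_ideal.subspace T"
  have "?F a \<in> T" for a
    using T(1) by (intro S_ideal.subspace_sum[OF T(2)] S_ideal.subspace_scale[OF T(2)]) blast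
  then show "range ?F \<subseteq> T" by blast
qed

lemma jacobian_ideal_eq: "jacobian_ideal f = range (\<lambda>a. \<Sum>j\<in>UNIV. a j * partial_deriv j f)"
  unfolding jacobian_ideal_def by (rule ideal_span_range)

lemma hideal_jacobian: "homogeneous d f \<Longrightarrow> hideal (jacobian_ideal f)"
  unfolding jacobian_ideal_def by (rule hideal_span) (auto intro: homogeneous_partial_deriv)

lemma partial_in_jacobian: "partial_deriv j f \<in> jacobian_ideal f"
  unfolding jacobian_ideal_def by (rule S_ideal.span_base) blast

lemma mem_jacobian_ideal:
  assumes "homogeneous d (f :: ('n::finite) cpoly)" "d > 0"
  shows "f \<in> jacobian_ideal f"
proof -
  have "Const (1 / of_nat d) * (\<Sum>j\<in>UNIV. Var j * partial_deriv j f) \<in> jacobian_ideal f"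
    unfolding jacobian_ideal_def
    by (intro S_ideal.span_scale S_ideal.span_sum S_ideal.span_base) blast
  also have "Const (1 / of_nat d) * (\<Sum>j\<in>UNIV. Var j * partial_deriv j f) = Const (1 / of_nat d) * Const (of_nat d) * f"
    by (simp add: euler_formula[OF assms(1)] Const_def mult.assoc)
  also have "Const (1 / of_nat d) * Const (of_nat d) = 1" using assms(2) by (simp flip: Const_mult)
  finally show ?thesis by simp
qed

section \<open>Counting monomials\<close>

definition mons_in :: "('n::finite) set \<Rightarrow> nat \<Rightarrow> ('n \<Rightarrow>\<^sub>0 nat) set" where
  "mons_in W t = {m. Poly_Mapping.keys m \<subseteq> W \<and> mon_degree m = t}"

lemma finite_mons_in [simp]: "finite (mons_in W t)"
  by (rule finite_subset[OF _ finite_mon_degree[of t]]) (auto simp: mons_in_def)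

lemma card_mons_in_insert:
  assumes "i \<notin> W"
  shows "card (mons_in (insert i W) t) = (\<Sum>k\<le>t. card (mons_in W k))"
proof -
  let ?S = "\<lambda>k. (\<lambda>m. m + Poly_Mapping.single i (t - k)) ` mons_in W k"
  have *: "mons_in (insert i W) t = (\<Union>k\<in>{..t}. ?S k)"
  proof (intro subset_antisym subsetI)
    fix m assume m: "m \<in> mons_in (insert i W) t"
    define m' where "m' = m - Poly_Mapping.single i (Poly_Mapping.lookup m i)"
    have e: "m = m' + Poly_Mapping.single i (Poly_Mapping.lookup m i)"
      by (auto simp: m'_def poly_mapping_eq_iff fun_eq_iff lookup_add lookup_minus lookup_single when_def)
    then have "mon_degree m = mon_degree m' + Poly_Mapping.lookup m i" by (metis mon_degree_add mon_degree_single)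
    then have "mon_degree m' \<le> t" "Poly_Mapping.lookup m i = t - mon_degree m'" using m by (auto simp: mons_in_def)
    moreover have "Poly_Mapping.keys m' \<subseteq> W"
      using m by (auto simp: m'_def mons_in_def subset_iff in_keys_iff lookup_minus lookup_single when_def split: if_splits)
    ultimately show "m \<in> (\<Union>k\<in>{..t}. ?S k)" using e by (auto simp: mons_in_def)
  next
    fix m assume "m \<in> (\<Union>k\<in>{..t}. ?S k)"
    then obtain k m' where k: "k \<le> t" "m' \<in> mons_in W k" "m = m' + Poly_Mapping.single i (t - k)" by blast
    then have "Poly_Mapping.keys m \<subseteq> insert i W" using keys_add[of m' "Poly_Mapping.single i (t - k)"]
      by (auto simp: mons_in_def split: if_splits)
    then show "m \<in> mons_in (insert i W) t" using k by (simp add: mons_in_def mon_degree_add)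
  qed
  have li: "Poly_Mapping.lookup m i = 0" if "m \<in> mons_in W k" for m k
    using that assms by (auto simp: mons_in_def in_keys_iff)
  have "card (\<Union>k\<in>{..t}. ?S k) = (\<Sum>k\<le>t. card (?S k))"
  proof (rule card_UN_disjoint)
    show "\<forall>k\<in>{..t}. \<forall>l\<in>{..t}. k \<noteq> l \<longrightarrow> ?S k \<inter> ?S l = {}"
    proof (intro ballI impI, rule ccontr)
      fix k l assume kl: "k \<in> {..t}" "l \<in> {..t}" "k \<noteq> l" "?S k \<inter> ?S l \<noteq> {}"
      then obtain a b where ab: "a \<in> mons_in W k" "b \<in> mons_in W l"
        "a + Poly_Mapping.single i (t - k) = b + Poly_Mapping.single i (t - l)" by blast
      then have "Poly_Mapping.lookup (a + Poly_Mapping.single i (t - k)) i = Poly_Mapping.lookup (b + Poly_Mapping.single i (t - l)) i" by simp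
      then have "t - k = t - l" using li[OF ab(1)] li[OF ab(2)] by (simp add: lookup_add)
      then show False using kl by auto
    qed
  qed auto
  also have "\<dots> = (\<Sum>k\<le>t. card (mons_in W k))"
    by (intro sum.cong refl card_image) (simp add: inj_on_def)
  finally show ?thesis using * by simp
qed

lemma card_mons_in:
  assumes "W \<noteq> {}"
  shows "card (mons_in W t) = ((card W - 1) + t) choose t"
  using finite[of W] assms
proof (induction W arbitrary: t rule: finite_ne_induct)
  case (singleton i)
  have "mons_in {i} t = {Poly_Mapping.single i t}"
  proof (intro subset_antisym subsetI)
    fix m assume m: "m \<in> mons_in {i} t"
    have "m = Poly_Mapping.single i (Poly_Mapping.lookup m i)"
      using m by (auto simp: mons_in_def poly_mapping_eq_iff fun_eq_iff in_keys_iff lookup_single when_def)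
    moreover from this have "mon_degree m = Poly_Mapping.lookup m i" by (metis mon_degree_single)
    ultimately show "m \<in> {Poly_Mapping.single i t}" using m by (simp add: mons_in_def)
  qed (auto simp: mons_in_def split: if_splits)
  then show ?case by simp
next
  case (insert i W)
  have "card W > 0" using insert by (simp add: card_gt_0_iff)
  then have W: "card W = Suc (card W - 1)" by simp
  have "card (mons_in (insert i W) t) = (\<Sum>k\<le>t. (card W - 1) + k choose k)"
    by (simp only: card_mons_in_insert[OF insert.hyps(3)] insert.IH)
  also have "\<dots> = (Suc ((card W - 1) + t) choose t)" by (rule sum_choose_lower)
  also have "\<dots> = ((card (insert i W) - 1) + t choose t)" using W insert.hyps by simp
  finally show ?case .
qed

lemma binomial_le_power: "(n + t choose t) \<le> (t + 1) ^ n"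
proof (induction n arbitrary: t)
  case (Suc n)
  have "(Suc n + t choose t) = (\<Sum>k\<le>t. n + k choose k)" by (simp add: sum_choose_lower)
  also have "\<dots> \<le> (\<Sum>k\<le>t. (t + 1) ^ n)"
    by (intro sum_mono order_trans[OF Suc] power_mono) auto
  finally show ?case by simp
qed simp

lemma mons_in_UNIV: "mons_in UNIV t = {m. mon_degree m = t}"
  by (simp add: mons_in_def)

lemma growth_le_zero_ideal: "growth_le CARD('n) ({0} :: ('n::{finite,linorder}) cpoly set)"
proof -
  obtain n where n: "CARD('n) = Suc n" by (metis Suc_pred' zero_less_card_finite)
  have "hilbert_function ({0} :: 'n cpoly set) t \<le> 1 * (t + 1) ^ n" for t
  proof -
    have "hilbert_function ({0} :: 'n cpoly set) t \<le> CP.dim (Hom t :: 'n cpoly set)"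
      using hilbert_function_eq[of "{0} :: 'n cpoly set" t] by (simp add: S_ideal.subspace_def)
    also have "\<dots> = (n + t choose t)"
      unfolding dim_Hom mons_in_UNIV[symmetric] by (simp add: card_mons_in n)
    finally show ?thesis using binomial_le_power[of n t] by simp
  qed
  then show ?thesis unfolding n growth_le.simps by blast
qed

section \<open>The Jacobian ideal has codimension at least two\<close>

lemma finite_hcomp_nonzero:
  assumes "p \<noteq> 0"
  shows "finite {u. hcomp u p \<noteq> 0}" "{u. hcomp u p \<noteq> 0} \<noteq> {}"
    "{u. hcomp u p \<noteq> 0} = mon_degree ` Poly_Mapping.keys p"
proof -
  show *: "{u. hcomp u p \<noteq> 0} = mon_degree ` Poly_Mapping.keys p"
    by (auto simp: poly_mapping_eq_iff fun_eq_iff coef_hcomp in_keys_iff image_iff)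
  show "finite {u. hcomp u p \<noteq> 0}" "{u. hcomp u p \<noteq> 0} \<noteq> {}" unfolding * using assms by auto
qed

text \<open>The last premise says that \<open>(r, s)\<close> is the only pair of occurring degrees
  with its sum; this holds for the two top degrees and for the two bottom degrees.\<close>

lemma hcomp_mult_extremal:
  assumes "y \<noteq> 0" "hcomp s y \<noteq> 0"
    "\<And>u v. hcomp u x \<noteq> 0 \<Longrightarrow> hcomp v y \<noteq> 0 \<Longrightarrow> u + v = r + s \<Longrightarrow> v = s"
  shows "hcomp (r + s) (x * y) = hcomp r x * hcomp s y"
proof -
  let ?Y = "mon_degree ` Poly_Mapping.keys y"
  let ?F = "\<lambda>u. if u \<le> r + s then hcomp (r + s - u) x * hcomp u y else 0"
  have "s \<in> ?Y" using finite_hcomp_nonzero(3)[OF assms(1)] assms(2) by blast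
  then have "hcomp (r + s) (x * y) = ?F s + sum ?F (?Y - {s})"
    unfolding hcomp_mult_sum by (subst sum.remove[of _ s]) auto
  also have "sum ?F (?Y - {s}) = 0"
  proof (rule sum.neutral, rule ballI)
    fix u assume "u \<in> ?Y - {s}"
    then have us: "u \<noteq> s" by blast
    show "?F u = 0"
    proof (cases "u \<le> r + s")
      case True
      then have "hcomp (r + s - u) x = 0 \<or> hcomp u y = 0" using assms(3)[of "r + s - u" u] us by auto
      then show ?thesis by auto
    qed simp
  qed
  finally show ?thesis by simp
qed

lemma homogeneous_factors:
  fixes x y :: "('n::{finite,linorder}) cpoly"
  assumes "homogeneous e (x * y)" "x \<noteq> 0" "y \<noteq> 0"
  shows "\<exists>a b. homogeneous a x \<and> homogeneous b y \<and> a + b = e"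
proof -
  let ?X = "{u. hcomp u x \<noteq> 0}" and ?Y = "{u. hcomp u y \<noteq> 0}"
  note X = finite_hcomp_nonzero(1,2)[OF assms(2)] and Y = finite_hcomp_nonzero(1,2)[OF assms(3)]
  have deg: "r + s = e" if "r \<in> ?X" "s \<in> ?Y"
    "\<And>u v. hcomp u x \<noteq> 0 \<Longrightarrow> hcomp v y \<noteq> 0 \<Longrightarrow> u + v = r + s \<Longrightarrow> v = s" for r s
  proof -
    have "hcomp (r + s) (x * y) \<noteq> 0"
      by (subst hcomp_mult_extremal[OF assms(3) _ that(3)]) (use that in auto)
    then show ?thesis using hcomp_homogeneous[OF assms(1), of "r + s"] by (auto split: if_splits)
  qed
  have M: "Max ?X \<in> ?X" "Max ?Y \<in> ?Y" "\<And>u. hcomp u x \<noteq> 0 \<Longrightarrow> u \<le> Max ?X" "\<And>u. hcomp u y \<noteq> 0 \<Longrightarrow> u \<le> Max ?Y"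
    using Max_in[OF X] Max_in[OF Y] Max_ge[OF X(1)] Max_ge[OF Y(1)] by auto
  have m: "Min ?X \<in> ?X" "Min ?Y \<in> ?Y" "\<And>u. hcomp u x \<noteq> 0 \<Longrightarrow> Min ?X \<le> u" "\<And>u. hcomp u y \<noteq> 0 \<Longrightarrow> Min ?Y \<le> u"
    using Min_in[OF X] Min_in[OF Y] Min_le[OF X(1)] Min_le[OF Y(1)] by auto
  have 1: "Max ?X + Max ?Y = e"
  proof (rule deg[OF M(1,2)])
    fix u v assume "hcomp u x \<noteq> 0" "hcomp v y \<noteq> 0" "u + v = Max ?X + Max ?Y"
    then show "v = Max ?Y" using M(3)[of u] M(4)[of v] by linarith
  qed
  have 2: "Min ?X + Min ?Y = e"
  proof (rule deg[OF m(1,2)])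
    fix u v assume "hcomp u x \<noteq> 0" "hcomp v y \<noteq> 0" "u + v = Min ?X + Min ?Y"
    then show "v = Min ?Y" using m(3)[of u] m(4)[of v] by linarith
  qed
  have "Min ?X \<le> Max ?X" "Min ?Y \<le> Max ?Y" using m(1,2) M(3,4) by blast+
  with 1 2 have eq: "Min ?X = Max ?X" "Min ?Y = Max ?Y" by linarith+
  have "homogeneous (Max ?X) x" "homogeneous (Max ?Y) y"
  proof -
    have "u = Max ?X" if "hcomp u x \<noteq> 0" for u using M(3)[OF that] m(3)[OF that] eq by simp
    then show "homogeneous (Max ?X) x" using finite_hcomp_nonzero(3)[OF assms(2)] unfolding homogeneous_def by blast
    have "u = Max ?Y" if "hcomp u y \<noteq> 0" for u using M(4)[OF that] m(4)[OF that] eq by simp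
    then show "homogeneous (Max ?Y) y" using finite_hcomp_nonzero(3)[OF assms(3)] unfolding homogeneous_def by blast
  qed
  with 1 show ?thesis by blast
qed

text \<open>Otherwise a prime \<open>P\<close> of too large growth contains the Jacobian ideal. A
  nonzero homogeneous \<open>g\<close> in \<open>P\<close> of least degree is irreducible, so the
  ideal \<open>Q\<close> of its multiples is prime. It differs from \<open>P\<close>, because
  \<open>g\<close> cannot divide \<open>f\<close> and all its partial derivatives. Along the chain
  0, \<open>Q\<close>, \<open>P\<close> the growth falls twice, from \<open>n + 1\<close> to
  \<open>n - 1\<close>.\<close>

lemma jacobian_growth:
  fixes f :: "('n::{finite,linorder}) cpoly"
  assumes "hypersurface d f" and n: "CARD('n) = n + 1"
  shows "growth_le (n - 1) (jacobian_ideal f)"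
proof (rule ccontr)
  assume *: "\<not> growth_le (n - 1) (jacobian_ideal f)"
  have f: "homogeneous d f" "squarefree f" "3 \<le> d" using assms(1) by (auto simp: hypersurface_def)
  have f0: "f \<noteq> 0" using f(2) by auto
  obtain P where P: "hideal P" "prime_ideal P" "jacobian_ideal f \<subseteq> P" "\<not> growth_le (n - 1) P"
    using prime_of_growth_exists[OF hideal_jacobian[OF f(1)] *] by blast
  note sub = hidealD(1)[OF P(1)]
  have nV: "\<not> range Var \<subseteq> P" using growth_le_Var[OF sub] P(4) by blast
  have fP: "f \<in> P" using mem_jacobian_ideal[OF f(1)] f(3) P(3) by auto
  define X where "X = (\<lambda>e. \<exists>p\<in>P. p \<noteq> 0 \<and> homogeneous e p)"
  have "X d" unfolding X_def using fP f0 f(1) by blast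
  then have "X (LEAST e. X e)" by (rule LeastI)
  then obtain e g where e: "e = (LEAST e. X e)" and g: "g \<in> P" "g \<noteq> 0" "homogeneous e g" by (auto simp: X_def)
  have min: "e \<le> e'" if "p \<in> P" "p \<noteq> 0" "homogeneous e' p" for e' p
    unfolding e by (rule Least_le) (use that in \<open>auto simp: X_def\<close>)
  have gu: "\<not> g dvd 1"
  proof
    assume "g dvd 1"
    then obtain k where "1 = k * g" by (metis dvdE mult.commute)
    then show False using ideal_mult[OF sub g(1)] prime_idealD(4)[OF P(2)] by metis
  qed
  have "irreducible g"
  proof (rule irreducibleI)
    fix a b assume ab: "g = a * b"
    \<comment> \<open>The factors of \<open>g\<close> are homogeneous, and the one in
      \<open>P\<close> has degree at least \<open>e\<close>; so the other has degree 0.\<close>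
    have unit: "y dvd 1" if xy: "g = x * y" "x \<in> P" for x y
    proof -
      have nz: "x \<noteq> 0" "y \<noteq> 0" using xy g(2) by auto
      obtain a b where ab: "homogeneous a x" "homogeneous b y" "a + b = e"
        using homogeneous_factors[OF _ nz] g(3) xy(1) by metis
      moreover from this have "b = 0" using min[OF xy(2) nz(1) ab(1)] by linarith
      ultimately have "homogeneous 0 y" by simp
      then have "y = Const (coef y 0)" by (rule homogeneous_0_imp_Const)
      then show ?thesis using nz(2) unit_iff_Const by (metis Const_0)
    qed
    have "a \<in> P \<or> b \<in> P" using prime_idealD(3)[OF P(2)] g(1) ab by blast
    then show "a dvd 1 \<or> b dvd 1" using unit[of a b] unit[of b a] ab by (auto simp: mult.commute)
  qed (use g gu in auto)
  then have gp: "prime_elem g" by (rule irreducible_imp_prime_elem)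
  define Q where "Q = {p. g dvd p}"
  have Qsub: "S_ideal.subspace Q" by (rule S_ideal.subspaceI) (auto simp: Q_def)
  have Qh: "hideal Q"
    unfolding hideal_def
  proof (intro conjI ballI allI Qsub)
    fix p t assume "p \<in> Q"
    then obtain k where "p = k * g" by (auto simp: Q_def dvd_def mult.commute)
    then show "hcomp t p \<in> Q" by (simp add: Q_def hcomp_mult[OF g(3)])
  qed
  have Qp: "prime_ideal Q"
    using gp Qsub gu unfolding prime_ideal_def by (auto simp: Q_def prime_elem_dvd_mult_iff)
  have QP: "Q \<subseteq> P" using ideal_mult[OF sub g(1)] by (auto simp: Q_def dvd_def) (metis mult.commute)
  moreover have "Q \<noteq> P"
  proof
    assume "Q = P"
    then have "g dvd f" "\<And>j. g dvd partial_deriv j f"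
      using fP P(3) partial_in_jacobian by (auto simp: Q_def)
    then show False using prime_not_dvd_all_partials[OF f(2) gp] by blast
  qed
  ultimately have QP': "Q \<subset> P" by blast
  define Z where "Z = ({0} :: 'n cpoly set)"
  have Zsub: "S_ideal.subspace Z" by (simp add: Z_def S_ideal.subspace_def)
  then have Z: "hideal Z" by (simp add: hideal_def Z_def)
  have "(1 :: 'n cpoly) \<notin> Z" by (simp add: Z_def)
  then have Zp: "prime_ideal Z" using Zsub unfolding prime_ideal_def
  proof (intro conjI allI impI)
    show "Z \<noteq> UNIV" using \<open>1 \<notin> Z\<close> by blast
    fix a b assume "a * b \<in> Z"
    then show "a \<in> Z \<or> b \<in> Z" by (simp add: Z_def)
  qed
  have "Z \<subseteq> Q" "g \<in> Q" "g \<notin> Z" using g(2) by (simp_all add: Z_def Q_def)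
  then have "Z \<subset> Q" by blast
  moreover have "growth_le (Suc n) Z" using growth_le_zero_ideal[where 'n='n] n by (simp add: Z_def)
  moreover have "\<not> range Var \<subseteq> Q" using nV subset_trans[OF _ QP] by metis
  ultimately have gQ: "0 < n \<and> growth_le n Q"
    by (intro growth_le_prime_subset[OF Z Zp Qh Qp])
  then obtain m where m: "n = Suc m" by (cases n) auto
  have "growth_le m P"
    using growth_le_prime_subset[OF Qh Qp P(1,2) nV QP', of m] gQ unfolding m by simp
  then show False using P(4) m by simp
qed

section \<open>Graded pieces of the syzygy module\<close>

global_interpretation CV: linear_space "\<lambda>c (v :: 'n cpoly ^ 'n::finite). Const c *s v"
  by unfold_locales (simp_all add: vec_eq_iff algebra_simps Const_add Const_mult)

global_interpretation CVP: linear_space_pair "\<lambda>c (v :: 'n cpoly ^ 'n::finite). Const c *s v" "\<lambda>c (p :: 'n cpoly). Const c * p"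
  by unfold_locales

global_interpretation CPV: linear_space_pair "\<lambda>c (p :: 'n cpoly). Const c * p" "\<lambda>c (v :: 'n cpoly ^ 'n::finite). Const c *s v"
  by unfold_locales

lemma dim_zero [simp]: "CP.dim {0} = 0" "CV.dim {0} = 0"
  using CP.dim_le_card[of "{0}" "{}"] CV.dim_le_card[of "{0}" "{}"] by simp_all

definition vhcomp :: "nat \<Rightarrow> ('n::finite) cpoly_vec \<Rightarrow> 'n cpoly_vec" where
  "vhcomp t v = (\<chi> j. hcomp t (v $ j))"

lemma vhcomp_nth [simp]: "vhcomp t v $ j = hcomp t (v $ j)"
  by (simp add: vhcomp_def)

lemma homogeneous_vec_vhcomp [simp]: "homogeneous_vec t (vhcomp t v)"
  by (simp add: homogeneous_vec_def)

lemma vhcomp_homogeneous: "homogeneous_vec e v \<Longrightarrow> vhcomp t v = (if t = e then v else 0)"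
proof -
  assume "homogeneous_vec e v"
  then have "hcomp t (v $ i) = (if t = e then v $ i else 0)" for i
    by (intro hcomp_homogeneous) (simp add: homogeneous_vec_def)
  then show ?thesis by (simp add: vec_eq_iff)
qed

lemma vhcomp_0 [simp]: "vhcomp t 0 = 0"
  by (simp add: vec_eq_iff)

lemma vhcomp_add: "vhcomp t (v + w) = vhcomp t v + vhcomp t w"
  by (simp add: vec_eq_iff hcomp_add)

lemma vhcomp_sum: "vhcomp t (sum f A) = (\<Sum>x\<in>A. vhcomp t (f x))"
  by (induction A rule: infinite_finite_induct) (simp_all add: vhcomp_add)

lemma vhcomp_smult:
  "homogeneous_vec e v \<Longrightarrow> vhcomp t (a *s v) = (if e \<le> t then hcomp (t - e) a *s v else 0)"
proof -
  assume "homogeneous_vec e v"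
  then have "hcomp t (a * v $ i) = (if e \<le> t then hcomp (t - e) a * v $ i else 0)" for i
    by (intro hcomp_mult) (simp add: homogeneous_vec_def)
  then show ?thesis by (simp add: vec_eq_iff)
qed

lemma homogeneous_vec_0 [simp]: "homogeneous_vec e 0"
  by (simp add: homogeneous_vec_def)

lemma homogeneous_vec_add: "homogeneous_vec e v \<Longrightarrow> homogeneous_vec e w \<Longrightarrow> homogeneous_vec e (v + w)"
  by (simp add: homogeneous_vec_def homogeneous_add)

lemma homogeneous_vec_smult: "homogeneous d a \<Longrightarrow> homogeneous_vec e v \<Longrightarrow> homogeneous_vec (d + e) (a *s v)"
  by (simp add: homogeneous_vec_def homogeneous_mult)

abbreviation Homv :: "nat \<Rightarrow> ('n::finite) cpoly_vec set" where
  "Homv t \<equiv> {v. homogeneous_vec t v}"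

lemma subspace_Homv [simp]: "CV.subspace (Homv t)"
proof (rule CV.subspaceI)
  fix c and v :: "('n::finite) cpoly_vec" assume "v \<in> Homv t"
  then show "Const c *s v \<in> Homv t" using homogeneous_vec_smult[OF homogeneous_Const] by fastforce
qed (auto intro: homogeneous_vec_add)

definition mon_count :: "'n::finite itself \<Rightarrow> nat \<Rightarrow> nat" where
  "mon_count _ t = card {m :: 'n \<Rightarrow>\<^sub>0 nat. mon_degree m = t}"

text \<open>The degree \<open>t\<close> part of the submodule generated by the \<rho>_k; the index
  set \<open>K\<close> is arbitrary, so that generators can be added or removed one at a
  time.\<close>

definition graded_combs :: "'k set \<Rightarrow> ('k \<Rightarrow> ('n::finite) cpoly_vec) \<Rightarrow> nat \<Rightarrow> 'n cpoly_vec set" where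
  "graded_combs K \<rho> t = {v. homogeneous_vec t v \<and> (\<exists>a. v = (\<Sum>k\<in>K. a k *s \<rho> k))}"

lemma graded_combsI: "homogeneous_vec t v \<Longrightarrow> v = (\<Sum>k\<in>K. a k *s \<rho> k) \<Longrightarrow> v \<in> graded_combs K \<rho> t"
  unfolding graded_combs_def by (intro CollectI conjI exI[of _ a])

lemma graded_combsE:
  assumes "v \<in> graded_combs K \<rho> t"
  obtains a where "homogeneous_vec t v" "v = (\<Sum>k\<in>K. a k *s \<rho> k)"
  using assms unfolding graded_combs_def by blast

lemma smult_sum_right: "c *s (\<Sum>k\<in>K. f k) = (\<Sum>k\<in>K. c *s (f k :: 'a::semiring_1 ^ 'n))"
  by (simp add: vec_eq_iff sum_distrib_left)

lemma smult_smult: "c *s (b *s v) = (c * b) *s (v :: 'a::semigroup_mult ^ 'n)"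
  by (simp add: vec_eq_iff mult.assoc)

lemma subspace_graded_combs: "CV.subspace (graded_combs K \<rho> t)"
proof (rule CV.subspaceI)
  show "0 \<in> graded_combs K \<rho> t" by (rule graded_combsI[of _ _ "\<lambda>_. 0"]) simp_all
  fix v w c assume "v \<in> graded_combs K \<rho> t"
  then obtain a where v: "homogeneous_vec t v" "v = (\<Sum>k\<in>K. a k *s \<rho> k)" by (rule graded_combsE)
  have "Const c *s v = (\<Sum>k\<in>K. (Const c * a k) *s \<rho> k)" by (simp add: v(2) smult_sum_right smult_smult)
  moreover have "homogeneous_vec t (Const c *s v)" using homogeneous_vec_smult[OF homogeneous_Const v(1)] by simp
  ultimately show "Const c *s v \<in> graded_combs K \<rho> t" by (intro graded_combsI)
  assume "w \<in> graded_combs K \<rho> t"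
  then obtain b where w: "homogeneous_vec t w" "w = (\<Sum>k\<in>K. b k *s \<rho> k)" by (rule graded_combsE)
  have "v + w = (\<Sum>k\<in>K. (a k + b k) *s \<rho> k)" unfolding v(2) w(2) sum.distrib[symmetric] by (rule sum.cong) (simp_all add: vec_eq_iff distrib_right)
  then show "v + w \<in> graded_combs K \<rho> t" by (rule graded_combsI[OF homogeneous_vec_add[OF v(1) w(1)]])
qed

lemma graded_combs_coeffs:
  assumes "v \<in> graded_combs K \<rho> t" "\<And>k. k \<in> K \<Longrightarrow> homogeneous_vec (\<delta> k) (\<rho> k)"
  obtains a where "v = (\<Sum>k\<in>K. a k *s \<rho> k)" "\<And>k. \<delta> k \<le> t \<Longrightarrow> homogeneous (t - \<delta> k) (a k)" "\<And>k. t < \<delta> k \<Longrightarrow> a k = 0"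
proof -
  obtain a where v: "homogeneous_vec t v" "v = (\<Sum>k\<in>K. a k *s \<rho> k)" using assms(1) by (rule graded_combsE)
  have "v = vhcomp t v" using v(1) by (simp add: vhcomp_homogeneous)
  also have "\<dots> = (\<Sum>k\<in>K. (if \<delta> k \<le> t then hcomp (t - \<delta> k) (a k) else 0) *s \<rho> k)"
    unfolding v(2) vhcomp_sum by (rule sum.cong) (simp_all add: vhcomp_smult[OF assms(2)])
  finally show ?thesis by (rule that) auto
qed

lemma graded_combs_insert:
  fixes \<rho> :: "'k \<Rightarrow> ('n::finite) cpoly_vec"
  assumes "finite K" "k \<notin> K" and hom: "\<And>i. i \<in> insert k K \<Longrightarrow> homogeneous_vec (\<delta> i) (\<rho> i)"
  shows "graded_combs (insert k K) \<rho> t =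
    (if \<delta> k \<le> t then {u + w | u w. u \<in> graded_combs K \<rho> t \<and> w \<in> (\<lambda>q. q *s \<rho> k) ` Hom (t - \<delta> k)}
     else graded_combs K \<rho> t)"
proof (intro subset_antisym subsetI)
  fix v assume "v \<in> graded_combs (insert k K) \<rho> t"
  then obtain a where a: "v = (\<Sum>i\<in>insert k K. a i *s \<rho> i)"
    "\<And>i. \<delta> i \<le> t \<Longrightarrow> homogeneous (t - \<delta> i) (a i)" "\<And>i. t < \<delta> i \<Longrightarrow> a i = 0"
    by (rule graded_combs_coeffs[OF _ hom]) blast+
  define u where "u = (\<Sum>i\<in>K. a i *s \<rho> i)"
  have "homogeneous_vec t (a i *s \<rho> i)" if "i \<in> insert k K" for i
    using homogeneous_vec_smult[OF a(2)[of i] hom[OF that]] a(3)[of i] by (cases "\<delta> i \<le> t") auto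
  then have "homogeneous_vec t u" unfolding u_def homogeneous_vec_def by (auto intro!: homogeneous_sum)
  then have u: "u \<in> graded_combs K \<rho> t" by (rule graded_combsI) (rule u_def)
  have v: "v = u + a k *s \<rho> k" using assms(1,2) by (simp add: a(1) u_def add.commute)
  show "v \<in> (if \<delta> k \<le> t then {u + w | u w. u \<in> graded_combs K \<rho> t \<and> w \<in> (\<lambda>q. q *s \<rho> k) ` Hom (t - \<delta> k)}
     else graded_combs K \<rho> t)"
    using u v a(2)[of k] a(3)[of k] by (cases "\<delta> k \<le> t") auto
next
  have sub: "u + q *s \<rho> k \<in> graded_combs (insert k K) \<rho> t"
    if "u \<in> graded_combs K \<rho> t" "homogeneous_vec t (q *s \<rho> k)" for u q
  proof -
    from that(1) obtain a where a: "homogeneous_vec t u" "u = (\<Sum>i\<in>K. a i *s \<rho> i)" by (rule graded_combsE)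
    have "(\<Sum>i\<in>K. (a(k := q)) i *s \<rho> i) = u" unfolding a(2) using assms(2) by (intro sum.cong) auto
    then have "u + q *s \<rho> k = (\<Sum>i\<in>insert k K. (a(k := q)) i *s \<rho> i)" using assms(1,2) by (simp add: add.commute)
    then show ?thesis by (rule graded_combsI[OF homogeneous_vec_add[OF a(1) that(2)]])
  qed
  fix v assume v: "v \<in> (if \<delta> k \<le> t then {u + w | u w. u \<in> graded_combs K \<rho> t \<and> w \<in> (\<lambda>q. q *s \<rho> k) ` Hom (t - \<delta> k)}
     else graded_combs K \<rho> t)"
  show "v \<in> graded_combs (insert k K) \<rho> t"
  proof (cases "\<delta> k \<le> t")
    case True
    then obtain u q where uq: "v = u + q *s \<rho> k" "u \<in> graded_combs K \<rho> t" "homogeneous (t - \<delta> k) q" using v by auto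
    have "homogeneous_vec t (q *s \<rho> k)" using homogeneous_vec_smult[OF uq(3) hom[of k]] True by simp
    then show ?thesis using sub uq by blast
  next
    case False
    then show ?thesis using sub[of v 0] v by simp
  qed
qed

text \<open>The upper bound serves generators with relations, the equality independent ones; one
  induction on \<open>K\<close> proves both. The guard \<open>\<delta> k \<le> t\<close> expresses
  that S(-\<delta>) vanishes below degree \<delta>, where truncated subtraction would count
  constants.\<close>

lemma dim_graded_combs:
  fixes \<rho> :: "'k \<Rightarrow> ('n::finite) cpoly_vec"
  assumes "finite K" and "\<And>k. k \<in> K \<Longrightarrow> homogeneous_vec (\<delta> k) (\<rho> k)"
  shows "CV.findim (graded_combs K \<rho> t) \<and>
    CV.dim (graded_combs K \<rho> t) \<le> (\<Sum>k\<in>K. if \<delta> k \<le> t then mon_count TYPE('n) (t - \<delta> k) else 0) \<and>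
    ((\<forall>a. (\<Sum>k\<in>K. a k *s \<rho> k) = 0 \<longrightarrow> (\<forall>k\<in>K. a k = 0)) \<longrightarrow>
      CV.dim (graded_combs K \<rho> t) = (\<Sum>k\<in>K. if \<delta> k \<le> t then mon_count TYPE('n) (t - \<delta> k) else 0))"
  using assms
proof (induction K rule: finite_induct)
  case empty
  have "graded_combs {} \<rho> t = {0}" by (auto simp: graded_combs_def)
  moreover have "CV.findim {0 :: 'n cpoly_vec}" unfolding CV.findim_def by (intro exI[of _ "{}"]) simp
  ultimately show ?case by simp
next
  case (insert k K)
  let ?U = "graded_combs K \<rho> t" and ?W = "(\<lambda>q. q *s \<rho> k) ` Hom (t - \<delta> k)"
  have IH: "CV.findim ?U" "CV.dim ?U \<le> (\<Sum>k\<in>K. if \<delta> k \<le> t then mon_count TYPE('n) (t - \<delta> k) else 0)"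
    "(\<forall>a. (\<Sum>k\<in>K. a k *s \<rho> k) = 0 \<longrightarrow> (\<forall>k\<in>K. a k = 0)) \<Longrightarrow>
      CV.dim ?U = (\<Sum>k\<in>K. if \<delta> k \<le> t then mon_count TYPE('n) (t - \<delta> k) else 0)"
    using insert.IH insert.prems by auto
  have indK: "\<forall>a. (\<Sum>k\<in>K. a k *s \<rho> k) = 0 \<longrightarrow> (\<forall>k\<in>K. a k = 0)"
    if ind: "\<forall>a. (\<Sum>i\<in>insert k K. a i *s \<rho> i) = 0 \<longrightarrow> (\<forall>i\<in>insert k K. a i = 0)"
  proof (intro allI impI ballI)
    fix a i assume a: "(\<Sum>k\<in>K. a k *s \<rho> k) = 0" and i: "i \<in> K"
    have "(\<Sum>i\<in>K. (a(k := 0)) i *s \<rho> i) = (\<Sum>k\<in>K. a k *s \<rho> k)" using insert.hyps(2) by (intro sum.cong) auto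
    then have "(\<Sum>i\<in>insert k K. (a(k := 0)) i *s \<rho> i) = 0" using insert.hyps a by simp
    then have "(a(k := 0)) i = 0" using ind i by blast
    then show "a i = 0" using i insert.hyps(2) by (auto split: if_splits)
  qed
  show ?case
  proof (cases "\<delta> k \<le> t")
    case False
    then have eq: "graded_combs (insert k K) \<rho> t = ?U"
      using graded_combs_insert[OF insert.hyps insert.prems, where t = t] by simp
    show ?thesis using IH(1,2) IH(3)[OF indK] False insert.hyps unfolding eq by simp
  next
    case True
    have eq: "graded_combs (insert k K) \<rho> t = {u + w | u w. u \<in> ?U \<and> w \<in> ?W}"
      using graded_combs_insert[OF insert.hyps insert.prems, where t = t] True by simp
    have lin: "Vector_Spaces.linear (\<lambda>c (p :: 'n cpoly). Const c * p) (\<lambda>c v. Const c *s v) (\<lambda>q. q *s \<rho> k)"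
      by unfold_locales (simp_all add: vec_eq_iff algebra_simps)
    have W: "CV.findim ?W" "CV.dim ?W + CP.dim {q \<in> Hom (t - \<delta> k). q *s \<rho> k = 0} = mon_count TYPE('n) (t - \<delta> k)"
      using CPV.rank_nullity[OF lin subspace_Hom findim_Hom, of "t - \<delta> k"]
      by (simp_all add: mon_count_def dim_Hom)
    have Ws: "CV.subspace ?W" by (rule CPV.linear_subspace_image[OF lin subspace_Hom])
    note sum = CV.dim_sum_Int[OF subspace_graded_combs Ws IH(1) W(1)]
    have le: "CV.dim (graded_combs (insert k K) \<rho> t) \<le>
        (\<Sum>k\<in>insert k K. if \<delta> k \<le> t then mon_count TYPE('n) (t - \<delta> k) else 0)"
      using sum(1) IH(2) W(2) insert.hyps True unfolding eq by simp
    have "CV.dim (graded_combs (insert k K) \<rho> t) =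
        (\<Sum>k\<in>insert k K. if \<delta> k \<le> t then mon_count TYPE('n) (t - \<delta> k) else 0)"
      if ind: "\<forall>a. (\<Sum>i\<in>insert k K. a i *s \<rho> i) = 0 \<longrightarrow> (\<forall>i\<in>insert k K. a i = 0)"
    proof -
      have key: "q = 0" if "(\<Sum>i\<in>K. a i *s \<rho> i) = q *s \<rho> k" for a q
      proof -
        have "(\<Sum>i\<in>K. (a(k := - q)) i *s \<rho> i) = (\<Sum>k\<in>K. a k *s \<rho> k)" using insert.hyps(2) by (intro sum.cong) auto
        then have "(\<Sum>i\<in>insert k K. (a(k := - q)) i *s \<rho> i) = (- q) *s \<rho> k + q *s \<rho> k"
          using insert.hyps that by simp
        also have "\<dots> = 0" by (simp flip: vector_sadd_rdistrib)
        finally have "(\<Sum>i\<in>insert k K. (a(k := - q)) i *s \<rho> i) = 0" .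
        then have "(a(k := - q)) k = 0" using ind by blast
        then show ?thesis by simp
      qed
      have "q = 0" if "q *s \<rho> k = 0" for q using key[of "\<lambda>_. 0" q] that by simp
      then have "{q \<in> Hom (t - \<delta> k). q *s \<rho> k = 0} = {0}" by auto
      then have 1: "CV.dim ?W = mon_count TYPE('n) (t - \<delta> k)" using W(2) by simp
      have "?U \<inter> ?W = {0}"
      proof
        show "?U \<inter> ?W \<subseteq> {0}"
        proof
          fix v assume v: "v \<in> ?U \<inter> ?W"
          then obtain q where q: "v = q *s \<rho> k" by blast
          from v have "v \<in> ?U" by blast
          then obtain a where "v = (\<Sum>i\<in>K. a i *s \<rho> i)" by (rule graded_combsE)
          then have "q = 0" using q by (intro key[of a]) simp
          then show "v \<in> {0}" using q by simp
        qed
        show "{0} \<subseteq> ?U \<inter> ?W" using CV.subspace_0[OF subspace_graded_combs] CV.subspace_0[OF Ws] by blast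
      qed
      then have 2: "CV.dim (?U \<inter> ?W) = 0" by simp
      show ?thesis using sum(1) 1 2 IH(3)[OF indK[OF ind]] insert.hyps True unfolding eq by simp
    qed
    then show ?thesis using le sum(2) unfolding eq[symmetric] by blast
  qed
qed

lemma axis_sum: "(\<Sum>k\<in>UNIV. a k *s axis k (1 :: 'a::comm_ring_1)) $ j = a j"
proof -
  have "(\<Sum>k\<in>UNIV. a k *s axis k (1 :: 'a)) $ j = (\<Sum>k\<in>UNIV. if k = j then a k else 0)"
    unfolding sum_component by (rule sum.cong) (auto simp: axis_def)
  then show ?thesis by simp
qed

lemma dim_Homv:
  "CV.findim (Homv t :: ('n::finite) cpoly_vec set)"
  "CV.dim (Homv t :: ('n::finite) cpoly_vec set) = CARD('n) * mon_count TYPE('n) t"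
proof -
  have eq: "graded_combs UNIV (\<lambda>k. axis k 1) t = (Homv t :: 'n cpoly_vec set)"
  proof -
    have "\<exists>a. v = (\<Sum>k\<in>UNIV. a k *s axis k 1)" for v :: "'n cpoly_vec"
      by (intro exI[of _ "\<lambda>k. v $ k"]) (simp only: vec_eq_iff axis_sum, simp)
    then show ?thesis by (auto simp: graded_combs_def)
  qed
  have hom: "homogeneous_vec 0 (axis k 1 :: 'n cpoly_vec)" for k
    using homogeneous_Const[of 1] by (simp add: homogeneous_vec_def axis_def)
  have ind: "\<forall>a. (\<Sum>k\<in>UNIV. a k *s axis k (1 :: 'n cpoly)) = 0 \<longrightarrow> (\<forall>k\<in>UNIV. a k = 0)"

  proof (intro allI impI ballI)
    fix a k assume "(\<Sum>k\<in>UNIV. a k *s axis k (1 :: 'n cpoly)) = 0"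
    then show "a k = 0" using axis_sum[of a k] by simp
  qed
  from dim_graded_combs[of UNIV "\<lambda>_. 0" "\<lambda>k. axis k 1 :: 'n cpoly_vec" t] hom ind
  show "CV.findim (Homv t :: 'n cpoly_vec set)" "CV.dim (Homv t :: 'n cpoly_vec set) = CARD('n) * mon_count TYPE('n) t"
    unfolding eq by auto
qed

lemma subspace_D0: "CV.subspace (D0 f)"
  by (rule CV.subspaceI)
     (auto simp: D0_def distrib_right sum.distrib mult.assoc sum_distrib_left[symmetric])

lemma findim_Homv_Int: "CV.findim (Homv t \<inter> X)"
  by (rule CV.findim_subset[OF dim_Homv(1)]) blast

lemma vhcomp_D0:
  assumes "homogeneous d f" "\<rho> \<in> D0 f"
  shows "vhcomp t \<rho> \<in> D0 f"
proof -
  have "0 = hcomp (t + (d - 1)) (\<Sum>j\<in>UNIV. \<rho> $ j * partial_deriv j f)" using assms(2) by (simp add: D0_def)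
  also have "\<dots> = (\<Sum>j\<in>UNIV. hcomp t (\<rho> $ j) * partial_deriv j f)"
    unfolding hcomp_sum by (rule sum.cong) (simp_all add: hcomp_mult[OF homogeneous_partial_deriv[OF assms(1)]])
  finally show ?thesis by (simp add: D0_def)
qed

text \<open>Rank and nullity of (a_j) \<mapsto> \<Sum> a_j f_j from degree \<open>t\<close> to
  degree \<open>t + (d - 1)\<close>, whose kernel is the piece of \<open>D0 f\<close>.\<close>

lemma hilbert_function_jacobian:
  fixes f :: "('n::finite) cpoly"
  assumes "homogeneous d f"
  shows "hilbert_function (jacobian_ideal f) (t + (d - 1)) + CARD('n) * mon_count TYPE('n) t =
    mon_count TYPE('n) (t + (d - 1)) + CV.dim (Homv t \<inter> D0 f)"
proof -
  let ?\<phi> = "\<lambda>\<rho> :: 'n cpoly_vec. \<Sum>j\<in>UNIV. \<rho> $ j * partial_deriv j f"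
  have lin: "Vector_Spaces.linear (\<lambda>c v. Const c *s v) (\<lambda>c (p :: 'n cpoly). Const c * p) ?\<phi>"
    by unfold_locales (simp_all add: distrib_right sum.distrib mult.assoc sum_distrib_left)
  have "?\<phi> ` Homv t = Hom (t + (d - 1)) \<inter> jacobian_ideal f"
  proof (intro subset_antisym subsetI)
    fix x assume "x \<in> ?\<phi> ` Homv t"
    then obtain \<rho> where \<rho>: "homogeneous_vec t \<rho>" "x = ?\<phi> \<rho>" by blast
    have "homogeneous (t + (d - 1)) x" unfolding \<rho>(2)
      using \<rho>(1) by (intro homogeneous_sum homogeneous_mult homogeneous_partial_deriv[OF assms]) (simp add: homogeneous_vec_def)
    moreover have "x \<in> jacobian_ideal f" unfolding jacobian_ideal_eq \<rho>(2) by blast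
    ultimately show "x \<in> Hom (t + (d - 1)) \<inter> jacobian_ideal f" by blast
  next
    fix x assume x: "x \<in> Hom (t + (d - 1)) \<inter> jacobian_ideal f"
    then obtain a where a: "x = (\<Sum>j\<in>UNIV. a j * partial_deriv j f)" unfolding jacobian_ideal_eq by blast
    have "x = hcomp (t + (d - 1)) x" using x hcomp_homogeneous[of "t + (d - 1)" x "t + (d - 1)"] by simp
    also have "\<dots> = ?\<phi> (\<chi> j. hcomp t (a j))"
      unfolding a hcomp_sum by (rule sum.cong) (simp_all add: hcomp_mult[OF homogeneous_partial_deriv[OF assms]])
    finally show "x \<in> ?\<phi> ` Homv t" by (rule image_eqI) (simp add: homogeneous_vec_def)
  qed
  moreover have "{\<rho> \<in> Homv t. ?\<phi> \<rho> = 0} = Homv t \<inter> D0 f" by (auto simp: D0_def)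
  ultimately have "CP.dim (Hom (t + (d - 1)) \<inter> jacobian_ideal f) + CV.dim (Homv t \<inter> D0 f) = CARD('n) * mon_count TYPE('n) t"
    using CVP.rank_nullity(2)[OF lin subspace_Homv dim_Homv(1), of t] by (simp add: dim_Homv(2))
  moreover have "S_ideal.subspace (jacobian_ideal f)" unfolding jacobian_ideal_def by (rule S_ideal.subspace_span)
  ultimately show ?thesis
    using hilbert_function_eq[of "jacobian_ideal f" "t + (d - 1)"] by (simp add: dim_Hom mon_count_def)
qed

section \<open>Leading coefficients of Hilbert polynomials\<close>

text \<open>(t + 1)...(t + n) / n!, the Hilbert polynomial of the polynomial ring in n + 1
  variables. Real coefficients permit shifts by negative numbers.\<close>

definition binom_poly :: "nat \<Rightarrow> real poly" where
  "binom_poly n = smult (1 / fact n) (\<Prod>k=1..n. [:real k, 1:])"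

lemma poly_binom_poly: "poly (binom_poly n) (real t) = real (n + t choose t)"
proof -
  have "(\<Prod>k=1..n. real k + real t) = fact (n + t) / fact t"
  proof (induction n)
    case (Suc n)
    then have "(\<Prod>k=1..Suc n. real k + real t) = fact (n + t) / fact t * (real (Suc n) + real t)" by simp
    also have "\<dots> = fact (Suc n + t) / fact t" by (simp add: algebra_simps)
    finally show ?case .
  qed simp
  then show ?thesis by (simp add: binom_poly_def poly_prod binomial_fact)
qed

lemma degree_binom_poly: "degree (binom_poly n) = n" and lead_coeff_binom_poly: "coeff (binom_poly n) n = 1 / fact n"
proof -
  have "degree (\<Prod>k=1..n. [:real k, 1:]) = n" by (subst degree_prod_sum_eq) auto
  moreover have "lead_coeff (\<Prod>k=1..n. [:real k, 1:]) = 1" by (simp add: lead_coeff_prod)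
  ultimately show "degree (binom_poly n) = n" "coeff (binom_poly n) n = 1 / fact n" by (auto simp: binom_poly_def)
qed

lemma mon_count_eq: "CARD('n::finite) = n + 1 \<Longrightarrow> mon_count TYPE('n) t = (n + t choose t)"
  unfolding mon_count_def mons_in_UNIV[symmetric] by (simp add: card_mons_in)

lemma mon_count_poly: "CARD('n::finite) = n + 1 \<Longrightarrow> real (mon_count TYPE('n) t) = poly (binom_poly n) (real t)"
  by (simp add: mon_count_eq poly_binom_poly)

section \<open>Top coefficients of shifted polynomials\<close>

abbreviation shift :: "real \<Rightarrow> real poly \<Rightarrow> real poly" where
  "shift c p \<equiv> pcompose p [:c, 1:]"

lemma poly_shift: "poly (shift c p) x = poly p (x + c)"
  by (simp add: poly_pcompose add.commute)

lemma degree_shift: "degree (shift c p) = degree p"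
  by (simp add: degree_pcompose)

lemma coeff_shift_top: "degree p \<le> N \<Longrightarrow> coeff (shift c p) N = coeff p N"
proof (cases "degree p = N")
  case True
  have "coeff (shift c p) N = (\<Sum>i\<le>N. if i = N then coeff p N else 0)"
    unfolding pcompose_shift_coeff True by (rule sum.cong) (auto simp: binomial_eq_0)
  then show ?thesis by simp
next
  case False
  assume "degree p \<le> N"
  with False show ?thesis by (simp add: coeff_eq_0 degree_shift)
qed

lemma coeff_shift_second:
  assumes "degree p \<le> Suc N"
  shows "coeff (shift c p) N = coeff p N + real (Suc N) * c * coeff p (Suc N)"
proof -
  have "coeff (shift c p) N = (\<Sum>i\<le>degree p. coeff p i * (real (i choose N) * c ^ (i - N)))"
    by (rule pcompose_shift_coeff)
  also have "\<dots> = (\<Sum>i\<le>Suc N. coeff p i * (real (i choose N) * c ^ (i - N)))"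
    by (rule sum.mono_neutral_left) (use assms in \<open>auto simp: coeff_eq_0\<close>)
  also have "\<dots> = (\<Sum>i\<in>{N, Suc N}. coeff p i * (real (i choose N) * c ^ (i - N)))"
    by (rule sum.mono_neutral_right) (auto simp: binomial_eq_0)
  finally show ?thesis by (simp add: binomial_Suc_n)
qed

lemma coeff_shift_third:
  assumes "degree p \<le> Suc (Suc N)"
  shows "coeff (shift c p) N = coeff p N + real (Suc N) * c * coeff p (Suc N)
    + real (Suc (Suc N) choose N) * c ^ 2 * coeff p (Suc (Suc N))"
proof -
  have "coeff (shift c p) N = (\<Sum>i\<le>degree p. coeff p i * (real (i choose N) * c ^ (i - N)))"
    by (rule pcompose_shift_coeff)
  also have "\<dots> = (\<Sum>i\<le>Suc (Suc N). coeff p i * (real (i choose N) * c ^ (i - N)))"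
    by (rule sum.mono_neutral_left) (use assms in \<open>auto simp: coeff_eq_0\<close>)
  also have "\<dots> = (\<Sum>i\<in>{N, Suc N, Suc (Suc N)}. coeff p i * (real (i choose N) * c ^ (i - N)))"
    by (rule sum.mono_neutral_right) (auto simp: binomial_eq_0)
  also have "\<dots> = coeff p N + real (Suc N) * c * coeff p (Suc N)
    + real (Suc (Suc N) choose N) * c ^ 2 * coeff p (Suc (Suc N))"
    by (simp add: binomial_Suc_n Suc_diff_le numeral_2_eq_2 del: binomial_Suc_Suc)
  finally show ?thesis .
qed

lemma pair_sum_eq: "pair_sum n e = ((\<Sum>i<n. e i) ^ 2 - (\<Sum>i<n. e i ^ 2)) / 2"
proof (induction n)
  case 0
  show ?case by (simp add: pair_sum_def)
next
  case (Suc n)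
  have "{(i, j). i < j \<and> j < Suc n} = {(i, j). i < j \<and> j < n} \<union> (\<lambda>i. (i, n)) ` {..<n}" by auto
  moreover have "finite {(i, j). i < j \<and> j < (n :: nat)}"
    by (rule finite_subset[of _ "{..<n} \<times> {..<n}"]) auto
  ultimately have "pair_sum (Suc n) e = pair_sum n e + (\<Sum>(i, j)\<in>(\<lambda>i. (i, n)) ` {..<n}. e i * e j)"
    unfolding pair_sum_def by (simp only:) (rule sum.union_disjoint, auto)
  also have "(\<Sum>(i, j)\<in>(\<lambda>i. (i, n)) ` {..<n}. e i * e j) = (\<Sum>i<n. e i) * e n"
    by (simp add: sum.reindex inj_on_def sum_distrib_right)
  finally show ?case unfolding Suc sum.lessThan_Suc by (simp add: power2_sum)
qed

text \<open>The Hilbert polynomial of \<open>S/J\<^sub>f\<close>, shifted by \<open>e = d - 1\<close>, that a free resolution of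
  \<open>D\<^sub>0(f)\<close> with generators in degrees \<open>\<delta>\<^sub>0, \<dots>, \<delta>\<^sub>n\<^sub>-\<^sub>1\<close> would give.\<close>

definition free_hilbert_poly :: "nat \<Rightarrow> real \<Rightarrow> (nat \<Rightarrow> real) \<Rightarrow> real poly" where
  "free_hilbert_poly n e \<delta> = shift e (binom_poly n) - smult (real n + 1) (binom_poly n)
     + (\<Sum>i<n. shift (- \<delta> i) (binom_poly n))"

text \<open>A shift preserves the leading coefficient, and 1 - (n + 1) + n = 0.\<close>

lemma coeff_free_hilbert_poly_high:
  assumes "j \<ge> n"
  shows "coeff (free_hilbert_poly n e \<delta>) j = 0"
proof (cases "j = n")
  case True
  have "coeff (shift c (binom_poly n)) n = coeff (binom_poly n) n" for c
    by (rule coeff_shift_top) (simp add: degree_binom_poly)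
  then show ?thesis unfolding True free_hilbert_poly_def by (simp add: coeff_sum algebra_simps)
next
  case False
  then show ?thesis using assms
    by (simp add: free_hilbert_poly_def coeff_sum coeff_eq_0 degree_shift degree_binom_poly)
qed

text \<open>A shift by \<open>c\<close> adds \<open>c / fact (n - 1)\<close> to the coefficient in
  degree \<open>n - 1\<close>; the unshifted parts cancel as in degree \<open>n\<close>.\<close>

lemma coeff_free_hilbert_poly_1:
  assumes "n \<ge> 1"
  shows "coeff (free_hilbert_poly n e \<delta>) (n - 1) = (e - (\<Sum>i<n. \<delta> i)) / fact (n - 1)"
proof -
  obtain N where n: "n = Suc N" using assms by (cases n) auto
  let ?p = "binom_poly n"
  have f: "real (Suc N) * (1 / fact (Suc N)) = 1 / fact N" by (simp add: divide_simps)
  have s: "coeff (shift c ?p) N = coeff ?p N + c / fact N" for c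
  proof -
    have "coeff (shift c ?p) N = coeff ?p N + real (Suc N) * c * coeff ?p (Suc N)"
      by (rule coeff_shift_second) (simp add: degree_binom_poly n)
    also have "coeff ?p (Suc N) = 1 / fact (Suc N)" using lead_coeff_binom_poly[of n] n by simp
    also have "real (Suc N) * c * (1 / fact (Suc N)) = c * (real (Suc N) * (1 / fact (Suc N)))" by (simp only: ac_simps)
    finally show ?thesis unfolding f by simp
  qed
  have "coeff (free_hilbert_poly n e \<delta>) N = coeff ?p N + e / fact N - (real n + 1) * coeff ?p N
      + (\<Sum>i<n. coeff ?p N - \<delta> i / fact N)"
    unfolding free_hilbert_poly_def by (simp add: coeff_sum s)
  also have "\<dots> = (e - (\<Sum>i<n. \<delta> i)) / fact N"
    by (simp add: sum_subtractf algebra_simps diff_divide_distrib sum_divide_distrib)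
  finally show ?thesis by (simp add: n)
qed

text \<open>Here the effect of a shift is quadratic in \<open>c\<close>. The constant parts cancel
  by the count of summands, the linear parts by the condition on the sum. There remains (e^2 +
  \<Sum> \<delta>_i^2) / 2, and \<open>pair_sum_eq\<close> converts it.\<close>

lemma coeff_free_hilbert_poly_2:
  assumes "n \<ge> 2" "(\<Sum>i<n. \<delta> i) = e"
  shows "coeff (free_hilbert_poly n e \<delta>) (n - 2) = (e ^ 2 - pair_sum n \<delta>) / fact (n - 2)"
proof -
  obtain N where n: "n = Suc (Suc N)" using assms(1) by (cases n; cases "n - 1") auto
  let ?p = "binom_poly n"
  have "(Suc (Suc N) choose N) = (Suc (Suc N) choose (Suc (Suc N) - N))"
    by (rule binomial_symmetric) simp
  also have "\<dots> = (Suc (Suc N) choose 2)" by (rule arg_cong[of _ _ "\<lambda>k. Suc (Suc N) choose k"]) simp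
  also have "\<dots> = Suc (Suc N) * Suc N div 2" by (simp only: choose_two diff_Suc_1)
  finally have "2 * (Suc (Suc N) choose N) = 2 * (Suc (Suc N) * Suc N div 2)" by (simp only:)
  also have "\<dots> = Suc (Suc N) * Suc N" by (rule dvd_mult_div_cancel) simp
  finally have "2 * (Suc (Suc N) choose N) = Suc (Suc N) * Suc N" .
  then have "real (2 * (Suc (Suc N) choose N)) = real (Suc (Suc N) * Suc N)" by (simp only:)
  then have C: "real (Suc (Suc N) choose N) = real (Suc (Suc N)) * real (Suc N) / 2"
    by (simp only: of_nat_mult)
  have F: "(fact (Suc (Suc N)) :: real) = real (Suc (Suc N)) * real (Suc N) * fact N"
    by (simp only: fact_Suc of_nat_mult mult.assoc)
  have f: "real (Suc (Suc N) choose N) * (1 / fact (Suc (Suc N))) = 1 / (2 * fact N)"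
    unfolding C F by (simp del: of_nat_Suc)
  define a b where "a = coeff ?p N" and "b = real (Suc N) * coeff ?p (Suc N)"
  have s: "coeff (shift c ?p) N = a + b * c + c ^ 2 / (2 * fact N)" for c
  proof -
    have "coeff (shift c ?p) N = coeff ?p N + real (Suc N) * c * coeff ?p (Suc N)
        + real (Suc (Suc N) choose N) * c ^ 2 * coeff ?p (Suc (Suc N))"
      by (rule coeff_shift_third) (simp add: degree_binom_poly n)
    also have "coeff ?p (Suc (Suc N)) = 1 / fact (Suc (Suc N))" using lead_coeff_binom_poly[of n] n by simp
    also have "real (Suc (Suc N) choose N) * c ^ 2 * (1 / fact (Suc (Suc N))) =
        c ^ 2 * (real (Suc (Suc N) choose N) * (1 / fact (Suc (Suc N))))" by (simp only: ac_simps)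
    finally show ?thesis unfolding f a_def b_def by (simp add: mult.commute mult.left_commute)
  qed
  have "coeff (free_hilbert_poly n e \<delta>) N = (a + b * e + e ^ 2 / (2 * fact N)) - (real n + 1) * a
      + (\<Sum>i<n. a + b * (- \<delta> i) + (- \<delta> i) ^ 2 / (2 * fact N))"
    unfolding free_hilbert_poly_def by (simp only: coeff_add coeff_diff coeff_smult coeff_sum s a_def[symmetric])
  also have "(\<Sum>i<n. a + b * (- \<delta> i) + (- \<delta> i) ^ 2 / (2 * fact N)) =
      real n * a - b * (\<Sum>i<n. \<delta> i) + (\<Sum>i<n. \<delta> i ^ 2) / (2 * fact N)"
    by (simp add: sum.distrib sum_subtractf sum_divide_distrib sum_distrib_left)
  finally have "coeff (free_hilbert_poly n e \<delta>) N = (e ^ 2 + (\<Sum>i<n. \<delta> i ^ 2)) / (2 * fact N)"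
    using assms(2) by (simp add: algebra_simps add_divide_distrib)
  then show ?thesis using assms(2) by (simp add: n pair_sum_eq field_simps)
qed

section \<open>Asymptotics of polynomials and of Hilbert functions\<close>

lemma poly_div_power_tendsto:
  fixes p :: "real poly"
  assumes "degree p \<le> N"
  shows "(\<lambda>t. poly p (real t) / real t ^ N) \<longlonglongrightarrow> coeff p N"
proof -
  have "((\<lambda>t. \<Sum>i\<le>N. coeff p i * (real t ^ i / real t ^ N)) \<longlongrightarrow> (\<Sum>i\<le>N. coeff p i * (if i = N then 1 else 0))) sequentially"
  proof (intro tendsto_sum tendsto_mult tendsto_const)
    fix i assume i: "i \<in> {..N}"
    show "(\<lambda>t. real t ^ i / real t ^ N) \<longlonglongrightarrow> (if i = N then 1 else 0)"
    proof (cases "i = N")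
      case True
      have "\<forall>\<^sub>F t in sequentially. real t ^ i / real t ^ N = 1"
        using eventually_gt_at_top[of 0] by eventually_elim (simp add: True)
      then have "(\<lambda>t. real t ^ i / real t ^ N) \<longlonglongrightarrow> 1" by (rule tendsto_eventually)
      then show ?thesis using True by simp
    next
      case False
      then have iN: "i < N" using i by simp
      have "(\<lambda>t. inverse (real t ^ (N - i))) \<longlonglongrightarrow> 0"
        by (intro tendsto_inverse_0_at_top filterlim_pow_at_top filterlim_real_sequentially) (use iN in simp)
      moreover have "\<forall>\<^sub>F t in sequentially. inverse (real t ^ (N - i)) = real t ^ i / real t ^ N"
        using eventually_gt_at_top[of 0]
      proof eventually_elim
        case (elim t)
        have "real t ^ N = real t ^ i * real t ^ (N - i)" using iN by (simp flip: power_add)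
        then show ?case using elim by (simp add: field_simps)
      qed
      ultimately have "(\<lambda>t. real t ^ i / real t ^ N) \<longlonglongrightarrow> 0" by (rule Lim_transform_eventually)
      then show ?thesis using False by simp
    qed
  qed
  moreover have "poly p (real t) / real t ^ N = (\<Sum>i\<le>N. coeff p i * (real t ^ i / real t ^ N))" for t
  proof -
    have "poly p (real t) = (\<Sum>i\<le>N. coeff p i * real t ^ i)"
      unfolding poly_altdef by (rule sum.mono_neutral_left) (use assms in \<open>auto simp: coeff_eq_0\<close>)
    then show ?thesis by (simp add: sum_divide_distrib)
  qed
  moreover have "(\<Sum>i\<le>N. coeff p i * (if i = N then 1 else 0)) = coeff p N"
    by (simp add: if_distrib sum.delta cong: if_cong)
  ultimately show ?thesis by simp
qed

lemma poly_eventually_nonneg_coeff: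
  fixes p :: "real poly"
  assumes "degree p \<le> N" "\<And>t. t \<ge> T \<Longrightarrow> 0 \<le> poly p (real t)"
  shows "0 \<le> coeff p N"
proof (rule tendsto_lowerbound[OF poly_div_power_tendsto[OF assms(1)]])
  show "\<forall>\<^sub>F t in sequentially. 0 \<le> poly p (real t) / real t ^ N"
    using eventually_ge_at_top[of T] by eventually_elim (simp add: assms(2))
qed simp

lemma growth_le_imp_tendsto:
  assumes "growth_le k I" "k \<le> N"
  shows "(\<lambda>t. real (hilbert_function I t) / real t ^ N) \<longlonglongrightarrow> 0"
proof (cases k)
  case 0
  with assms(1) obtain T where T: "\<And>t. t \<ge> T \<Longrightarrow> hilbert_function I t = 0" by auto
  have "\<forall>\<^sub>F t in sequentially. real (hilbert_function I t) / real t ^ N = 0"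
    using eventually_ge_at_top[of T] by eventually_elim (simp add: T)
  then show ?thesis by (rule tendsto_eventually)
next
  case (Suc j)
  with assms(1) obtain C where C: "\<And>t. hilbert_function I t \<le> C * (t + 1) ^ j" by auto
  have "(\<lambda>t. poly (smult (real C) ([:1, 1:] ^ j)) (real t) / real t ^ N) \<longlonglongrightarrow> coeff (smult (real C) ([:1, 1:] ^ j)) N"
  proof (rule poly_div_power_tendsto)
    show "degree (smult (real C) ([:1, 1:] ^ j)) \<le> N"
      using degree_smult_le[of "real C" "[:1, 1:] ^ j"] degree_power_le[of "[:1::real, 1:]" j] Suc assms(2) by simp
  qed
  moreover have "coeff (smult (real C) ([:1, 1:] ^ j)) N = 0"
    using Suc assms(2) by (simp add: coeff_shift_power binomial_eq_0)
  ultimately have lim: "(\<lambda>t. real C * (1 + real t) ^ j / real t ^ N) \<longlonglongrightarrow> 0" by (simp only: poly_smult poly_power) simp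
  show ?thesis
  proof (rule tendsto_sandwich[OF _ _ tendsto_const lim])
    show "\<forall>\<^sub>F t in sequentially. real (hilbert_function I t) / real t ^ N \<le> real C * (1 + real t) ^ j / real t ^ N"
    proof (intro always_eventually allI divide_right_mono)
      fix t
      have "real (hilbert_function I t) \<le> real (C * (t + 1) ^ j)" using C[of t] of_nat_le_iff by blast
      then show "real (hilbert_function I t) \<le> real C * (1 + real t) ^ j" by (simp add: add.commute)
    qed simp
  qed simp
qed

text \<open>Otherwise \<open>h\<close> has degree at least \<open>k\<close>, and after division by
  that power of t the Hilbert function would tend both to 0 and to the leading coefficient of
  \<open>h\<close>.\<close>

lemma growth_le_imp_coeff_0:
  assumes "growth_le k I" "\<And>t. t \<ge> T \<Longrightarrow> poly h (real t) = real (hilbert_function I t)" "j \<ge> k"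
  shows "coeff h j = 0"
proof (rule ccontr)
  assume nz: "coeff h j \<noteq> 0"
  then have "j \<le> degree h" by (rule le_degree)
  then have k: "k \<le> degree h" using assms(3) by simp
  have "\<forall>\<^sub>F t in sequentially. real (hilbert_function I t) / real t ^ degree h = poly h (real t) / real t ^ degree h"
    using eventually_ge_at_top[of T] by eventually_elim (simp add: assms(2))
  then have "(\<lambda>t. poly h (real t) / real t ^ degree h) \<longlonglongrightarrow> 0"
    by (rule Lim_transform_eventually[OF growth_le_imp_tendsto[OF assms(1) k]])
  moreover have "(\<lambda>t. poly h (real t) / real t ^ degree h) \<longlonglongrightarrow> lead_coeff h"
    by (rule poly_div_power_tendsto) simp
  ultimately have "lead_coeff h = 0" using LIMSEQ_unique by blast
  then show False using nz by simp
qed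

section \<open>Free hypersurfaces\<close>

lemma vec_span_image:
  fixes \<rho> :: "'k \<Rightarrow> ('n::finite) cpoly_vec"
  assumes "finite K"
  shows "S_vec.span (\<rho> ` K) = range (\<lambda>a. \<Sum>k\<in>K. a k *s \<rho> k)" (is "_ = range ?F")
proof (rule S_vec.span_unique)
  have F_in: "x \<in> range ?F" if "x = ?F a" for x a using that by blast
  show "\<rho> ` K \<subseteq> range ?F"
  proof
    fix x assume "x \<in> \<rho> ` K"
    then obtain k where k: "x = \<rho> k" "k \<in> K" by blast
    then have "x = (\<Sum>j\<in>K. if j = k then \<rho> j else 0)" using assms by (simp add: sum.delta)
    also have "\<dots> = ?F (\<lambda>j. if j = k then 1 else 0)" by (rule sum.cong) (auto simp: vec_eq_iff)
    finally show "x \<in> range ?F" by (rule F_in)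
  qed
  show "S_vec.subspace (range ?F)"
  proof (rule S_vec.subspaceI)
    have "0 = ?F (\<lambda>_. 0)" by simp
    then show "0 \<in> range ?F" by (rule F_in)
    fix x y c assume "x \<in> range ?F"
    then obtain a where x: "x = ?F a" by blast
    have "c *s x = ?F (\<lambda>j. c * a j)" unfolding x smult_sum_right smult_smult ..
    then show "c *s x \<in> range ?F" by (rule F_in)
    assume "y \<in> range ?F"
    then obtain b where y: "y = ?F b" by blast
    have "x + y = ?F (\<lambda>j. a j + b j)" unfolding x y sum.distrib[symmetric] vector_sadd_rdistrib ..
    then show "x + y \<in> range ?F" by (rule F_in)
  qed
  fix T assume T: "\<rho> ` K \<subseteq> T" "S_vec.subspace T"
  have "?F a \<in> T" for a
    using T(1) by (intro S_vec.subspace_sum[OF T(2)] S_vec.subspace_scale[OF T(2)]) blast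
  then show "range ?F \<subseteq> T" by blast
qed

lemma set_conv_nth_image: "set rs = (!) rs ` {..<length rs}"
  by (auto simp: set_conv_nth)

lemma minimal_generatorsD:
  assumes "minimal_generators f rs ds"
  shows "length ds = length rs" "\<And>i. i < length rs \<Longrightarrow> homogeneous_vec (ds ! i) (rs ! i)"
    "D0 f = range (\<lambda>a. \<Sum>i<length rs. a i *s rs ! i)"
    "\<And>i. i < length rs \<Longrightarrow> rs ! i \<in> D0 f"
proof -
  have *: "list_all2 homogeneous_vec ds rs" "S_vec.span (set rs) = D0 f"
    using assms by (auto simp: minimal_generators_def)
  show "length ds = length rs" "\<And>i. i < length rs \<Longrightarrow> homogeneous_vec (ds ! i) (rs ! i)"
    using *(1) by (auto simp: list_all2_conv_all_nth)
  show "D0 f = range (\<lambda>a. \<Sum>i<length rs. a i *s rs ! i)"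
    using *(2) unfolding set_conv_nth_image by (simp add: vec_span_image)
  show "rs ! i \<in> D0 f" if "i < length rs" for i
    using *(2) S_vec.span_base[of "rs ! i" "set rs"] that by auto
qed

lemma homogeneous_relation:
  assumes "\<And>k. k \<in> K \<Longrightarrow> homogeneous_vec (\<delta> k) (\<rho> k)" "(\<Sum>k\<in>K. a k *s \<rho> k) = 0"
  shows "(\<Sum>k\<in>K. (if \<delta> k \<le> T then hcomp (T - \<delta> k) (a k) else 0) *s \<rho> k) = 0"
proof -
  have "0 = vhcomp T (\<Sum>k\<in>K. a k *s \<rho> k)" using assms(2) by simp
  also have "\<dots> = (\<Sum>k\<in>K. (if \<delta> k \<le> T then hcomp (T - \<delta> k) (a k) else 0) *s \<rho> k)"
    unfolding vhcomp_sum by (rule sum.cong) (simp_all add: vhcomp_smult[OF assms(1)])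
  finally show ?thesis by simp
qed

lemma mon_count_mono:
  assumes "CARD('n::finite) = n + 1" "s \<le> t"
  shows "mon_count TYPE('n) s \<le> mon_count TYPE('n) t"
proof -
  have "mon_count TYPE('n) t \<le> mon_count TYPE('n) (Suc t)" for t
    by (simp add: mon_count_eq[OF assms(1)])
  then show ?thesis using assms(2) by (rule lift_Suc_mono_le)
qed

text \<open>A rank count. Given a relation, multiplication by the coefficient of one generator maps
  \<open>D0 f\<close> injectively into the span of the other n - 1. Then its Hilbert function has
  leading coefficient at most (n - 1)/n!, whereas the kernel of a map from S^(n+1) to S(d-1) needs
  at least n/n!.\<close>

lemma free_generators_independent:
  fixes f :: "('n::{finite,linorder}) cpoly"
  assumes f: "homogeneous d f" and n: "CARD('n) = n + 1" and rs: "minimal_generators f rs ds" "length rs = n"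
    and rel: "(\<Sum>k<n. a k *s rs ! k) = 0" and i: "i < n"
  shows "a i = 0"
proof (rule ccontr)
  assume "a i \<noteq> 0"
  note gen = minimal_generatorsD[OF rs(1), unfolded rs(2)]
  obtain s where s: "hcomp s (a i) \<noteq> 0" using finite_hcomp_nonzero(2)[OF \<open>a i \<noteq> 0\<close>] by blast
  \<comment> \<open>The homogeneous part of the relation in degree \<open>s + ds ! i\<close>, chosen
    so that the coefficient at \<open>i\<close> is the nonzero component
    \<open>hcomp s (a i)\<close>.\<close>
  define b where "b k = (if ds ! k \<le> s + ds ! i then hcomp (s + ds ! i - ds ! k) (a k) else 0)" for k
  have bi: "b i = hcomp s (a i)" by (simp add: b_def)
  have rel': "(\<Sum>k<n. b k *s rs ! k) = 0"
    unfolding b_def by (rule homogeneous_relation[OF _ rel]) (simp add: gen(2))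
  then have rel'': "b i *s rs ! i + (\<Sum>k\<in>{..<n} - {i}. b k *s rs ! k) = 0"
    using i by (subst (asm) sum.remove[of _ i]) auto
  let ?G = "\<lambda>t. graded_combs ({..<n} - {i}) ((!) rs) t"
  have lin: "Vector_Spaces.linear (\<lambda>c v. Const c *s v) (\<lambda>c v. Const c *s v) (\<lambda>v :: 'n cpoly_vec. b i *s v)"
    by unfold_locales (simp_all add: vec_eq_iff algebra_simps)
  interpret VV: linear_space_pair "\<lambda>c (v :: 'n cpoly_vec). Const c *s v" "\<lambda>c (v :: 'n cpoly_vec). Const c *s v"
    by unfold_locales
  have bound: "CV.dim (Homv t \<inter> D0 f) \<le> (n - 1) * mon_count TYPE('n) (t + s)" for t
  proof -
    have "(\<lambda>v. b i *s v) ` (Homv t \<inter> D0 f) \<subseteq> ?G (t + s)"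
    proof
      fix w assume "w \<in> (\<lambda>v. b i *s v) ` (Homv t \<inter> D0 f)"
      then obtain v where v: "homogeneous_vec t v" "v \<in> D0 f" "w = b i *s v" by blast
      obtain c where c: "v = (\<Sum>k<n. c k *s rs ! k)" using v(2) gen(3) by blast
      have "w = b i *s (c i *s rs ! i + (\<Sum>k\<in>{..<n} - {i}. c k *s rs ! k))"
        unfolding v(3) c using i by (subst sum.remove[of _ i]) auto
      also have "\<dots> = c i *s (b i *s rs ! i) + (\<Sum>k\<in>{..<n} - {i}. (b i * c k) *s rs ! k)"
        by (simp add: vector_add_ldistrib smult_sum_right smult_smult mult.commute)
      also have "b i *s rs ! i = - (\<Sum>k\<in>{..<n} - {i}. b k *s rs ! k)"
        using rel'' by (simp add: eq_neg_iff_add_eq_0)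
      also have "c i *s (- (\<Sum>k\<in>{..<n} - {i}. b k *s rs ! k)) = (\<Sum>k\<in>{..<n} - {i}. (- (c i * b k)) *s rs ! k)"
        by (simp add: vec_eq_iff sum_distrib_left sum_negf mult.assoc)
      also have "\<dots> + (\<Sum>k\<in>{..<n} - {i}. (b i * c k) *s rs ! k) =
          (\<Sum>k\<in>{..<n} - {i}. (- (c i * b k) + b i * c k) *s rs ! k)"
        unfolding vector_sadd_rdistrib sum.distrib ..
      finally have w: "w = (\<Sum>k\<in>{..<n} - {i}. (- (c i * b k) + b i * c k) *s rs ! k)" .
      have "homogeneous_vec (t + s) w"
        unfolding v(3) bi using homogeneous_vec_smult[OF homogeneous_hcomp v(1), of s "a i"] by (simp add: add.commute)
      then show "w \<in> ?G (t + s)" using w by (rule graded_combsI)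
    qed
    moreover have g: "CV.findim (?G (t + s)) \<and> CV.dim (?G (t + s)) \<le>
        (\<Sum>k\<in>{..<n} - {i}. if ds ! k \<le> t + s then mon_count TYPE('n) (t + s - ds ! k) else 0)"
      using dim_graded_combs[of "{..<n} - {i}" "(!) ds" "(!) rs" "t + s"] gen(2) by simp
    ultimately have "CV.dim ((\<lambda>v. b i *s v) ` (Homv t \<inter> D0 f)) \<le> CV.dim (?G (t + s))"
      by (intro CV.dim_mono_findim) auto
    also have "\<dots> \<le> (\<Sum>k\<in>{..<n} - {i}. if ds ! k \<le> t + s then mon_count TYPE('n) (t + s - ds ! k) else 0)"
      using g by blast
    also have "\<dots> \<le> (\<Sum>k\<in>{..<n} - {i}. mon_count TYPE('n) (t + s))"
      by (rule sum_mono) (auto intro: mon_count_mono[OF n])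
    also have "\<dots> = (n - 1) * mon_count TYPE('n) (t + s)" using i by simp
    finally show ?thesis
    proof (subst (asm) VV.dim_image_inj[OF lin])
      show "CV.subspace (Homv t \<inter> D0 f)" by (intro CV.subspace_inter subspace_Homv subspace_D0)
      show "CV.findim (Homv t \<inter> D0 f)" by (rule findim_Homv_Int)
      fix v assume "b i *s v = 0"
      then show "v = 0" using s by (simp add: bi vec_eq_iff)
    qed
  qed
  let ?P = "binom_poly n"
  \<comment> \<open>Nonnegative by the two dimension bounds, but with leading coefficient (1 + (n -
    1) - (n + 1))/n! = -1/n!.\<close>
  define p where "p = shift (real (d - 1)) ?P + smult (real (n - 1)) (shift (real s) ?P) - smult (real (n + 1)) ?P"
  have "0 \<le> poly p (real t)" for t
  proof -
    have "CARD('n) * mon_count TYPE('n) t \<le> mon_count TYPE('n) (t + (d - 1)) + (n - 1) * mon_count TYPE('n) (t + s)"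
      using hilbert_function_jacobian[OF f, of t] bound[of t] by linarith
    then have "real (CARD('n) * mon_count TYPE('n) t) \<le> real (mon_count TYPE('n) (t + (d - 1)) + (n - 1) * mon_count TYPE('n) (t + s))"
      by (rule of_nat_mono)
    then show ?thesis
      by (simp only: p_def poly_diff poly_add poly_smult poly_shift of_nat_mult of_nat_add mon_count_poly[OF n] n)
  qed
  moreover have "degree p \<le> n"
    unfolding p_def by (intro degree_diff_le degree_add_le degree_smult_le[THEN order_trans]) (simp_all add: degree_shift degree_binom_poly)
  ultimately have "0 \<le> coeff p n" by (intro poly_eventually_nonneg_coeff[of p n 0])
  moreover have "coeff p n = - coeff ?P n"
  proof -
    have c: "coeff (shift c ?P) n = coeff ?P n" for c by (rule coeff_shift_top) (simp add: degree_binom_poly)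
    show ?thesis unfolding p_def coeff_add coeff_diff coeff_smult c using i by (simp add: of_nat_diff algebra_simps)
  qed
  ultimately show False using fact_gt_zero[of n, where 'a = real] by (simp add: lead_coeff_binom_poly)
qed

text \<open>Common to the free and the tame case: \<open>F\<close> is any polynomial for the shifted
  Hilbert function. By \<open>jacobian_growth\<close> its degree is at most \<open>n - 2\<close>, so
  undoing the shift leaves the coefficient there unchanged, and if that is nonzero, the dimension is
  exactly \<open>n - 2\<close>.\<close>

lemma hilbert_polynomial_jacobian:
  fixes f :: "('n::{finite,linorder}) cpoly"
  assumes f: "hypersurface d f" and n: "CARD('n) = n + 1" "2 \<le> n"
    and F: "\<forall>t\<ge>T. real (hilbert_function (jacobian_ideal f) (t + (d - 1))) = poly F (real t)"
  shows "hilbert_polynomial (jacobian_ideal f) = shift (- real (d - 1)) F"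
    "degree F \<le> n - 2" "coeff (hilbert_polynomial (jacobian_ideal f)) (n - 2) = coeff F (n - 2)"
    "coeff F (n - 2) \<noteq> 0 \<Longrightarrow> sing_dimension f = int n - 2"
proof -
  let ?h = "shift (- real (d - 1)) F"
  have h: "poly ?h (real t) = real (hilbert_function (jacobian_ideal f) t)" if "t \<ge> T + (d - 1)" for t
    using F[rule_format, of "t - (d - 1)"] that by (simp add: poly_shift of_nat_diff)
  then show eq: "hilbert_polynomial (jacobian_ideal f) = ?h" by (rule hilbert_polynomial_eqI)
  have g: "growth_le (n - 1) (jacobian_ideal f)" by (rule jacobian_growth[OF f n(1)])
  have z: "coeff ?h j = 0" if "j \<ge> n - 1" for j by (rule growth_le_imp_coeff_0[OF g h that])
  have "degree ?h \<le> n - 2"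
  proof (rule degree_le, intro allI impI)
    fix j assume "n - 2 < j"
    then show "coeff ?h j = 0" using n(2) by (intro z) linarith
  qed
  then show "degree F \<le> n - 2" by (simp add: degree_shift)
  then show c: "coeff (hilbert_polynomial (jacobian_ideal f)) (n - 2) = coeff F (n - 2)"
    unfolding eq by (rule coeff_shift_top)
  assume nz: "coeff F (n - 2) \<noteq> 0"
  have "\<not> growth_le (n - 2) (jacobian_ideal f)"
    using growth_le_imp_coeff_0[where k = "n - 2" and j = "n - 2", OF _ h] nz c eq by auto
  moreover have "hideal (jacobian_ideal f)" using f by (intro hideal_jacobian) (auto simp: hypersurface_def)
  moreover have "growth_le (Suc (n - 2)) (jacobian_ideal f)" using g n(2) by (simp add: numeral_2_eq_2 Suc_diff_Suc)
  ultimately have "sing_dimension f = int (n - 2)" by (intro proj_dimension_eqI)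
  then show "sing_dimension f = int n - 2" using n(2) by (simp add: of_nat_diff)
qed

lemma sing_degree_eq:
  assumes "sing_dimension f = int n - 2" "2 \<le> n"
  shows "sing_degree f = fact (n - 2) * coeff (hilbert_polynomial (jacobian_ideal f)) (n - 2)"
proof -
  have "nat (int n - 2) = n - 2" by simp
  then show ?thesis using assms by (simp add: proj_degree_def Let_def)
qed

theorem free_hypersurface_singular_locus:
  fixes f :: "('n::{finite,linorder}) cpoly"
  assumes f: "hypersurface d f" and n: "CARD('n) = n + 1" "2 \<le> n"
    and rs: "minimal_generators f rs ds" "length rs = n"
  shows "(\<Sum>i<n. ds ! i) = d - 1" "sing_dimension f = int n - 2"
    "sing_degree f = (real d - 1) ^ 2 - pair_sum n (\<lambda>i. real (ds ! i))"
proof -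
  note gen = minimal_generatorsD[OF rs(1), unfolded rs(2)]
  have hom: "homogeneous d f" and d: "3 \<le> d" using f by (auto simp: hypersurface_def)
  let ?F = "free_hilbert_poly n (real (d - 1)) (\<lambda>i. real (ds ! i))"
  let ?J = "jacobian_ideal f"
  have F: "\<forall>t\<ge>(\<Sum>i<n. ds ! i). real (hilbert_function ?J (t + (d - 1))) = poly ?F (real t)"
  proof (intro allI impI)
    fix t assume t: "t \<ge> (\<Sum>i<n. ds ! i)"
    have dst: "ds ! k \<le> t" if "k < n" for k
      using member_le_sum[of k "{..<n}" "(!) ds"] that t by simp
    have D: "Homv t \<inter> D0 f = graded_combs {..<n} ((!) rs) t"
      unfolding graded_combs_def gen(3) by blast
    have "CV.dim (Homv t \<inter> D0 f) = (\<Sum>k<n. if ds ! k \<le> t then mon_count TYPE('n) (t - ds ! k) else 0)"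
      unfolding D using dim_graded_combs[of "{..<n}" "(!) ds" "(!) rs" t] gen(2)
        free_generators_independent[OF hom n(1) rs] by auto
    also have "\<dots> = (\<Sum>k<n. mon_count TYPE('n) (t - ds ! k))" by (rule sum.cong) (simp_all add: dst)
    finally have "real (hilbert_function ?J (t + (d - 1)) + CARD('n) * mon_count TYPE('n) t) =
      real (mon_count TYPE('n) (t + (d - 1)) + (\<Sum>k<n. mon_count TYPE('n) (t - ds ! k)))"
      using hilbert_function_jacobian[OF hom, of t] by simp
    moreover have "(\<Sum>k<n. real (mon_count TYPE('n) (t - ds ! k))) = (\<Sum>k<n. poly (binom_poly n) (real t - real (ds ! k)))"
      by (rule sum.cong) (simp_all add: mon_count_poly[OF n(1)] of_nat_diff dst)
    ultimately show "real (hilbert_function ?J (t + (d - 1))) = poly ?F (real t)"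
      by (simp add: free_hilbert_poly_def poly_sum poly_shift mon_count_poly[OF n(1)] n(1) algebra_simps)
  qed
  note hp = hilbert_polynomial_jacobian[OF f n F]
  have "coeff ?F (n - 1) = 0" using hp(2) n(2) by (intro coeff_eq_0) linarith
  moreover have "coeff ?F (n - 1) = (real (d - 1) - (\<Sum>i<n. real (ds ! i))) / fact (n - 1)"
    by (rule coeff_free_hilbert_poly_1) (use n in simp)
  ultimately have sum: "(\<Sum>i<n. real (ds ! i)) = real (d - 1)" by simp
  then have "real (\<Sum>i<n. ds ! i) = real (d - 1)" by simp
  then show "(\<Sum>i<n. ds ! i) = d - 1" by (simp only: of_nat_eq_iff)
  have c: "coeff ?F (n - 2) = (real (d - 1) ^ 2 - pair_sum n (\<lambda>i. real (ds ! i))) / fact (n - 2)"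
    by (rule coeff_free_hilbert_poly_2[OF n(2) sum])
  \<comment> \<open>As the exponents sum to d - 1, the difference is half of a sum of squares that
    contains (d - 1)^2.\<close>
  have "real (d - 1) ^ 2 - pair_sum n (\<lambda>i. real (ds ! i)) = (real (d - 1) ^ 2 + (\<Sum>i<n. real (ds ! i) ^ 2)) / 2"
    unfolding pair_sum_eq sum by (simp add: field_simps)
  also have "\<dots> > 0" using d by (simp add: add_pos_nonneg sum_nonneg)
  finally have "coeff ?F (n - 2) \<noteq> 0" unfolding c by simp
  then show dim: "sing_dimension f = int n - 2" by (rule hp(4))
  show "sing_degree f = (real d - 1) ^ 2 - pair_sum n (\<lambda>i. real (ds ! i))"
    unfolding sing_degree_eq[OF dim n(2)] hp(3) c using d by (simp add: of_nat_diff)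
qed

section \<open>The number of minimal generators\<close>

text \<open>Graded Nakayama: in the degree of the generator \<open>rs ! i\<close> its coefficient in
  the relation becomes the constant term of \<open>a i\<close>. Were it nonzero, the generator could
  be expressed by the others.\<close>

lemma minimal_generators_relation:
  assumes rs: "minimal_generators f rs ds" and rel: "(\<Sum>k<length rs. a k *s rs ! k) = 0" and i: "i < length rs"
  shows "coef (a i) 0 = 0"
proof (rule ccontr)
  assume nz: "coef (a i) 0 \<noteq> 0"
  note gen = minimal_generatorsD[OF rs]
  let ?K = "{..<length rs}"
  define b where "b k = (if ds ! k \<le> ds ! i then hcomp (ds ! i - ds ! k) (a k) else 0)" for k
  have "hcomp 0 (a i) = Const (coef (hcomp 0 (a i)) 0)" by (rule homogeneous_0_imp_Const) simp
  then have bi: "b i = Const (coef (a i) 0)" by (simp add: b_def coef_hcomp)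
  have "(\<Sum>k\<in>?K. b k *s rs ! k) = 0"
    unfolding b_def by (rule homogeneous_relation[OF _ rel]) (simp add: gen(2))
  then have rel': "b i *s rs ! i + (\<Sum>k\<in>?K - {i}. b k *s rs ! k) = 0"
    using i by (subst (asm) sum.remove[of _ i]) auto
  let ?R = "set rs - {rs ! i}"
  have dist: "distinct rs" and min: "\<And>R. R \<subset> set rs \<Longrightarrow> S_vec.span R \<noteq> D0 f" and span: "S_vec.span (set rs) = D0 f"
    using rs by (auto simp: minimal_generators_def)
  have "(\<Sum>k\<in>?K - {i}. b k *s rs ! k) \<in> S_vec.span ?R"
    using dist i by (intro S_vec.span_sum S_vec.span_scale S_vec.span_base) (auto simp: nth_eq_iff_index_eq)
  then have "- (\<Sum>k\<in>?K - {i}. b k *s rs ! k) \<in> S_vec.span ?R" by (rule S_vec.span_neg)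
  moreover have "b i *s rs ! i = - (\<Sum>k\<in>?K - {i}. b k *s rs ! k)" using rel' by (simp add: eq_neg_iff_add_eq_0)
  ultimately have "b i *s rs ! i \<in> S_vec.span ?R" by simp
  then have "Const (1 / coef (a i) 0) *s (b i *s rs ! i) \<in> S_vec.span ?R" by (rule S_vec.span_scale)
  also have "Const (1 / coef (a i) 0) *s (b i *s rs ! i) = rs ! i"
    unfolding bi smult_smult Const_mult[symmetric] using nz by simp
  finally have "set rs \<subseteq> S_vec.span ?R" using S_vec.span_superset[of ?R] by auto
  then have "S_vec.span (set rs) \<subseteq> S_vec.span ?R" by (rule S_vec.span_minimal) simp
  with S_vec.span_mono[of ?R "set rs", OF Diff_subset]
  have "S_vec.span ?R = S_vec.span (set rs)" by (rule subset_antisym)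
  then have "S_vec.span ?R = D0 f" by (rule trans[OF _ span])
  moreover have "rs ! i \<in> set rs" using i by (rule nth_mem)
  then have "?R \<subset> set rs" by blast
  note min[OF this]
  ultimately show False by contradiction
qed

text \<open>Writing each of the two systems in terms of the other gives matrices whose products
  in both orders have identity matrices as constant terms; compare traces.\<close>

lemma minimal_generators_length_unique:
  fixes f :: "('n::finite) cpoly"
  assumes rs: "minimal_generators f rs ds" and rs': "minimal_generators f rs' ds'"
  shows "length rs = length rs'"
proof -
  have express: "\<exists>A. \<forall>i<length xs. xs ! i = (\<Sum>j<length ys. A i j *s ys ! j)"
    if "minimal_generators f xs es" "minimal_generators f ys es'" for xs ys es es'
  proof -
    have "\<forall>i. \<exists>a. i < length xs \<longrightarrow> xs ! i = (\<Sum>j<length ys. a j *s ys ! j)"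
      using minimal_generatorsD(4)[OF that(1)] unfolding minimal_generatorsD(3)[OF that(2)] by blast
    then have "\<exists>A. \<forall>i. i < length xs \<longrightarrow> xs ! i = (\<Sum>j<length ys. A i j *s ys ! j)" by (rule choice)
    then show ?thesis by blast
  qed
  have trace: "(\<Sum>i<length xs. \<Sum>j<length ys. coef (A i j) 0 * coef (B j i) 0) = of_nat (length xs)"
    if xs: "minimal_generators f xs es" and A: "\<forall>i<length xs. xs ! i = (\<Sum>j<length ys. A i j *s ys ! j)"
      and B: "\<forall>j<length ys. ys ! j = (\<Sum>k<length xs. B j k *s xs ! k)" for xs ys es A B
  proof -
    have "(\<Sum>j<length ys. coef (A i j) 0 * coef (B j i) 0) = 1" if i: "i < length xs" for i
    proof -
      let ?a = "\<lambda>k. (\<Sum>j<length ys. A i j * B j k) - (if k = i then 1 else 0)"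
      have "(\<Sum>k<length xs. (\<Sum>j<length ys. A i j * B j k) *s xs ! k) =
          (\<Sum>j<length ys. A i j *s (\<Sum>k<length xs. B j k *s xs ! k))"
        unfolding smult_sum_right smult_smult
        by (subst sum.swap) (simp add: vec_eq_iff sum_distrib_right)
      also have "\<dots> = xs ! i" using A B i by simp
      finally have 1: "(\<Sum>k<length xs. (\<Sum>j<length ys. A i j * B j k) *s xs ! k) = xs ! i" .
      have "(\<Sum>k<length xs. (if k = i then 1 else 0) *s xs ! k) = (\<Sum>k<length xs. if k = i then xs ! k else 0)"
        by (rule sum.cong) (auto simp: vec_eq_iff)
      then have 2: "(\<Sum>k<length xs. (if k = i then 1 else 0) *s xs ! k) = xs ! i" using i by simp
      have "(\<Sum>k<length xs. ?a k *s xs ! k) = 0"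
        unfolding vector_sub_rdistrib sum_subtractf 1 2 by simp
      from minimal_generators_relation[OF xs this i] have "coef (?a i) 0 = 0" .
      then show ?thesis by (simp add: lookup_minus lookup_sum coef_0_mult)
    qed
    then show ?thesis by simp
  qed
  obtain A where A: "\<forall>i<length rs. rs ! i = (\<Sum>j<length rs'. A i j *s rs' ! j)" using express[OF rs rs'] by blast
  obtain B where B: "\<forall>j<length rs'. rs' ! j = (\<Sum>k<length rs. B j k *s rs ! k)" using express[OF rs' rs] by blast
  have "(of_nat (length rs) :: complex) = (\<Sum>i<length rs. \<Sum>j<length rs'. coef (A i j) 0 * coef (B j i) 0)"
    by (rule trace[OF rs A B, symmetric])
  also have "\<dots> = (\<Sum>j<length rs'. \<Sum>i<length rs. coef (B j i) 0 * coef (A i j) 0)"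
    by (subst sum.swap) (simp add: mult.commute)
  also have "\<dots> = of_nat (length rs')" by (rule trace[OF rs' B A])
  finally show ?thesis by (simp only: of_nat_eq_iff)
qed

section \<open>Ideals of large codimension contain unmixed coprime pairs\<close>

text \<open>A regular sequence of length two, written so that the unit pair \<open>1, 1\<close> is
  included.\<close>

definition coprime_pair :: "('n::{finite,linorder}) cpoly \<Rightarrow> 'n cpoly \<Rightarrow> bool" where
  "coprime_pair p r \<longleftrightarrow> p \<noteq> 0 \<and> r \<noteq> 0 \<and> (\<forall>b. p dvd b * r \<longrightarrow> p dvd b)"

lemma coprime_pair_cancel:
  assumes "coprime_pair p r" "a * p = b * r"
  shows "\<exists>c. b = p * c \<and> a = r * c"
proof -
  have "p dvd b * r" using assms(2) by (metis dvd_triv_right)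
  then obtain c where c: "b = p * c" using assms(1) unfolding coprime_pair_def dvd_def by blast
  have "p * a = p * (r * c)" using assms(2) by (simp add: c ac_simps)
  then have "a = r * c" using assms(1) by (simp add: coprime_pair_def)
  with c show ?thesis by blast
qed

definition ideal2 :: "'n cpoly \<Rightarrow> 'n cpoly \<Rightarrow> 'n cpoly set" where
  "ideal2 p r = {x * p + y * r | x y. True}"

lemma ideal2I: "z = x * p + y * r \<Longrightarrow> z \<in> ideal2 p r"
  unfolding ideal2_def by blast

lemma subspace_ideal2: "S_ideal.subspace (ideal2 p r)"
proof (rule S_ideal.subspaceI)
  show "0 \<in> ideal2 p r" by (rule ideal2I[of _ 0 _ 0]) simp
  fix z w c assume "z \<in> ideal2 p r"
  then obtain x y where z: "z = x * p + y * r" by (auto simp: ideal2_def)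
  show "c * z \<in> ideal2 p r" by (rule ideal2I[of _ "c * x" _ "c * y"]) (simp add: z algebra_simps)
  assume "w \<in> ideal2 p r"
  then obtain x' y' where w: "w = x' * p + y' * r" by (auto simp: ideal2_def)
  show "z + w \<in> ideal2 p r" by (rule ideal2I[of _ "x + x'" _ "y + y'"]) (simp add: z w algebra_simps)
qed

text \<open>For a regular sequence p, r in I the quotient ((p, r) : I)/(p, r) is Ext^2(S/I, S), that
  is, Ext^1(I, S). The last condition therefore states the vanishing that splits the
  sequence.\<close>

definition good_pair :: "('n::{finite,linorder}) cpoly set \<Rightarrow> 'n cpoly \<Rightarrow> 'n cpoly \<Rightarrow> bool" where
  "good_pair I p r \<longleftrightarrow> p \<in> I \<and> r \<in> I \<and> coprime_pair p r \<and>
     (\<forall>\<phi>. (\<forall>c\<in>I. c * \<phi> \<in> ideal2 p r) \<longrightarrow> \<phi> \<in> ideal2 p r)"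

text \<open>If \<open>c \<phi> = \<alpha>\<^sub>c p + \<beta>\<^sub>c r\<close> for all \<open>c \<in> I\<close>, then \<open>e \<alpha>\<^sub>c - c \<alpha>\<^sub>e = r \<tau>\<^sub>c\<^sub>e\<close> and
  \<open>c \<beta>\<^sub>e - e \<beta>\<^sub>c = p \<tau>\<^sub>c\<^sub>e\<close> for a cocycle \<open>\<tau>\<close>, which is a coboundary since \<open>I\<close> contains a good pair.\<close>

lemma good_pair_transfer:
  assumes pr: "coprime_pair p r" and good: "good_pair I p' r'"
    and kill: "\<And>c. c \<in> I \<Longrightarrow> c * \<phi> \<in> ideal2 p r"
  shows "\<phi> \<in> ideal2 p r"
proof -
  have p0: "p \<noteq> 0" "r \<noteq> 0" using pr by (auto simp: coprime_pair_def)
  have g: "p' \<in> I" "r' \<in> I" "coprime_pair p' r'"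
    and gu: "\<And>\<psi>. (\<And>c. c \<in> I \<Longrightarrow> c * \<psi> \<in> ideal2 p' r') \<Longrightarrow> \<psi> \<in> ideal2 p' r'"
    using good by (auto simp: good_pair_def)
  have "\<forall>c. \<exists>xy. c \<in> I \<longrightarrow> c * \<phi> = fst xy * p + snd xy * r"
  proof
    fix c
    show "\<exists>xy. c \<in> I \<longrightarrow> c * \<phi> = fst xy * p + snd xy * r"
    proof (cases "c \<in> I")
      case True
      then obtain x y where "c * \<phi> = x * p + y * r" using kill[OF True] by (auto simp: ideal2_def)
      then show ?thesis by (intro exI[of _ "(x, y)"]) simp
    qed simp
  qed
  from choice[OF this] obtain h where h: "\<And>c. c \<in> I \<Longrightarrow> c * \<phi> = fst (h c) * p + snd (h c) * r" by blast
  define \<alpha> \<beta> where "\<alpha> c = fst (h c)" and "\<beta> c = snd (h c)" for c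
  have ab: "c * \<phi> = \<alpha> c * p + \<beta> c * r" if "c \<in> I" for c using h[OF that] by (simp add: \<alpha>_def \<beta>_def)
  have cocycle: "\<exists>\<tau>. c * \<beta> e - e * \<beta> c = p * \<tau> \<and> e * \<alpha> c - c * \<alpha> e = r * \<tau>" if "c \<in> I" "e \<in> I" for c e
  proof (rule coprime_pair_cancel[OF pr])
    have "e * (\<alpha> c * p + \<beta> c * r) = c * (\<alpha> e * p + \<beta> e * r)"
      using ab[OF that(1)] ab[OF that(2)] by (metis mult.left_commute)
    then show "(e * \<alpha> c - c * \<alpha> e) * p = (c * \<beta> e - e * \<beta> c) * r"
      by (simp add: algebra_simps)
  qed
  obtain \<tau> where \<tau>: "p' * \<beta> r' - r' * \<beta> p' = p * \<tau>" "r' * \<alpha> p' - p' * \<alpha> r' = r * \<tau>"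
    using cocycle[OF g(1,2)] by blast
  have "\<tau> \<in> ideal2 p' r'"
  proof (rule gu)
    fix c assume c: "c \<in> I"
    obtain t1 where t1: "c * \<alpha> p' - p' * \<alpha> c = r * t1" using cocycle[OF g(1) c] by blast
    obtain t2 where t2: "c * \<alpha> r' - r' * \<alpha> c = r * t2" using cocycle[OF g(2) c] by blast
    have "r * (c * \<tau>) = c * (r' * \<alpha> p' - p' * \<alpha> r')" unfolding \<tau>(2) by (simp add: ac_simps)
    also have "\<dots> = r' * (c * \<alpha> p' - p' * \<alpha> c) - p' * (c * \<alpha> r' - r' * \<alpha> c)" by (simp add: algebra_simps)
    also have "\<dots> = r * (r' * t1 - p' * t2)" unfolding t1 t2 by (simp add: algebra_simps)
    finally have "c * \<tau> = r' * t1 - p' * t2" using p0 by simp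
    then show "c * \<tau> \<in> ideal2 p' r'" by (intro ideal2I[of _ "- t2" _ t1]) (simp add: algebra_simps)
  qed
  then obtain x y where xy: "\<tau> = x * p' + y * r'" by (auto simp: ideal2_def)
  \<comment> \<open>Correcting \<alpha> and \<beta> by the coboundary makes their values at
    \<open>p'\<close> divisible by \<open>p'\<close>; cancelling \<open>p'\<close> then displays
    \<phi> as a combination of \<open>p\<close> and \<open>r\<close>.\<close>
  have "(\<alpha> r' + r * x) * p' = (\<alpha> p' - r * y) * r'" using \<tau>(2) unfolding xy by (simp add: algebra_simps)
  from coprime_pair_cancel[OF g(3) this] obtain a where a: "\<alpha> p' - r * y = p' * a" by blast
  have "(\<beta> r' - p * x) * p' = (\<beta> p' + p * y) * r'" using \<tau>(1) unfolding xy by (simp add: algebra_simps)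
  from coprime_pair_cancel[OF g(3) this] obtain b where b: "\<beta> p' + p * y = p' * b" by blast
  have "p' * \<phi> = \<alpha> p' * p + \<beta> p' * r" by (rule ab[OF g(1)])
  also have "\<dots> = (\<alpha> p' - r * y) * p + (\<beta> p' + p * y) * r" by (simp add: algebra_simps)
  also have "\<dots> = p' * (a * p + b * r)" unfolding a b by (simp add: algebra_simps)
  finally have "\<phi> = a * p + b * r" using g(3) by (simp add: coprime_pair_def)
  then show ?thesis by (rule ideal2I)
qed

text \<open>Induction on the prime factors of \<open>p = \<pi> * p'\<close>. If \<open>r\<close>
  avoids the primes of \<open>p'\<close> but is divisible by \<pi>, then \<pi> does not divide
  \<open>p'\<close>, and adding \<open>p' * y\<close> with \<open>y\<close> not divisible by \<pi>
  repairs this without harming the others. The set \<open>A\<close> is only closed under such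
  additions because it will be an ideal intersected with a subring.\<close>

lemma prime_avoidance:
  fixes p :: "('n::{finite,linorder}) cpoly"
  assumes "p \<noteq> 0" "A \<noteq> {}" "\<And>r y q. r \<in> A \<Longrightarrow> y \<in> A \<Longrightarrow> q dvd p \<Longrightarrow> r + q * y \<in> A"
    and "\<And>g. prime_elem g \<Longrightarrow> g dvd p \<Longrightarrow> \<exists>y\<in>A. \<not> g dvd y"
  shows "\<exists>r\<in>A. \<forall>g. prime_elem g \<longrightarrow> g dvd p \<longrightarrow> \<not> g dvd r"
  using assms
proof (induction "tdeg p" arbitrary: p rule: less_induct)
  case less
  show ?case
  proof (cases "p dvd 1")
    case True
    then have "\<not> g dvd p" if "prime_elem g" for g using that by (metis dvd_trans prime_elem_def)
    then show ?thesis using less.prems(2) by blast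
  next
    case False
    from prime_factor_exists[OF less.prems(1) False] obtain \<pi> p' where \<pi>: "prime_elem \<pi>" "p = \<pi> * p'"
      by (auto simp: dvd_def)
    have p': "p' \<noteq> 0" "tdeg p' < tdeg p" using less.prems(1) \<pi> tdeg_prime_mult[OF \<pi>(1), of p'] by auto
    have dvd: "q dvd p" if "q dvd p'" for q using that \<pi>(2) by simp
    obtain r where r: "r \<in> A" "\<And>g. prime_elem g \<Longrightarrow> g dvd p' \<Longrightarrow> \<not> g dvd r"
      using less.hyps[OF p'(2,1) less.prems(2)] less.prems(3,4) dvd by metis
    have assoc: "\<pi> dvd g" if g: "prime_elem g" "g dvd \<pi>" for g
    proof -
      obtain u where u: "\<pi> = g * u" using g(2) by (auto simp: dvd_def)
      have "\<pi> dvd g \<or> \<pi> dvd u" using \<pi>(1) u by (metis dvd_refl prime_elem_def)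
      moreover have "\<not> \<pi> dvd u"
      proof
        assume "\<pi> dvd u"
        then obtain w where "u = \<pi> * w" by (auto simp: dvd_def)
        then have "\<pi> * 1 = \<pi> * (g * w)" using u by (simp add: ac_simps)
        then have "1 = g * w" using \<pi>(1) by (metis mult_left_cancel prime_elem_def)
        then show False using g(1) by (metis dvd_triv_left prime_elem_def)
      qed
      ultimately show ?thesis by blast
    qed
    show ?thesis
    proof (cases "\<pi> dvd r")
      case False
      have "\<not> g dvd r" if g: "prime_elem g" "g dvd p" for g
      proof
        assume gr: "g dvd r"
        have "g dvd \<pi> \<or> g dvd p'" using g \<pi>(2) by (simp add: prime_elem_dvd_mult_iff)
        then show False using r(2)[OF g(1)] gr assoc[OF g(1)] False dvd_trans by blast
      qed
      then show ?thesis using r(1) by blast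
    next
      case True
      then have np: "\<not> \<pi> dvd p'" using r(2)[OF \<pi>(1)] by blast
      obtain y where y: "y \<in> A" "\<not> \<pi> dvd y" using less.prems(4)[OF \<pi>(1)] \<pi>(2) by auto
      have "\<not> g dvd r + p' * y" if g: "prime_elem g" "g dvd p" for g
      proof
        assume gr: "g dvd r + p' * y"
        have "g dvd \<pi> \<or> g dvd p'" using g \<pi>(2) by (simp add: prime_elem_dvd_mult_iff)
        then show False
        proof
          assume "g dvd p'"
          then have "g dvd p' * y" by simp
          then have "g dvd r" using gr by (simp add: dvd_add_left_iff)
          then show False using r(2)[OF g(1) \<open>g dvd p'\<close>] by blast
        next
          assume "g dvd \<pi>"
          from assoc[OF g(1) this] gr have "\<pi> dvd r + p' * y" by (rule dvd_trans)
          then have "\<pi> dvd p' * y" using True by (simp add: dvd_add_right_iff)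
          then show False using \<pi>(1) np y(2) by (simp add: prime_elem_dvd_mult_iff)
        qed
      qed
      moreover have "r + p' * y \<in> A" using less.prems(3)[OF r(1) y(1)] dvd by simp
      ultimately show ?thesis by blast
    qed
  qed
qed

lemma xcoef_ideal2:
  assumes "deg_in i p = 0" "deg_in i r = 0" "x \<in> ideal2 p r"
  shows "xcoef i k x \<in> ideal2 p r"
proof -
  obtain a b where x: "x = a * p + b * r" using assms(3) by (auto simp: ideal2_def)
  have "x = p * a + r * b" unfolding x by (simp only: mult.commute)
  then have "xcoef i k x = p * xcoef i k a + r * xcoef i k b"
    by (simp only: xcoef_add xcoef_mult_left[OF assms(1)] xcoef_mult_left[OF assms(2)])
  also have "\<dots> = xcoef i k a * p + xcoef i k b * r" by (simp only: mult.commute)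
  finally show ?thesis by (rule ideal2I)
qed

text \<open>McCoy's argument: if \<open>I\<close> kills a polynomial \<open>\<phi>\<close> in \<open>x\<^sub>i\<close> modulo \<open>(p, r)\<close>, then so do all the
  \<open>x\<^sub>i\<close>-coefficients of elements of \<open>I\<close>, by induction on the degree of \<open>\<phi>\<close>.\<close>

lemma kills_of_xcoef_kills:
  fixes I :: "('n::{finite,linorder}) cpoly set"
  assumes pr: "deg_in i p = 0" "deg_in i r = 0"
    and coeffs: "\<And>\<phi>. (\<And>c k. c \<in> I \<Longrightarrow> xcoef i k c * \<phi> \<in> ideal2 p r) \<Longrightarrow> \<phi> \<in> ideal2 p r"
    and kill: "\<And>c. c \<in> I \<Longrightarrow> c * \<phi> \<in> ideal2 p r"
  shows "\<phi> \<in> ideal2 p r"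
  using kill
proof (induction "deg_in i \<phi>" arbitrary: \<phi> rule: less_induct)
  case (less \<phi>)
  note sub = subspace_ideal2[of p r]
  define d where "d = deg_in i \<phi>"
  define l where "l = xcoef i d \<phi>"
  define \<eta> where "\<eta> = \<phi> - l * Var i ^ d"
  have xl: "xpoly i l = [:l:]" by (simp add: l_def flip: deg_in_0_iff)
  have x\<eta>: "xpoly i \<eta> = xpoly i \<phi> - monom l d"
    unfolding \<eta>_def xpoly_diff xpoly_mult xl xpoly_Var_power const_mult by (simp add: smult_monom)
  have deg\<eta>: "deg_in i \<eta> < d" if "\<eta> \<noteq> 0"
  proof -
    have "deg_in i \<eta> \<le> d" unfolding x\<eta> d_def by (intro degree_diff_le degree_monom_le order_refl)
    moreover have "coeff (xpoly i \<eta>) d = 0" unfolding x\<eta> by (simp add: coeff_xpoly l_def)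
    moreover have "coeff (xpoly i \<eta>) (deg_in i \<eta>) \<noteq> 0" using that by simp
    ultimately show ?thesis by (metis le_neq_implies_less)
  qed
  show ?case
  proof (rule coeffs)
    fix c k assume c: "c \<in> I"
    show "xcoef i k c * \<phi> \<in> ideal2 p r"
    \<comment> \<open>Downward in \<open>k\<close>, starting above the degree of \<open>c\<close>,
      where the coefficient is 0.\<close>
    proof (induction "deg_in i c + 1 - k" arbitrary: k rule: less_induct)
      case inner: (less k)
      show ?case
      proof (cases "k \<le> deg_in i c")
        case False
        then show ?thesis using S_ideal.subspace_0[OF sub] by (simp add: xcoef_eq_0)
      next
        case True
        have IH: "xcoef i j c * \<phi> \<in> ideal2 p r" if "j > k" for j
          by (rule inner.hyps) (use that True in linarith)
        define a where "a = xcoef i k c"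
        have da: "deg_in i a = 0" by (simp add: a_def)
        let ?rest = "\<Sum>j\<in>{..k+d} - {k}. xcoef i j c * xcoef i (k + d - j) \<phi>"
        have split: "xcoef i (k + d) (c * \<phi>) = a * l + ?rest"
          unfolding xcoef_mult a_def l_def by (subst sum.remove[of _ k]) auto
        have "?rest \<in> ideal2 p r"
        proof (rule S_ideal.subspace_sum[OF sub])
          fix j assume j: "j \<in> {..k+d} - {k}"
          show "xcoef i j c * xcoef i (k + d - j) \<phi> \<in> ideal2 p r"
          proof (cases "j > k")
            case True
            have "xcoef i (k + d - j) (xcoef i j c * \<phi>) \<in> ideal2 p r" by (rule xcoef_ideal2[OF pr IH[OF True]])
            then show ?thesis by (simp add: xcoef_mult_left)
          next
            case False
            then have "xcoef i (k + d - j) \<phi> = 0" using j by (intro xcoef_eq_0) (auto simp: d_def)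
            then show ?thesis using S_ideal.subspace_0[OF sub] by simp
          qed
        qed
        from S_ideal.subspace_diff[OF sub xcoef_ideal2[OF pr less.prems[OF c], of "k + d"] this]
        have al: "a * l \<in> ideal2 p r" unfolding split by (simp only: add_diff_cancel_right')
        \<comment> \<open>\<open>a * \<eta>\<close> has smaller degree in \<open>Var i\<close> than
          \<phi> and is still killed by \<open>I\<close>, because \<open>a * l\<close> is already in
          \<open>(p, r)\<close>: the outer induction applies.\<close>
        have "a * \<eta> \<in> ideal2 p r"
        proof (cases "a * \<eta> = 0")
          case True
          then show ?thesis by (simp only: S_ideal.subspace_0[OF sub])
        next
          case False
          then have "a \<noteq> 0" "\<eta> \<noteq> 0" by auto
          then have "deg_in i (a * \<eta>) < deg_in i \<phi>" using deg\<eta> by (simp add: deg_in_mult da d_def)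
          then show ?thesis
          proof (rule less.hyps)
            fix e assume e: "e \<in> I"
            have "e * (a * \<eta>) = a * (e * \<phi>) - (e * Var i ^ d) * (a * l)" by (simp add: \<eta>_def algebra_simps)
            then show "e * (a * \<eta>) \<in> ideal2 p r"
              using S_ideal.subspace_diff[OF sub ideal_mult[OF sub less.prems[OF e], of a] ideal_mult[OF sub al, of "e * Var i ^ d"]]
              by simp
          qed
        qed
        from S_ideal.subspace_add[OF sub this ideal_mult[OF sub al, of "Var i ^ d"]]
        show ?thesis unfolding a_def[symmetric] by (simp add: \<eta>_def algebra_simps)
      qed
    qed
  qed
qed

text \<open>The hypothesis is the trace of codimension at least 3: \<open>I\<close> has nonzero
  elements in all but any two of the variables of \<open>V\<close>. It passes from \<open>I\<close>
  to the ideal \<open>C\<close> of all coefficients with respect to one variable \<open>i\<close>,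
  with \<open>V - {i}\<close> in place of \<open>V\<close>. So \<open>C\<close> has a good pair,
  \<open>good_pair_transfer\<close> carries its property to a coprime pair of \<open>I\<close> free
  of \<open>Var i\<close>, and McCoy's argument leads from \<open>C\<close> back to
  \<open>I\<close>.\<close>

lemma good_pair_exists:
  fixes I :: "('n::{finite,linorder}) cpoly set"
  assumes "S_ideal.subspace I" "\<And>W. W \<subseteq> V \<Longrightarrow> card V \<le> card W + 2 \<Longrightarrow> \<exists>p\<in>I. p \<noteq> 0 \<and> p \<in> Svars W"
  shows "\<exists>p r. good_pair I p r"
  using assms
proof (induction "card V" arbitrary: V I rule: less_induct)
  case less
  note sub = less.prems(1)
  have finV: "finite V" by simp
  show ?case
  proof (cases "card V \<le> 2")
    case True
    then obtain p where p: "p \<in> I" "p \<noteq> 0" "p \<in> Svars {}" using less.prems(2)[of "{}"] by auto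
    then have "p dvd 1" using unit_iff_Svars_empty by blast
    then obtain q where "1 = q * p" by (metis dvdE mult.commute)
    then have 1: "1 \<in> I" using ideal_mult[OF sub p(1)] by metis
    have "x \<in> ideal2 1 1" for x :: "'n cpoly" by (rule ideal2I[of _ x _ 0]) simp
    then have "good_pair I 1 1" using 1 by (simp add: good_pair_def coprime_pair_def)
    then show ?thesis by blast
  next
    case False
    then obtain i where i: "i \<in> V" by fastforce
    define V' where "V' = V - {i}"
    have cV': "card V = card V' + 1" unfolding V'_def using i False by (simp add: card_Diff_singleton)
    then have "V' \<noteq> {}" using False by auto
    then obtain j where j: "j \<in> V'" by blast
    define C where "C = S_ideal.span {xcoef i k c | k c. c \<in> I}"
    have "\<exists>p\<in>C. p \<noteq> 0 \<and> p \<in> Svars W" if W: "W \<subseteq> V'" "card V' \<le> card W + 2" for W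
    proof -
      have iW: "i \<notin> W" using W(1) by (auto simp: V'_def)
      have "card V \<le> card (insert i W) + 2" using W(2) cV' iW by simp
      moreover have "insert i W \<subseteq> V" using W(1) i by (auto simp: V'_def)
      ultimately obtain p where p: "p \<in> I" "p \<noteq> 0" "p \<in> Svars (insert i W)" using less.prems(2)[of "insert i W"] by blast
      have "xcoef i (deg_in i p) p \<noteq> 0" using p(2) unfolding coeff_xpoly[symmetric] by simp
      moreover have "xcoef i (deg_in i p) p \<in> C" unfolding C_def by (rule S_ideal.span_base) (use p(1) in blast)
      moreover have "xcoef i (deg_in i p) p \<in> Svars W" by (rule Svars_xcoef_insert[OF p(3) iW])
      ultimately show ?thesis by blast
    qed
    moreover have "S_ideal.subspace C" unfolding C_def by (rule S_ideal.subspace_span)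
    ultimately obtain p' r' where good: "good_pair C p' r'" using less.hyps[of V' C] cV' by auto
    define A where "A = I \<inter> Svars V'"
    have "card (V - {i, j}) + 2 = card V"
      using i j finV False by (subst card_Diff_subset) (auto simp: V'_def)
    then obtain p where p: "p \<in> I" "p \<noteq> 0" "p \<in> Svars (V - {i, j})" using less.prems(2)[of "V - {i, j}"] by auto
    have pA: "p \<in> A" using p(1) Svars_mono[OF _ p(3), of V'] by (auto simp: A_def V'_def)
    have pV': "p \<in> Svars V'" using pA by (simp add: A_def)
    have "\<exists>r\<in>A. \<forall>g. prime_elem g \<longrightarrow> g dvd p \<longrightarrow> \<not> g dvd r"
    proof (rule prime_avoidance[OF p(2)])
      show "A \<noteq> {}" using pA by blast
      fix r y q assume *: "r \<in> A" "y \<in> A" "q dvd p"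
      have "q \<in> Svars V'" using Svars_dvd[OF *(3) p(2) pV'] .
      then show "r + q * y \<in> A" using * S_ideal.subspace_add[OF sub] ideal_mult[OF sub, of y q]
        by (auto simp: A_def intro: Svars_add Svars_mult)
    next
      \<comment> \<open>Being no unit, \<open>g\<close> involves some variable \<open>k\<close>
        other than \<open>i\<close>, so it cannot divide a nonzero element of \<open>I\<close> that
        is free of \<open>Var i\<close> and \<open>Var k\<close>.\<close>
      fix g assume g: "prime_elem g" "g dvd p"
      have gW: "g \<in> Svars (V - {i, j})" using Svars_dvd[OF g(2) p(2,3)] .
      have "g \<noteq> 0" "\<not> g dvd 1" using g(1) by (auto simp: prime_elem_def)
      then have "g \<notin> Svars {}" using unit_iff_Svars_empty by blast
      then obtain k where k: "deg_in k g \<noteq> 0" by (auto simp: Svars_def)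
      then have kV: "k \<in> V" "k \<noteq> i" using gW by (auto simp: Svars_def)
      have "card (V - {i, k}) + 2 = card V"
        using i kV finV False by (subst card_Diff_subset) auto
      then obtain y where y: "y \<in> I" "y \<noteq> 0" "y \<in> Svars (V - {i, k})" using less.prems(2)[of "V - {i, k}"] by auto
      have "y \<in> A" using y(1) Svars_mono[OF _ y(3), of V'] by (auto simp: A_def V'_def)
      moreover have "\<not> g dvd y"
      proof
        assume "g dvd y"
        then have "g \<in> Svars (V - {i, k})" using Svars_dvd y(2,3) by blast
        then show False using SvarsD[of g "V - {i, k}" k] k by simp
      qed
      ultimately show "\<exists>y\<in>A. \<not> g dvd y" by blast
    qed
    then obtain r0 where r0: "r0 \<in> A" "\<And>g. prime_elem g \<Longrightarrow> g dvd p \<Longrightarrow> \<not> g dvd r0" by blast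
    \<comment> \<open>\<open>r0 = 0\<close> is possible only if \<open>p\<close> has no prime
      factor; then \<open>p\<close> is a unit and may be repeated.\<close>
    define r where "r = (if r0 = 0 then p else r0)"
    have unit: "p dvd 1" if "r0 = 0" using r0(2) prime_factor_exists[OF p(2)] that by fastforce
    have r: "r \<in> A" "r \<noteq> 0" using r0(1) pA p(2) by (auto simp: r_def)
    have "\<not> g dvd r" if g: "prime_elem g" "g dvd p" for g
    proof (cases "r0 = 0")
      case True
      then have "g dvd 1" using unit g(2) dvd_trans by blast
      then show ?thesis using g(1) by (simp add: prime_elem_def)
    next
      case False
      then show ?thesis using r0(2)[OF g] by (simp add: r_def)
    qed
    then have cop: "coprime_pair p r"
      unfolding coprime_pair_def using p(2) r(2) dvd_of_no_common_prime[OF p(2)] by blast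
    have free: "deg_in i p = 0" "deg_in i r = 0"
      using pV' r(1) SvarsD[of _ V' i] by (auto simp: A_def V'_def)
    have "\<phi> \<in> ideal2 p r" if kill: "\<And>c. c \<in> I \<Longrightarrow> c * \<phi> \<in> ideal2 p r" for \<phi>
    proof (rule kills_of_xcoef_kills[OF free _ kill])
      fix \<psi> assume \<psi>: "\<And>c k. c \<in> I \<Longrightarrow> xcoef i k c * \<psi> \<in> ideal2 p r"
      show "\<psi> \<in> ideal2 p r"
      proof (rule good_pair_transfer[OF cop good])
        fix c assume "c \<in> C"
        then show "c * \<psi> \<in> ideal2 p r"
          unfolding C_def
        proof (induction rule: S_ideal.span_induct_alt)
          case base
          then show ?case using S_ideal.subspace_0[OF subspace_ideal2] by simp
        next
          case (step e x y)
          then obtain k b where "x = xcoef i k b" "b \<in> I" by blast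
          then have "e * (x * \<psi>) \<in> ideal2 p r" using \<psi> ideal_mult[OF subspace_ideal2] by blast
          from S_ideal.subspace_add[OF subspace_ideal2 this step(2)]
          show ?case by (simp add: distrib_right mult.assoc)
        qed
      qed
    qed
    then have "good_pair I p r" using p(1) r(1) cop by (auto simp: good_pair_def A_def)
    then show ?thesis by blast
  qed
qed

section \<open>Tame hypersurfaces\<close>

lemma det_replace_row_comb:
  fixes A :: "'a::comm_ring_1^'n^'n"
  shows "det (\<chi> i. if i = k then \<Sum>l\<in>UNIV. x l *s row l A else row i A) = x k * det A"
proof -
  have "det (\<chi> i. if i = k then \<Sum>l\<in>UNIV. x l *s row l A else row i A) =
      (\<Sum>l\<in>UNIV. det (\<chi> i. if i = k then x l *s row l A else row i A))"
    by (rule det_linear_row_sum) simp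
  also have "\<dots> = (\<Sum>l\<in>UNIV. if l = k then x k * det A else 0)"
  proof (rule sum.cong)
    fix l
    have "det (\<chi> i. if i = k then x l *s row l A else row i A) = x l * det (\<chi> i. if i = k then row l A else row i A)"
      by (rule det_row_mul)
    also have "det (\<chi> i. if i = k then row l A else row i A) = (if l = k then det A else 0)"
    proof (cases "l = k")
      case True
      have "(\<chi> i. if i = k then row l A else row i A) = A" by (simp add: vec_eq_iff row_def True)
      then show ?thesis using True by simp
    next
      case False
      have "det (\<chi> i. if i = k then row l A else row i A) = 0"
        by (rule det_identical_rows[of k l]) (use False in \<open>auto simp: row_def vec_eq_iff\<close>)
      then show ?thesis using False by simp
    qed
    finally show "det (\<chi> i. if i = k then x l *s row l A else row i A) = (if l = k then x k * det A else 0)" by simp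
  qed simp
  also have "\<dots> = x k * det A" by simp
  finally show ?thesis .
qed

lemma homogeneous_prod:
  "(\<And>i. i \<in> A \<Longrightarrow> homogeneous (\<delta> i) (g i)) \<Longrightarrow> homogeneous (\<Sum>i\<in>A. \<delta> i) (\<Prod>i\<in>A. g i)"
proof (induction A rule: infinite_finite_induct)
  case (infinite A)
  then show ?case using homogeneous_Const[of 1] by simp
next
  case empty
  then show ?case using homogeneous_Const[of 1] by simp
next
  case (insert x A)
  then show ?case by (simp add: homogeneous_mult)
qed

lemma homogeneous_det:
  fixes A :: "(('n::finite) cpoly ^ 'n) ^ 'n"
  assumes "\<And>i. homogeneous_vec (\<delta> i) (A $ i)"
  shows "homogeneous (\<Sum>i\<in>UNIV. \<delta> i) (det A)"
  unfolding det_def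
proof (rule homogeneous_sum)
  fix p
  have "homogeneous (\<Sum>i\<in>UNIV. \<delta> i) (\<Prod>i\<in>UNIV. A $ i $ p i)"
    by (rule homogeneous_prod) (use assms in \<open>simp add: homogeneous_vec_def\<close>)
  moreover have "(of_int (sign p) :: 'n cpoly) = Const (of_int (sign p))"
    by (simp add: Const_def)
  ultimately show "homogeneous (\<Sum>i\<in>UNIV. \<delta> i) (of_int (sign p) * (\<Prod>i\<in>UNIV. A $ i $ p i))"
    using homogeneous_Const_mult by metis
qed

lemma bij_betw_card_lessThan: "bij_betw (\<lambda>i :: 'n::{finite,linorder}. card {..<i}) UNIV {..<CARD('n)}"
proof -
  have "card {..<i} < card {..<j}" if "i < j" for i j :: 'n
    by (rule psubset_card_mono) (use that in auto)
  then have inj: "inj (\<lambda>i :: 'n. card {..<i})"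
    by (intro injI) (metis less_irrefl neqE)
  have "card {..<i} < CARD('n)" for i :: 'n by (rule psubset_card_mono) auto
  then have "range (\<lambda>i :: 'n. card {..<i}) \<subseteq> {..<CARD('n)}" by blast
  moreover have "card (range (\<lambda>i :: 'n. card {..<i})) = CARD('n)" by (rule card_image[OF inj])
  ultimately have "range (\<lambda>i :: 'n. card {..<i}) = {..<CARD('n)}" by (intro card_subset_eq) auto
  then show ?thesis using inj by (simp add: bij_betw_def)
qed

text \<open>\<open>rs\<close> consists of just the n - 1 syzygies of the tame sequence, whereas
  \<open>ds\<close> may be the list of all exponents, constrained in its first n - 1
  entries.\<close>

locale tame_hypersurface =
  fixes f :: "('n::{finite,linorder}) cpoly" and d n :: nat and rs :: "'n cpoly_vec list" and ds :: "nat list"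
  assumes hyp: "hypersurface d f" and card: "CARD('n) = n + 1" and n2: "2 \<le> n"
    and len: "length rs = n - 1"
    and hom_rs: "\<And>k. k < n - 1 \<Longrightarrow> homogeneous_vec (ds ! k) (rs ! k)"
    and rs_D0: "\<And>k. k < n - 1 \<Longrightarrow> rs ! k \<in> D0 f"
    and tame: "tame f rs"
begin

lemma f: "homogeneous d f" "squarefree f" "3 \<le> d" "f \<noteq> 0"
  using hyp by (auto simp: hypersurface_def)

definition s0 :: nat where "s0 = (\<Sum>k<n - 1. ds ! k)"

definition cofactor :: "'n \<Rightarrow> 'n cpoly" where
  "cofactor j = det (syzygy_matrix rs (axis j 1))"

text \<open>The determinant as a function of its last row, which equals \<open>f\<close> times
  \<open>v\<close> on \<open>D0 f\<close>. Unlike \<open>v\<close>, it is linear on all of S^(n+1)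
  and so fits rank and nullity.\<close>

definition phi :: "'n cpoly_vec \<Rightarrow> 'n cpoly" where
  "phi \<rho> = (\<Sum>j\<in>UNIV. \<rho> $ j * cofactor j)"

abbreviation v where "v \<equiv> v_map f rs"

abbreviation pos :: "'n \<Rightarrow> nat" where "pos i \<equiv> card {..<i}"

lemma pos_bij: "bij_betw pos UNIV {..n}"
  using bij_betw_card_lessThan[where 'n = 'n] by (simp add: card lessThan_Suc_atMost)

lemma pos_le: "pos i \<le> n"
  using pos_bij by (auto simp: bij_betw_def)

lemma pos_inj: "pos i = pos j \<Longrightarrow> i = j"
  using pos_bij by (auto simp: bij_betw_def dest: injD)

lemma row_cases:
  "syzygy_matrix rs \<rho> $ i = (if pos i = 0 then \<chi> j. Var j else if pos i = n then \<rho> else rs ! (pos i - 1))"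
proof -
  have "pos i - 1 < length rs" if "pos i \<noteq> 0" "pos i \<noteq> n"
    using that pos_le[of i] len by linarith
  then show ?thesis
    using len n2 by (auto simp: syzygy_matrix_def nth_Cons' nth_append)
qed

lemma det_syzygy_matrix: "det (syzygy_matrix rs \<rho>) = phi \<rho>"
proof -
  obtain l where l: "pos l = n" using pos_bij by (metis atMost_iff bij_betw_iff_bijections le_refl)
  have pl: "pos i = n \<longleftrightarrow> i = l" for i using l pos_inj by auto
  let ?c = "\<lambda>i. if pos i = 0 then \<chi> j. Var j else rs ! (pos i - 1)"
  have M: "syzygy_matrix rs \<rho> = (\<chi> i. if i = l then \<rho> else ?c i)" for \<rho>
  proof -
    have "syzygy_matrix rs \<rho> $ i = (if i = l then \<rho> else ?c i)" for i
    proof (cases "i = l")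
      case True
      then have n: "pos i = n" using l by metis
      then have "pos i \<noteq> 0" using n2 by linarith
      then show ?thesis unfolding row_cases if_P[OF True] if_P[OF n] by (rule if_not_P)
    next
      case False
      then have "pos i \<noteq> n" using pl by blast
      then show ?thesis unfolding row_cases if_not_P[OF False] by (simp only: if_False)
    qed
    then show ?thesis by (simp only: vec_eq_iff vec_lambda_beta) simp
  qed
  have \<rho>: "\<rho> = (\<Sum>j\<in>UNIV. \<rho> $ j *s axis j 1)" by (simp only: vec_eq_iff axis_sum, simp)
  have "det (syzygy_matrix rs \<rho>) = det (\<chi> i. if i = l then (\<Sum>j\<in>UNIV. \<rho> $ j *s axis j 1) else ?c i)"
    using M[of \<rho>] \<rho> by metis
  also have "\<dots> = (\<Sum>j\<in>UNIV. det (\<chi> i. if i = l then \<rho> $ j *s axis j 1 else ?c i))"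
    by (rule det_linear_row_sum) simp
  also have "\<dots> = (\<Sum>j\<in>UNIV. \<rho> $ j * cofactor j)"
    unfolding det_row_mul cofactor_def M ..
  finally show ?thesis by (simp only: phi_def)
qed

lemma homogeneous_cofactor: "homogeneous (1 + s0) (cofactor j)"
proof -
  \<comment> \<open>Degrees of the rows: 1 for the variables, 0 for the unit vector in the last row,
    and those of the syzygies between.\<close>
  let ?\<delta> = "\<lambda>k. if k = 0 then 1 else if k = n then 0 else ds ! (k - 1)"
  have "homogeneous_vec (?\<delta> (pos i)) (syzygy_matrix rs (axis j 1) $ i)" for i
  proof -
    have 1: "homogeneous_vec 1 (\<chi> j. Var j)"
      unfolding homogeneous_vec_def vec_lambda_beta by (intro allI homogeneous_Var)
    have 2: "homogeneous_vec 0 (axis j 1 :: 'n cpoly_vec)"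
      using homogeneous_Const[of 1] by (simp add: homogeneous_vec_def axis_def)
    have 3: "homogeneous_vec (ds ! (pos i - 1)) (rs ! (pos i - 1))" if "pos i \<noteq> 0" "pos i \<noteq> n"
      using that pos_le[of i] by (intro hom_rs) linarith
    show ?thesis
    proof (cases "pos i = 0")
      case True
      show ?thesis unfolding row_cases if_P[OF True] by (rule 1)
    next
      case a: False
      show ?thesis
      proof (cases "pos i = n")
        case True
        show ?thesis unfolding row_cases if_not_P[OF a] if_P[OF True] by (rule 2)
      next
        case False
        show ?thesis unfolding row_cases if_not_P[OF a] if_not_P[OF False] by (rule 3[OF a False])
      qed
    qed
  qed
  then have "homogeneous (\<Sum>i\<in>UNIV. ?\<delta> (pos i)) (cofactor j)" unfolding cofactor_def by (rule homogeneous_det)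
  also have "(\<Sum>i\<in>UNIV. ?\<delta> (pos i)) = (\<Sum>k\<in>{..n}. ?\<delta> k)"
    by (rule sum.reindex_bij_betw[OF pos_bij])
  also have "{..n} = insert 0 (insert n (Suc ` {..<n - 1}))"
    using n2 by (auto simp: image_iff) (metis Suc_pred' diff_less_mono lessThan_iff less_le not_gr_zero One_nat_def Suc_leI)
  also have "(\<Sum>k\<in>\<dots>. ?\<delta> k) = 1 + s0"
  proof -
    have "(\<Sum>k\<in>insert 0 (insert n (Suc ` {..<n - 1})). ?\<delta> k) = 1 + (\<Sum>k\<in>Suc ` {..<n - 1}. ?\<delta> k)"
      using n2 by (subst sum.insert; (subst sum.insert)?) auto
    also have "(\<Sum>k\<in>Suc ` {..<n - 1}. ?\<delta> k) = (\<Sum>k<n - 1. ?\<delta> (Suc k))"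
      by (subst sum.reindex) auto
    also have "\<dots> = s0" unfolding s0_def by (rule sum.cong) auto
    finally show ?thesis .
  qed
  finally show ?thesis .
qed

text \<open>Cramer's rule: the matrix maps the gradient of \<open>f\<close> to (d f, 0, ..., 0) by
  Euler's formula and the syzygy relations, so the determinant times any partial derivative is a
  multiple of \<open>f\<close>.\<close>

lemma f_dvd_phi:
  assumes "\<rho> \<in> D0 f"
  shows "f dvd phi \<rho>"
proof (rule dvd_of_dvd_mult_partials[OF f(2)])
  fix k
  let ?M = "syzygy_matrix rs \<rho>" and ?x = "\<lambda>j. partial_deriv j f"
  let ?w = "(\<chi> i. if pos i = 0 then of_nat d else 0) :: 'n cpoly_vec"
  have "(\<Sum>l\<in>UNIV. ?x l *s row l (transpose ?M)) = f *s ?w"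
  proof -
    have "(\<Sum>l\<in>UNIV. ?x l * ?M $ i $ l) = f * (if pos i = 0 then of_nat d else 0)" for i
    proof -
      consider "pos i = 0" | "pos i = n" "pos i \<noteq> 0" | "pos i \<noteq> 0" "pos i \<noteq> n" by blast
      then show ?thesis
      proof cases
        case 1
        then show ?thesis using euler_formula[OF f(1)] by (simp add: row_cases mult.commute)
      next
        case 2
        then show ?thesis using assms by (simp add: row_cases D0_def mult.commute)
      next
        case 3
        then have "rs ! (pos i - 1) \<in> D0 f" using pos_le[of i] by (intro rs_D0) linarith
        with 3 show ?thesis by (simp add: row_cases D0_def mult.commute)
      qed
    qed
    then show ?thesis by (simp add: vec_eq_iff row_def transpose_def)
  qed
  note comb = this
  let ?D = "det (\<chi> i. if i = k then ?w else row i (transpose ?M))"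
  have "f * ?D = det (\<chi> i. if i = k then f *s ?w else row i (transpose ?M))"
    by (rule det_row_mul[symmetric])
  also have "\<dots> = det (\<chi> i. if i = k then \<Sum>l\<in>UNIV. ?x l *s row l (transpose ?M) else row i (transpose ?M))"
    by (simp only: comb)
  also have "\<dots> = ?x k * det (transpose ?M)" by (rule det_replace_row_comb)
  also have "\<dots> = phi \<rho> * ?x k" by (simp add: det_syzygy_matrix mult.commute)
  finally have "phi \<rho> * ?x k = f * ?D" by (rule sym)
  then show "f dvd phi \<rho> * partial_deriv k f" by (rule dvdI)
qed

lemma v_mult: "\<rho> \<in> D0 f \<Longrightarrow> v \<rho> * f = phi \<rho>"
proof -
  assume "\<rho> \<in> D0 f"
  then obtain q where q: "q * f = phi \<rho>" using f_dvd_phi by (metis dvdE mult.commute)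
  have "v \<rho> = q"
    unfolding v_map_def det_syzygy_matrix
  proof (rule the_equality)
    fix r assume "r * f = phi \<rho>"
    then have "r * f = q * f" using q by simp
    then show "r = q" using f(4) by simp
  qed (rule q)
  with q show ?thesis by simp
qed

section \<open>Linearity of v, exactness in each degree, and splittings\<close>

lemma phi_add: "phi (\<rho> + \<sigma>) = phi \<rho> + phi \<sigma>"
  by (simp add: phi_def distrib_right sum.distrib)

lemma phi_smult: "phi (a *s \<rho>) = a * phi \<rho>"
  by (simp add: phi_def sum_distrib_left mult.assoc)

lemma D0_add: "\<rho> \<in> D0 f \<Longrightarrow> \<sigma> \<in> D0 f \<Longrightarrow> \<rho> + \<sigma> \<in> D0 f"
  by (simp add: D0_def distrib_right sum.distrib)

lemma D0_smult: "\<rho> \<in> D0 f \<Longrightarrow> a *s \<rho> \<in> D0 f"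
  by (simp add: D0_def mult.assoc sum_distrib_left[symmetric])

lemma D0_diff: "\<rho> \<in> D0 f \<Longrightarrow> \<sigma> \<in> D0 f \<Longrightarrow> \<rho> - \<sigma> \<in> D0 f"
  by (simp add: D0_def left_diff_distrib sum_subtractf)

lemma D0_sum: "(\<And>k. k \<in> K \<Longrightarrow> g k \<in> D0 f) \<Longrightarrow> (\<Sum>k\<in>K. g k) \<in> D0 f"
proof (induction K rule: infinite_finite_induct)
  case (insert k K)
  then show ?case by (simp add: D0_add)
qed (simp_all add: D0_def)

lemma v_add:
  assumes "\<rho> \<in> D0 f" "\<sigma> \<in> D0 f"
  shows "v (\<rho> + \<sigma>) = v \<rho> + v \<sigma>"
proof -
  have "v (\<rho> + \<sigma>) * f = (v \<rho> + v \<sigma>) * f"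
    using v_mult[OF D0_add[OF assms]] v_mult[OF assms(1)] v_mult[OF assms(2)] by (simp add: phi_add distrib_right)
  then show ?thesis using f(4) by simp
qed

lemma v_smult:
  assumes "\<rho> \<in> D0 f"
  shows "v (a *s \<rho>) = a * v \<rho>"
proof -
  have "v (a *s \<rho>) * f = (a * v \<rho>) * f"
    using v_mult[OF D0_smult[OF assms]] v_mult[OF assms] by (simp add: phi_smult mult.assoc)
  then show ?thesis using f(4) by simp
qed

lemma v_diff:
  assumes "\<rho> \<in> D0 f" "\<sigma> \<in> D0 f"
  shows "v (\<rho> - \<sigma>) = v \<rho> - v \<sigma>"
  using v_add[OF D0_diff[OF assms] assms(2)] by (simp add: algebra_simps)

abbreviation B where "B \<equiv> B_ideal f rs"

lemma B_eq: "B = v ` D0 f"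
  by (auto simp: B_ideal_def)

lemma subspace_B: "S_ideal.subspace B"
proof (rule S_ideal.subspaceI)
  have "0 \<in> D0 f" by (simp add: D0_def)
  from v_smult[OF this, of 0] have "v 0 = 0" by simp
  then show "0 \<in> B" unfolding B_eq using \<open>0 \<in> D0 f\<close> by (metis imageI)
  fix x y c assume "x \<in> B"
  then obtain \<rho> where x: "x = v \<rho>" "\<rho> \<in> D0 f" by (auto simp: B_eq)
  show "c * x \<in> B" unfolding B_eq x(1) v_smult[OF x(2), symmetric] by (intro imageI D0_smult x)
  assume "y \<in> B"
  then obtain \<sigma> where y: "y = v \<sigma>" "\<sigma> \<in> D0 f" by (auto simp: B_eq)
  show "x + y \<in> B" unfolding B_eq x(1) y(1) v_add[OF x(2) y(2), symmetric] by (intro imageI D0_add x y)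
qed

text \<open>\<open>v\<close> changes degrees by \<open>1 + s0 - d\<close>, which may be negative;
  hence the comparison of \<open>s + d\<close> with \<open>1 + s0\<close>.\<close>

lemma hcomp_v:
  assumes "\<rho> \<in> D0 f"
  shows "hcomp s (v \<rho>) = (if 1 + s0 \<le> s + d then v (vhcomp (s + d - (1 + s0)) \<rho>) else 0)"
proof -
  have "hcomp s (v \<rho>) * f = hcomp (s + d) (v \<rho> * f)" by (simp add: hcomp_mult[OF f(1)])
  also have "\<dots> = hcomp (s + d) (phi \<rho>)" by (simp add: v_mult[OF assms])
  also have "\<dots> = (if 1 + s0 \<le> s + d then phi (vhcomp (s + d - (1 + s0)) \<rho>) else 0)"
    unfolding phi_def hcomp_sum hcomp_mult[OF homogeneous_cofactor] by simp
  also have "\<dots> = (if 1 + s0 \<le> s + d then v (vhcomp (s + d - (1 + s0)) \<rho>) else 0) * f"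
    using v_mult[OF vhcomp_D0[OF f(1) assms]] by simp
  finally show ?thesis using f(4) by simp
qed

lemma rs_comb_D0: "(\<Sum>k<n - 1. a k *s rs ! k) \<in> D0 f"
  by (intro D0_sum D0_smult rs_D0) simp

lemma v_eq_0_iff:
  assumes "\<rho> \<in> D0 f"
  shows "v \<rho> = 0 \<longleftrightarrow> (\<exists>a. \<rho> = (\<Sum>k<n - 1. a k *s rs ! k))"
proof -
  have im: "u_map rs ` coef_tuples (length rs) = {\<rho> \<in> D0 f. v \<rho> = 0}" using tame by (simp add: tame_def)
  show ?thesis
  proof
    assume "v \<rho> = 0"
    then have "\<rho> \<in> u_map rs ` coef_tuples (length rs)" using assms im by blast
    then show "\<exists>a. \<rho> = (\<Sum>k<n - 1. a k *s rs ! k)" by (auto simp: u_map_def len)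
  next
    assume "\<exists>a. \<rho> = (\<Sum>k<n - 1. a k *s rs ! k)"
    then obtain a where a: "\<rho> = (\<Sum>k<n - 1. a k *s rs ! k)" by blast
    let ?a = "\<lambda>k. if k < n - 1 then a k else 0"
    have "\<rho> = u_map rs ?a" unfolding u_map_def len a by (rule sum.cong) auto
    moreover have "?a \<in> coef_tuples (length rs)" by (simp add: coef_tuples_def len)
    ultimately have "\<rho> \<in> {\<rho> \<in> D0 f. v \<rho> = 0}" unfolding im[symmetric] by (rule image_eqI)
    then show "v \<rho> = 0" by simp
  qed
qed

lemma rs_independent:
  assumes "(\<Sum>k<n - 1. a k *s rs ! k) = 0" "k < n - 1"
  shows "a k = 0"
proof -
  let ?a = "\<lambda>k. if k < n - 1 then a k else 0"
  have "u_map rs ?a = (\<Sum>k<n - 1. a k *s rs ! k)" unfolding u_map_def len by (rule sum.cong) auto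
  also have "\<dots> = u_map rs (\<lambda>_. 0)" unfolding assms(1) by (simp add: u_map_def)
  finally have eq: "u_map rs ?a = u_map rs (\<lambda>_. 0)" .
  have inj: "inj_on (u_map rs) (coef_tuples (length rs))" using tame by (simp add: tame_def)
  have mem: "?a \<in> coef_tuples (length rs)" "(\<lambda>_. 0) \<in> coef_tuples (length rs)"
    by (simp_all add: coef_tuples_def len)
  have "?a = (\<lambda>_. 0)" using inj_on_eq_iff[OF inj mem] eq by blast
  then have "?a k = 0" by metis
  with assms(2) show ?thesis by simp
qed

text \<open>The tame sequence in a single degree; the hypothesis matches degree \<open>t\<close> of
  \<open>D0 f\<close> with degree \<open>s\<close> of \<open>B\<close>. The image of
  \<open>phi\<close> is \<open>f\<close> times the piece of \<open>B\<close>, and its kernel is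
  spanned by the independent syzygies \<open>rs\<close>.\<close>

lemma dim_D0_graded:
  assumes "s + d = 1 + s0 + t"
  shows "CV.dim (Homv t \<inter> D0 f) = CP.dim (Hom s \<inter> B)
    + (\<Sum>k<n - 1. if ds ! k \<le> t then mon_count TYPE('n) (t - ds ! k) else 0)"
proof -
  have lin: "Vector_Spaces.linear (\<lambda>c v. Const c *s v) (\<lambda>c (p :: 'n cpoly). Const c * p) phi"
    by unfold_locales (simp_all add: phi_add phi_smult)
  have linf: "Vector_Spaces.linear (\<lambda>c (p :: 'n cpoly). Const c * p) (\<lambda>c p. Const c * p) (\<lambda>q. q * f)"
    by unfold_locales (simp_all add: algebra_simps)
  have "phi ` (Homv t \<inter> D0 f) = (\<lambda>q. q * f) ` (Hom s \<inter> B)"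
  proof (intro subset_antisym subsetI)
    fix x assume "x \<in> phi ` (Homv t \<inter> D0 f)"
    then obtain \<rho> where \<rho>: "homogeneous_vec t \<rho>" "\<rho> \<in> D0 f" "x = phi \<rho>" by blast
    have x: "x = v \<rho> * f" using v_mult[OF \<rho>(2)] \<rho>(3) by simp
    have "homogeneous (t + (1 + s0)) x"
      unfolding \<rho>(3) phi_def using \<rho>(1)
      by (intro homogeneous_sum homogeneous_mult homogeneous_cofactor) (simp add: homogeneous_vec_def)
    then have "homogeneous (s + d) (v \<rho> * f)" using assms unfolding x by (simp add: ac_simps)
    then have "homogeneous s (v \<rho>)" using homogeneous_div(2)[OF _ f(1,4), of "s + d" "v \<rho>"] by (cases "v \<rho> = 0") auto
    then show "x \<in> (\<lambda>q. q * f) ` (Hom s \<inter> B)" using x \<rho>(2) by (auto simp: B_eq)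
  next
    fix x assume "x \<in> (\<lambda>q. q * f) ` (Hom s \<inter> B)"
    then obtain \<rho> where \<rho>: "\<rho> \<in> D0 f" "homogeneous s (v \<rho>)" "x = v \<rho> * f" by (auto simp: B_eq)
    have "v \<rho> = hcomp s (v \<rho>)" using hcomp_homogeneous[OF \<rho>(2), of s] by simp
    also have "\<dots> = v (vhcomp t \<rho>)" unfolding hcomp_v[OF \<rho>(1)] using assms by simp
    finally have "x = phi (vhcomp t \<rho>)" using \<rho>(3) v_mult[OF vhcomp_D0[OF f(1) \<rho>(1)]] by simp
    then show "x \<in> phi ` (Homv t \<inter> D0 f)" using vhcomp_D0[OF f(1) \<rho>(1)] by auto
  qed
  moreover have "CP.dim ((\<lambda>q. q * f) ` (Hom s \<inter> B)) = CP.dim (Hom s \<inter> B)"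
    by (rule CPP.dim_image_inj[OF linf])
       (use f(4) in \<open>auto intro: CP.subspace_inter ideal_imp_subspace[OF subspace_B]\<close>)
  moreover have "{\<rho> \<in> Homv t \<inter> D0 f. phi \<rho> = 0} = graded_combs {..<n - 1} ((!) rs) t"
  proof -
    have "phi \<rho> = 0 \<longleftrightarrow> v \<rho> = 0" if "\<rho> \<in> D0 f" for \<rho> using v_mult[OF that] f(4) by (metis mult_eq_0_iff)
    then show ?thesis using v_eq_0_iff rs_comb_D0 unfolding graded_combs_def by blast
  qed
  moreover have "CV.dim (graded_combs {..<n - 1} ((!) rs) t) =
      (\<Sum>k<n - 1. if ds ! k \<le> t then mon_count TYPE('n) (t - ds ! k) else 0)"
    using dim_graded_combs[of "{..<n - 1}" "(!) ds" "(!) rs" t] hom_rs rs_independent by auto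
  moreover have "CV.subspace (Homv t \<inter> D0 f)" by (intro CV.subspace_inter subspace_Homv subspace_D0)
  from CVP.rank_nullity(2)[OF lin this findim_Homv_Int]
  have "CP.dim (phi ` (Homv t \<inter> D0 f)) + CV.dim {\<rho> \<in> Homv t \<inter> D0 f. phi \<rho> = 0} = CV.dim (Homv t \<inter> D0 f)" .
  ultimately show ?thesis by simp
qed

text \<open>The homogeneous part \<tau> of \<sigma> in degree \<open>d - (1 + s0)\<close> is still
  mapped to 1. Since \<rho> - v(\<rho>) \<tau> is in the kernel of \<open>v\<close>, the syzygies
  \<open>rs\<close> and \<tau> form a basis of \<open>D0 f\<close>, and a basis is a minimal system
  of generators.\<close>

lemma free_of_section:
  assumes "\<sigma> \<in> D0 f" "v \<sigma> = 1"
  shows "free_hypersurface f"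
proof -
  have "1 = hcomp 0 (v \<sigma>)" using hcomp_homogeneous[OF homogeneous_Const[of 1], of 0] assms(2) by simp
  also have "\<dots> = (if 1 + s0 \<le> d then v (vhcomp (d - (1 + s0)) \<sigma>) else 0)" unfolding hcomp_v[OF assms(1)] by simp
  finally have "v (vhcomp (d - (1 + s0)) \<sigma>) = 1" by (auto split: if_splits)
  define \<tau> where "\<tau> = vhcomp (d - (1 + s0)) \<sigma>"
  have \<tau>: "\<tau> \<in> D0 f" "v \<tau> = 1" "homogeneous_vec (d - (1 + s0)) \<tau>"
    using vhcomp_D0[OF f(1) assms(1)] \<open>v (vhcomp (d - (1 + s0)) \<sigma>) = 1\<close> by (simp_all add: \<tau>_def)
  define ys where "ys = rs @ [\<tau>]"
  define es where "es = take (n - 1) (map ((!) ds) [0..<n - 1]) @ [d - (1 + s0)]"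
  have lys: "length ys = n" using len n2 by (simp add: ys_def)
  have les: "length es = n" using n2 by (simp add: es_def)
  have ysn: "ys ! k = (if k < n - 1 then rs ! k else \<tau>)" if "k < n" for k
    using that len by (auto simp: ys_def nth_append)
  have sum_ys: "(\<Sum>k<n. a k *s ys ! k) = (\<Sum>k<n - 1. a k *s rs ! k) + a (n - 1) *s \<tau>" for a
  proof -
    have "{..<n} = insert (n - 1) {..<n - 1}" using n2 by auto
    then have "(\<Sum>k<n. a k *s ys ! k) = a (n - 1) *s ys ! (n - 1) + (\<Sum>k<n - 1. a k *s ys ! k)" by simp
    also have "(\<Sum>k<n - 1. a k *s ys ! k) = (\<Sum>k<n - 1. a k *s rs ! k)" by (rule sum.cong) (auto simp: ysn)
    finally show ?thesis using n2 by (simp add: ysn add.commute)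
  qed
  have ind: "a k = 0" if "(\<Sum>k<n. a k *s ys ! k) = 0" "k < n" for a k
  proof -
    have "v ((\<Sum>k<n - 1. a k *s rs ! k) + a (n - 1) *s \<tau>) = a (n - 1)"
      using v_add[OF rs_comb_D0 D0_smult[OF \<tau>(1)], of a "a (n - 1)"] v_eq_0_iff[OF rs_comb_D0, of a]
        v_smult[OF \<tau>(1), of "a (n - 1)"] \<tau>(2) by auto
    moreover have "v 0 = 0" using v_smult[OF \<tau>(1), of 0] by simp
    ultimately have an: "a (n - 1) = 0" using that(1) unfolding sum_ys by simp
    then have "(\<Sum>k<n - 1. a k *s rs ! k) = 0" using that(1) unfolding sum_ys by simp
    moreover have "k < n - 1 \<or> k = n - 1" using that(2) by linarith
    ultimately show ?thesis using rs_independent an by blast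
  qed
  have D0: "D0 f = range (\<lambda>a. \<Sum>k<n. a k *s ys ! k)"
  proof (intro subset_antisym subsetI)
    fix \<rho> assume \<rho>: "\<rho> \<in> D0 f"
    let ?r = "\<rho> - v \<rho> *s \<tau>"
    have "?r \<in> D0 f" by (intro D0_diff D0_smult \<rho> \<tau>)
    moreover have "v ?r = 0" using v_diff[OF \<rho> D0_smult[OF \<tau>(1)]] v_smult[OF \<tau>(1)] \<tau>(2) by simp
    ultimately obtain a where a: "?r = (\<Sum>k<n - 1. a k *s rs ! k)" using v_eq_0_iff by blast
    let ?a = "a(n - 1 := v \<rho>)"
    have "(\<Sum>k<n - 1. ?a k *s rs ! k) = ?r" unfolding a by (rule sum.cong) auto
    then have "\<rho> = (\<Sum>k<n. ?a k *s ys ! k)" unfolding sum_ys by simp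
    then show "\<rho> \<in> range (\<lambda>a. \<Sum>k<n. a k *s ys ! k)" by blast
  next
    fix \<rho> assume "\<rho> \<in> range (\<lambda>a. \<Sum>k<n. a k *s ys ! k)"
    then obtain a where "\<rho> = (\<Sum>k<n. a k *s ys ! k)" by blast
    then show "\<rho> \<in> D0 f" unfolding sum_ys by (simp only: D0_add[OF rs_comb_D0 D0_smult[OF \<tau>(1)]])
  qed
  have not_span: "ys ! i \<notin> S_vec.span ((!) ys ` ({..<n} - {i}))" if i: "i < n" for i
  proof
    assume "ys ! i \<in> S_vec.span ((!) ys ` ({..<n} - {i}))"
    then obtain a where a: "ys ! i = (\<Sum>k\<in>{..<n} - {i}. a k *s ys ! k)" by (auto simp: vec_span_image)
    have "(\<Sum>k\<in>{..<n} - {i}. (a(i := - 1)) k *s ys ! k) = ys ! i" unfolding a by (rule sum.cong) auto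
    then have "(\<Sum>k<n. (a(i := - 1)) k *s ys ! k) = (- 1) *s ys ! i + ys ! i"
      using i by (subst sum.remove[of _ i]) auto
    also have "\<dots> = 0" by (simp add: vec_eq_iff)
    finally have "(a(i := - 1)) i = 0" using ind i by blast
    then show False by simp
  qed
  have "minimal_generators f ys es"
    unfolding minimal_generators_def
  proof (intro conjI allI impI)
    show "distinct ys"
      unfolding distinct_conv_nth lys
    proof (intro allI impI)
      fix i j assume ij: "i < n" "j < n" "i \<noteq> j"
      then have "ys ! j \<in> S_vec.span ((!) ys ` ({..<n} - {i}))" by (intro S_vec.span_base) auto
      then show "ys ! i \<noteq> ys ! j" using not_span[OF ij(1)] by metis
    qed
    show "list_all2 homogeneous_vec es ys"
      unfolding list_all2_conv_all_nth lys les
      using hom_rs \<tau>(3) by (auto simp: ysn es_def nth_append)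
    show "S_vec.span (set ys) = D0 f"
      unfolding set_conv_nth_image lys D0 by (rule vec_span_image) simp
    fix R assume "R \<subset> set ys"
    then obtain i where i: "i < n" "ys ! i \<notin> R" by (metis in_set_conv_nth lys psubset_imp_ex_mem DiffE)
    have "R \<subseteq> (!) ys ` ({..<n} - {i})"
    proof
      fix x assume x: "x \<in> R"
      then have "x \<in> set ys" using \<open>R \<subset> set ys\<close> by blast
      then obtain k where k: "k < n" "x = ys ! k" by (metis in_set_conv_nth lys)
      then have "k \<noteq> i" using x i(2) by blast
      then show "x \<in> (!) ys ` ({..<n} - {i})" using k by blast
    qed
    then have "ys ! i \<notin> S_vec.span R" using not_span[OF i(1)] S_vec.span_mono by blast
    moreover have "ys ! i \<in> D0 f" using rs_D0 \<tau>(1) i(1) by (simp add: ysn)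
    ultimately show "S_vec.span R \<noteq> D0 f" by blast
  qed
  then show ?thesis unfolding free_hypersurface_def exponents_def using les card by auto
qed

text \<open>Two lifts \<open>\<rho>\<^sub>a, \<rho>\<^sub>b\<close> of a good pair \<open>a, b \<in> B\<close> can be corrected by multiples of the \<open>\<rho>\<^sub>i\<close> so that
  \<open>a \<rho>\<^sub>b = b \<rho>\<^sub>a\<close>; their common quotient is a lift of \<open>1\<close>.\<close>

lemma section_of_good_pair:
  assumes "good_pair B a b"
  shows "\<exists>\<sigma>\<in>D0 f. v \<sigma> = 1"
proof -
  have ab: "a \<in> B" "b \<in> B" "coprime_pair a b"
    and gd: "\<And>\<phi>. (\<And>c. c \<in> B \<Longrightarrow> c * \<phi> \<in> ideal2 a b) \<Longrightarrow> \<phi> \<in> ideal2 a b"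
    using assms by (auto simp: good_pair_def)
  obtain ra rb where r: "ra \<in> D0 f" "v ra = a" "rb \<in> D0 f" "v rb = b" using ab by (auto simp: B_eq)
  have lift: "\<exists>s. x *s \<rho> - y *s \<sigma> = (\<Sum>k<n - 1. s k *s rs ! k)"
    if "\<rho> \<in> D0 f" "\<sigma> \<in> D0 f" "x * v \<rho> = y * v \<sigma>" for x y \<rho> \<sigma>
  proof -
    have "x *s \<rho> - y *s \<sigma> \<in> D0 f" by (intro D0_diff D0_smult that)
    moreover have "v (x *s \<rho> - y *s \<sigma>) = 0"
      using v_diff[OF D0_smult[OF that(1)] D0_smult[OF that(2)]] v_smult that by simp
    ultimately show ?thesis using v_eq_0_iff by blast
  qed
  obtain \<phi> where \<phi>: "a *s rb - b *s ra = (\<Sum>k<n - 1. \<phi> k *s rs ! k)"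
    using lift[OF r(3,1), of a b] r by (auto simp: mult.commute)
  have "\<phi> k \<in> ideal2 a b" if k: "k < n - 1" for k
  proof (rule gd)
    fix c assume "c \<in> B"
    then obtain rc where rc: "rc \<in> D0 f" "v rc = c" by (auto simp: B_eq)
    obtain s where s: "c *s rb - b *s rc = (\<Sum>k<n - 1. s k *s rs ! k)"
      using lift[OF r(3) rc(1), of c b] r rc by (auto simp: mult.commute)
    obtain t where t: "c *s ra - a *s rc = (\<Sum>k<n - 1. t k *s rs ! k)"
      using lift[OF r(1) rc(1), of c a] r rc by (auto simp: mult.commute)
    \<comment> \<open>Every element \<open>c\<close> of \<open>B\<close> multiplies the obstruction
      \<phi> into the ideal of \<open>a\<close> and \<open>b\<close>: expand all three differences
      in the independent \<open>rs\<close> and compare coefficients.\<close>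
    have "c *s (a *s rb - b *s ra) = a *s (c *s rb - b *s rc) - b *s (c *s ra - a *s rc)"
      by (simp add: vec_eq_iff algebra_simps)
    then have "(\<Sum>k<n - 1. (c * \<phi> k) *s rs ! k) - ((\<Sum>k<n - 1. (a * s k) *s rs ! k) - (\<Sum>k<n - 1. (b * t k) *s rs ! k)) = 0"
      unfolding \<phi> s t smult_sum_right smult_smult by simp
    then have "(\<Sum>k<n - 1. (c * \<phi> k - (a * s k - b * t k)) *s rs ! k) = 0"
      unfolding vector_sub_rdistrib sum_subtractf .
    then have "c * \<phi> k - (a * s k - b * t k) = 0" by (rule rs_independent[OF _ k])
    then have "c * \<phi> k = s k * a + (- t k) * b" by (simp add: algebra_simps)
    then show "c * \<phi> k \<in> ideal2 a b" by (rule ideal2I)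
  qed
  note in2 = this
  have "\<forall>k. \<exists>xy. k < n - 1 \<longrightarrow> \<phi> k = fst xy * a + snd xy * b"
  proof
    fix k
    show "\<exists>xy. k < n - 1 \<longrightarrow> \<phi> k = fst xy * a + snd xy * b"
    proof (cases "k < n - 1")
      case True
      from in2[OF this] obtain x y where "\<phi> k = x * a + y * b" by (auto simp: ideal2_def)
      then show ?thesis by (intro exI[of _ "(x, y)"]) simp
    qed simp
  qed
  from choice[OF this] obtain h where h: "\<And>k. k < n - 1 \<Longrightarrow> \<phi> k = fst (h k) * a + snd (h k) * b" by blast
  define ra' rb' where "ra' = ra + (\<Sum>k<n - 1. snd (h k) *s rs ! k)" and "rb' = rb - (\<Sum>k<n - 1. fst (h k) *s rs ! k)"
  have "(\<Sum>k<n - 1. \<phi> k *s rs ! k) = a *s (\<Sum>k<n - 1. fst (h k) *s rs ! k) + b *s (\<Sum>k<n - 1. snd (h k) *s rs ! k)"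
    unfolding smult_sum_right smult_smult sum.distrib[symmetric] vector_sadd_rdistrib[symmetric]
    by (rule sum.cong) (simp_all add: h mult.commute)
  then have eq: "a *s rb' = b *s ra'"
    using \<phi> by (simp add: ra'_def rb'_def vec_eq_iff algebra_simps)
  have "\<exists>c. ra' $ j = a * c" for j
  proof -
    have "rb' $ j * a = ra' $ j * b" using eq by (simp add: vec_eq_iff mult.commute)
    then show ?thesis using coprime_pair_cancel[OF ab(3)] by blast
  qed
  then obtain g where g: "\<And>j. ra' $ j = a * g j" by metis
  define \<sigma> where "\<sigma> = (\<chi> j. g j)"
  have \<sigma>: "ra' = a *s \<sigma>" by (simp add: vec_eq_iff \<sigma>_def g)
  have a0: "a \<noteq> 0" using ab(3) by (simp add: coprime_pair_def)
  have ra': "ra' \<in> D0 f" unfolding ra'_def by (intro D0_add r rs_comb_D0)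
  have "a * (\<Sum>j\<in>UNIV. \<sigma> $ j * partial_deriv j f) = 0"
    using ra' unfolding \<sigma> D0_def by (simp add: sum_distrib_left mult.assoc)
  then have \<sigma>D: "\<sigma> \<in> D0 f" using a0 by (simp add: D0_def)
  have "a * v \<sigma> = v ra'" unfolding \<sigma> by (rule v_smult[OF \<sigma>D, symmetric])
  also have "\<dots> = a" unfolding ra'_def using v_add[OF r(1) rs_comb_D0] v_eq_0_iff[OF rs_comb_D0] r(2) by auto
  finally have "v \<sigma> = 1" using a0 by simp
  with \<sigma>D show ?thesis by blast
qed

end

section \<open>Hilbert polynomials in the tame case\<close>

context tame_hypersurface
begin

text \<open>Real-valued because the last entry, the substitute for the missing exponent, may be
  negative. It makes the sum equal to d - 1, as for the exponents of a free hypersurface.\<close>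

definition delta :: "nat \<Rightarrow> real" where
  "delta i = (if i = n - 1 then real d - 1 - (\<Sum>j<n - 1. real (ds ! j)) else real (ds ! i))"

lemma lessThan_n: "{..<n} = insert (n - 1) {..<n - 1}"
  using n2 by auto

lemma sum_delta: "(\<Sum>i<n. delta i) = real (d - 1)"
proof -
  have "(\<Sum>i<n - 1. delta i) = (\<Sum>i<n - 1. real (ds ! i))" by (rule sum.cong) (auto simp: delta_def)
  then show ?thesis unfolding lessThan_n using f(3) by (simp add: delta_def of_nat_diff)
qed

text \<open>The Hilbert polynomial of S/B up to a shift, as \<open>defect_poly_eventually\<close>
  shows: the amount by which \<open>D0 f\<close> falls short of a free module with degrees
  \<open>delta\<close>.\<close>

definition defect_poly :: "real poly" where
  "defect_poly = free_hilbert_poly n (real (d - 1)) delta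
     - shift (real (d - 1)) (hilbert_polynomial (jacobian_ideal f))"

lemma hilbert_polynomial_eventually:
  "\<exists>T. \<forall>t\<ge>T. real (hilbert_function (jacobian_ideal f) (t + (d - 1))) =
     poly (shift (real (d - 1)) (hilbert_polynomial (jacobian_ideal f))) (real t)"
proof -
  obtain h T where h: "\<forall>t\<ge>T. poly h (real t) = real (hilbert_function (jacobian_ideal f) t)"
    using hilbert_function_eventually_poly[OF hideal_jacobian[OF f(1)]] by blast
  then have "hilbert_polynomial (jacobian_ideal f) = h" by (intro hilbert_polynomial_eqI) blast
  then show ?thesis using h by (intro exI[of _ T]) (simp add: poly_shift flip: of_nat_add)
qed

lemma defect_poly_eventually:
  "\<exists>T. \<forall>t\<ge>T. d \<le> 1 + s0 + t \<and> poly defect_poly (real t) = real (hilbert_function B (1 + s0 + t - d))"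
proof -
  obtain T where T: "\<forall>t\<ge>T. real (hilbert_function (jacobian_ideal f) (t + (d - 1))) =
     poly (shift (real (d - 1)) (hilbert_polynomial (jacobian_ideal f))) (real t)"
    using hilbert_polynomial_eventually by blast
  have "d \<le> 1 + s0 + t \<and> poly defect_poly (real t) = real (hilbert_function B (1 + s0 + t - d))"
    \<comment> \<open>Large enough that no truncated subtraction below cuts anything off:
      \<open>t\<close> exceeds \<open>d\<close> and every degree \<open>ds ! k\<close>.\<close>
    if t: "t \<ge> T + d + s0" for t
  proof
    show dt: "d \<le> 1 + s0 + t" using t by simp
    define s where "s = 1 + s0 + t - d"
    have s: "s + d = 1 + s0 + t" using dt by (simp add: s_def)
    have dst: "ds ! k \<le> t" if "k < n - 1" for k
    proof -
      have "ds ! k \<le> s0" unfolding s0_def by (rule member_le_sum) (use that in auto)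
      then show ?thesis using t by simp
    qed
    have "(\<Sum>k<n - 1. if ds ! k \<le> t then mon_count TYPE('n) (t - ds ! k) else 0) =
        (\<Sum>k<n - 1. mon_count TYPE('n) (t - ds ! k))" by (rule sum.cong) (simp_all add: dst)
    then have "hilbert_function (jacobian_ideal f) (t + (d - 1)) + CARD('n) * mon_count TYPE('n) t + hilbert_function B s =
        mon_count TYPE('n) (t + (d - 1)) + (\<Sum>k<n - 1. mon_count TYPE('n) (t - ds ! k)) + mon_count TYPE('n) s"
      using hilbert_function_jacobian[OF f(1), of t] dim_D0_graded[OF s] hilbert_function_eq[OF subspace_B, of s]
      by (simp add: dim_Hom mon_count_def)
    then have "real (hilbert_function (jacobian_ideal f) (t + (d - 1)) + CARD('n) * mon_count TYPE('n) t + hilbert_function B s) =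
        real (mon_count TYPE('n) (t + (d - 1)) + (\<Sum>k<n - 1. mon_count TYPE('n) (t - ds ! k)) + mon_count TYPE('n) s)"
      by (simp only:)
    then have main: "real (hilbert_function (jacobian_ideal f) (t + (d - 1))) + (real n + 1) * real (mon_count TYPE('n) t)
          + real (hilbert_function B s) =
        real (mon_count TYPE('n) (t + (d - 1))) + (\<Sum>k<n - 1. real (mon_count TYPE('n) (t - ds ! k))) + real (mon_count TYPE('n) s)"
      unfolding card by (simp add: algebra_simps)
    let ?P = "binom_poly n"
    have "real s = real t - (real d - 1 - (\<Sum>j<n - 1. real (ds ! j)))"
      using s by (simp add: s0_def of_nat_diff flip: of_nat_sum)
    then have last: "poly ?P (real t - delta (n - 1)) = real (mon_count TYPE('n) s)"
      unfolding delta_def mon_count_poly[OF card] by simp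
    have "(\<Sum>i<n. poly ?P (real t - delta i)) =
        poly ?P (real t - delta (n - 1)) + (\<Sum>i<n - 1. poly ?P (real t - delta i))"
      unfolding lessThan_n by simp
    also have "(\<Sum>i<n - 1. poly ?P (real t - delta i)) = (\<Sum>k<n - 1. real (mon_count TYPE('n) (t - ds ! k)))"
      by (rule sum.cong) (auto simp: delta_def mon_count_poly[OF card] of_nat_diff dst)
    finally have "(\<Sum>i<n. poly ?P (real t - delta i)) =
        real (mon_count TYPE('n) s) + (\<Sum>k<n - 1. real (mon_count TYPE('n) (t - ds ! k)))"
      unfolding last .
    moreover have "real (hilbert_function (jacobian_ideal f) (t + (d - 1))) =
        poly (shift (real (d - 1)) (hilbert_polynomial (jacobian_ideal f))) (real t)" using T t by simp
    moreover have "real (mon_count TYPE('n) (t + (d - 1))) = poly ?P (real t + real (d - 1))"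
      by (simp only: mon_count_poly[OF card] of_nat_add)
    ultimately show "poly defect_poly (real t) = real (hilbert_function B (1 + s0 + t - d))"
      using main unfolding defect_poly_def free_hilbert_poly_def s_def[symmetric]
      by (simp add: poly_sum poly_shift mon_count_poly[OF card] algebra_simps)
  qed
  then show ?thesis by blast
qed

lemma degree_defect_poly: "degree defect_poly \<le> n - 2"
proof (rule degree_le, intro allI impI)
  fix j assume j: "n - 2 < j"
  let ?F = "free_hilbert_poly n (real (d - 1)) delta"
  obtain T where T: "\<forall>t\<ge>T. real (hilbert_function (jacobian_ideal f) (t + (d - 1))) =
     poly (shift (real (d - 1)) (hilbert_polynomial (jacobian_ideal f))) (real t)"
    using hilbert_polynomial_eventually by blast
  have "coeff (shift (real (d - 1)) (hilbert_polynomial (jacobian_ideal f))) j = 0"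
    using hilbert_polynomial_jacobian(2)[OF hyp card n2 T] j by (intro coeff_eq_0) linarith
  moreover have "coeff ?F j = 0"
  proof (cases "j \<ge> n")
    case True
    then show ?thesis by (rule coeff_free_hilbert_poly_high)
  next
    case False
    then have "j = n - 1" using j n2 by linarith
    then show ?thesis using coeff_free_hilbert_poly_1[of n "real (d - 1)" delta] n2 sum_delta by simp
  qed
  ultimately show "coeff defect_poly j = 0" by (simp add: defect_poly_def)
qed

lemma coeff_defect_poly_nonneg: "0 \<le> coeff defect_poly (n - 2)"
proof -
  obtain T where "\<forall>t\<ge>T. d \<le> 1 + s0 + t \<and> poly defect_poly (real t) = real (hilbert_function B (1 + s0 + t - d))"
    using defect_poly_eventually by blast
  then show ?thesis by (intro poly_eventually_nonneg_coeff[OF degree_defect_poly, of T]) simp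
qed

lemma sing_degree_defect:
  assumes "sing_dimension f = int n - 2"
  shows "sing_degree f = (real d - 1) ^ 2 - pair_sum n delta - fact (n - 2) * coeff defect_poly (n - 2)"
proof -
  obtain T where T: "\<forall>t\<ge>T. real (hilbert_function (jacobian_ideal f) (t + (d - 1))) =
     poly (shift (real (d - 1)) (hilbert_polynomial (jacobian_ideal f))) (real t)"
    using hilbert_polynomial_eventually by blast
  have "coeff defect_poly (n - 2) = (real (d - 1) ^ 2 - pair_sum n delta) / fact (n - 2)
      - coeff (hilbert_polynomial (jacobian_ideal f)) (n - 2)"
    unfolding defect_poly_def coeff_diff coeff_free_hilbert_poly_2[OF n2 sum_delta]
      hilbert_polynomial_jacobian(3)[OF hyp card n2 T] ..
  then show ?thesis using f(3) by (simp add: sing_degree_eq[OF assms n2] of_nat_diff field_simps)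
qed

text \<open>Otherwise the polynomial ring in n - 1 of these variables would embed in S/B. Its
  Hilbert polynomial has degree n - 2 with leading coefficient 1/(n - 2)!, so the corresponding
  coefficient of \<open>defect_poly\<close> could not be 0.\<close>

lemma B_meets_Svars:
  assumes c0: "coeff defect_poly (n - 2) = 0" and W: "CARD('n) \<le> card W + 2"
  shows "\<exists>p\<in>B. p \<noteq> 0 \<and> p \<in> Svars W"
proof (rule ccontr)
  assume no: "\<not> (\<exists>p\<in>B. p \<noteq> 0 \<and> p \<in> Svars W)"
  have "n - 1 \<le> card W" using W card by simp
  then obtain W' where W': "W' \<subseteq> W" "card W' = n - 1" using obtain_subset_with_card_n by metis
  then have "W' \<noteq> {}" using n2 by auto
  have bound: "(n - 2 + s choose s) \<le> hilbert_function B s" for s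
  proof -
    let ?U = "{p :: 'n cpoly. Poly_Mapping.keys p \<subseteq> mons_in W' s}"
    have U: "CP.subspace ?U" unfolding span_monomials[symmetric] by (rule CP.subspace_span)
    have UH: "?U \<subseteq> Hom s" by (auto simp: homogeneous_def mons_in_def)
    have "?U \<inter> (Hom s \<inter> B) \<subseteq> {0}"
    proof
      fix p assume p: "p \<in> ?U \<inter> (Hom s \<inter> B)"
      have "p \<in> Svars W"
        unfolding Svars_def deg_in_eq_0_iff
      proof (intro CollectI allI impI ballI)
        fix i m assume "i \<notin> W" "m \<in> Poly_Mapping.keys p"
        then have "m \<in> mons_in W' s" "i \<notin> W'" using p W'(1) by blast+
        then show "Poly_Mapping.lookup m i = 0" by (auto simp: mons_in_def in_keys_iff)
      qed
      then show "p \<in> {0}" using no p by blast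
    qed
    then have "?U \<inter> (Hom s \<inter> B) = {0}"
      using CP.subspace_0[OF U] CP.subspace_0[OF subspace_Hom, of s] S_ideal.subspace_0[OF subspace_B] by auto
    then have "CP.dim (?U \<inter> (Hom s \<inter> B)) = 0" by simp
    moreover have "CP.subspace (Hom s \<inter> B)" by (intro CP.subspace_inter subspace_Hom ideal_imp_subspace[OF subspace_B])
    note CP.dim_sum_Int(1)[OF U this dim_monomials(2)[OF finite_mons_in] findim_Hom_Int]
    moreover have "{u + w | u w. u \<in> ?U \<and> w \<in> Hom s \<inter> B} \<subseteq> Hom s" using UH homogeneous_add by blast
    then have "CP.dim {u + w | u w. u \<in> ?U \<and> w \<in> Hom s \<inter> B} \<le> CP.dim (Hom s :: 'n cpoly set)"
      by (rule CP.dim_mono_findim) simp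
    ultimately have "card (mons_in W' s) + CP.dim (Hom s \<inter> B) \<le> CP.dim (Hom s :: 'n cpoly set)"
      by (simp add: dim_monomials(1))
    moreover have "card (mons_in W' s) = (n - 2 + s choose s)"
    proof -
      have "n - 1 - 1 = n - 2" by simp
      then show ?thesis using card_mons_in[OF \<open>W' \<noteq> {}\<close>, of s] W'(2) by simp
    qed
    ultimately show ?thesis using hilbert_function_eq[OF subspace_B, of s] by linarith
  qed
  obtain T where T: "\<forall>t\<ge>T. d \<le> 1 + s0 + t \<and> poly defect_poly (real t) = real (hilbert_function B (1 + s0 + t - d))"
    using defect_poly_eventually by blast
  define Q where "Q = defect_poly - shift (1 + real s0 - real d) (binom_poly (n - 2))"
  have "0 \<le> poly Q (real t)" if "t \<ge> T" for t
  proof -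
    let ?s = "1 + s0 + t - d"
    have t: "d \<le> 1 + s0 + t" "poly defect_poly (real t) = real (hilbert_function B ?s)" using T that by auto
    have "real t + (1 + real s0 - real d) = real ?s" using t(1) by (simp add: of_nat_diff)
    then have "poly Q (real t) = real (hilbert_function B ?s) - real (n - 2 + ?s choose ?s)"
      by (simp only: Q_def poly_diff poly_shift t(2) poly_binom_poly)
    then show ?thesis using bound[of ?s] by simp
  qed
  moreover have "degree Q \<le> n - 2"
    unfolding Q_def by (intro degree_diff_le degree_defect_poly) (simp add: degree_shift degree_binom_poly)
  ultimately have "0 \<le> coeff Q (n - 2)" by (intro poly_eventually_nonneg_coeff[of Q "n - 2" T])
  moreover have "coeff Q (n - 2) = - (1 / fact (n - 2))"
    unfolding Q_def coeff_diff c0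
    by (simp add: coeff_shift_top degree_binom_poly lead_coeff_binom_poly)
  ultimately show False using fact_gt_zero[of "n - 2", where 'a = real] by simp
qed

lemma free_of_equality:
  assumes "coeff defect_poly (n - 2) = 0"
  shows "free_hypersurface f"
proof -
  have "\<exists>a b. good_pair B a b"
    by (rule good_pair_exists[OF subspace_B, of UNIV]) (rule B_meets_Svars[OF assms])
  then obtain a b where "good_pair B a b" by blast
  then obtain \<sigma> where "\<sigma> \<in> D0 f" "v \<sigma> = 1" using section_of_good_pair by blast
  then show ?thesis by (rule free_of_section)
qed

theorem sing_degree_bound:
  assumes "sing_dimension f = int n - 2"
  shows "sing_degree f \<le> (real d - 1) ^ 2 - pair_sum n delta"
    "sing_degree f = (real d - 1) ^ 2 - pair_sum n delta \<Longrightarrow> free_hypersurface f"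
proof -
  note sing_degree_defect[OF assms]
  moreover have "0 \<le> fact (n - 2) * coeff defect_poly (n - 2)" using coeff_defect_poly_nonneg by simp
  ultimately show "sing_degree f \<le> (real d - 1) ^ 2 - pair_sum n delta" by linarith
next
  assume "sing_degree f = (real d - 1) ^ 2 - pair_sum n delta"
  then have "fact (n - 2) * coeff defect_poly (n - 2) = 0" using sing_degree_defect[OF assms] by linarith
  then show "free_hypersurface f" by (intro free_of_equality) simp
qed

end

section \<open>The degree formula and the degree bound\<close>

lemma pair_sum_cong: "(\<And>i. i < n \<Longrightarrow> e i = e' i) \<Longrightarrow> pair_sum n e = pair_sum n e'"
  unfolding pair_sum_def by (rule sum.cong) auto

theorem theorem4p3:
  fixes n :: nat
  assumes n_ge_2: "2 \<le> n"
    and card_vars: "CARD('n::{finite,linorder}) = n + 1"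
  shows
    "(\<forall>(f :: 'n cpoly) d ds.
        hypersurface d f \<and> free_hypersurface f \<and> exponents f ds \<and> length ds = n \<longrightarrow>
          sing_dimension f = int n - 2 \<and>
          sing_degree f = (real d - 1)^2 - pair_sum n (\<lambda>i. real (ds ! i)))
     \<and>
     (\<forall>(f' :: 'n cpoly) d' rs' ds' m.
        hypersurface d' f' \<and> minimal_generators f' rs' ds' \<and> length rs' = m \<and> n \<le> m \<and>
        tame f' (take (n - 1) rs') \<and> sing_dimension f' = int n - 2 \<longrightarrow>
          (let d'' = real d' - 1 - (\<Sum>j<n - 1. real (ds' ! j));
               bound = (real d' - 1)^2
                         - pair_sum n (\<lambda>i. if i = n - 1 then d'' else real (ds' ! i))
           in sing_degree f' \<le> bound \<and>
              (sing_degree f' = bound \<longleftrightarrow> free_hypersurface f') \<and>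
              (free_hypersurface f' \<longrightarrow> m = n)))"
proof (intro conjI allI impI)
  fix f :: "'n cpoly" and d ds
  assume "hypersurface d f \<and> free_hypersurface f \<and> exponents f ds \<and> length ds = n"
  then obtain rs where hyp: "hypersurface d f" and rs: "minimal_generators f rs ds" and "length ds = n"
    by (auto simp: exponents_def)
  then have "length rs = n" using minimal_generatorsD(1)[OF rs] by simp
  from free_hypersurface_singular_locus[OF hyp card_vars n_ge_2 rs this]
  show "sing_dimension f = int n - 2"
    and "sing_degree f = (real d - 1)^2 - pair_sum n (\<lambda>i. real (ds ! i))" by blast+
next
  fix f' :: "'n cpoly" and d' rs' ds' m
  assume "hypersurface d' f' \<and> minimal_generators f' rs' ds' \<and> length rs' = m \<and> n \<le> m \<and>
        tame f' (take (n - 1) rs') \<and> sing_dimension f' = int n - 2"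
  then have hyp: "hypersurface d' f'" and rs: "minimal_generators f' rs' ds'" and m: "length rs' = m" "n \<le> m"
    and tame: "tame f' (take (n - 1) rs')" and dim: "sing_dimension f' = int n - 2" by blast+
  note gen = minimal_generatorsD[OF rs]
  interpret tame_hypersurface f' d' n "take (n - 1) rs'" ds'
    by unfold_locales (use hyp card_vars n_ge_2 m tame gen(2,4) in auto)
  have delta: "(\<lambda>i. if i = n - 1 then real d' - 1 - (\<Sum>j<n - 1. real (ds' ! j)) else real (ds' ! i)) = delta"
    by (simp add: delta_def fun_eq_iff)
  have free: "m = n \<and> sing_degree f' = (real d' - 1)^2 - pair_sum n delta" if fr: "free_hypersurface f'"
  proof
    obtain es where "exponents f' es" "length es = CARD('n) - 1"
      using fr unfolding free_hypersurface_def by blast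
    then obtain qs where "minimal_generators f' qs es" "length es = n"
      using card_vars unfolding exponents_def by auto
    then show mn: "m = n"
      using minimal_generators_length_unique[OF rs] minimal_generatorsD(1) m(1) by metis
    note free = free_hypersurface_singular_locus[OF hyp card_vars n_ge_2 rs]
    \<comment> \<open>For a free hypersurface the exponents sum to d' - 1, so the substitute d_n''
      is the actual last exponent and the bound is the degree formula of the free case.\<close>
    have sum: "(\<Sum>i<n. ds' ! i) = d' - 1" using free(1) mn m(1) by simp
    have "delta i = real (ds' ! i)" if "i < n" for i
    proof (cases "i = n - 1")
      case True
      have "(\<Sum>i<n. ds' ! i) = ds' ! (n - 1) + (\<Sum>i<n - 1. ds' ! i)" unfolding lessThan_n by simp
      then have "real (ds' ! (n - 1) + (\<Sum>i<n - 1. ds' ! i)) = real (d' - 1)" using sum by simp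
      then show ?thesis using True f(3) by (simp add: delta_def of_nat_diff)
    qed (simp add: delta_def)
    then have "pair_sum n delta = pair_sum n (\<lambda>i. real (ds' ! i))" by (rule pair_sum_cong)
    then show "sing_degree f' = (real d' - 1)^2 - pair_sum n delta" using free(3) mn m(1) by simp
  qed
  show "let d'' = real d' - 1 - (\<Sum>j<n - 1. real (ds' ! j));
            bound = (real d' - 1)^2 - pair_sum n (\<lambda>i. if i = n - 1 then d'' else real (ds' ! i))
        in sing_degree f' \<le> bound \<and>
           (sing_degree f' = bound \<longleftrightarrow> free_hypersurface f') \<and>
           (free_hypersurface f' \<longrightarrow> m = n)"
    unfolding Let_def delta using sing_degree_bound[OF dim] free by blast
qed

end
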